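(* Let $g_0$ be the Gauss diagram with $9$ chords on the points $0,1,\dots,17$ whose chords are $$\{0,5\},\{1,8\},\{2,9\},\{3,14\},\{4,15\},\{6,13\},\{7,12\},\{10,17\},\{11,16\}.$$ Then $g_0$ is a prime Gauss diagram that satisfies both the B-conditions and the GL-conditions but is not realizable. Moreover, $g_0$ is a minimal such diagram and the only one of its size up to equivalence: every prime Gauss diagram with at most $8$ chords that satisfies both the B-conditions and the GL-conditions is realizable, and every non-realizable prime Gauss diagram with exactly $9$ chords that satisfies both the B-conditions and the GL-conditions is isomorphic to $g_0$.
   Context: Gauss diagrams. For $n\ge 1$, a Gauss diagram of size $n$ (with $n$ chords) is a partition of the set of points $\{0,1,\dots,2n-1\}$ into $n$ two-element subsets, called chords. The points are thought of as placed on a circle in this cyclic order, so that $i$ is followed by $i+1 \bmod 2n$. Two Gauss diagrams of size $n$ are isomorphic (equivalent) if one is obtained from the other by applying to all points a map of the form $x\mapsto x+s \bmod 2n$ or $x\mapsto -x+s \bmod 2n$ for some integer $s$. Double occurrence words. A double occurrence word is a word $w=a_0a_1\cdots a_{2n-1}$ in which each occurring letter appears exactly twice. Its Gauss diagram $g(w)$ has the chords $\{i,j\}$ with $i<j$ and $a_i=a_j$. Realizability. Take a generic smoothly immersed closed curve in the plane $\mathbb{R}^2$ (equivalently, in the sphere $S^2$), i.e. one whose only self-intersections are finitely many transverse double points. Assign distinct letters to its double points, and traverse the curve once from a non-double point, writing down the letters of the double points in the order in which they are passed. The resulting double occurrence word is associated with the curve. A double occurrence word is realizable if it is associated with some such curve.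 A Gauss diagram $g$ is realizable if there is a realizable word $w$ such that $g$ is isomorphic to $g(w)$. Interlacement graph. The interlacement graph $I_g$ of a Gauss diagram $g$ is the simple undirected graph whose vertices are the chords of $g$. Two chords $\{i,j\}$ with $i<j$ and $\{k,l\}$ with $k<l$ are adjacent if and only if $i<k<j<l$ or $k<i<l<j$. The diagram $g$ is prime if $I_g$ is connected. Conditions on a simple graph $I=(V,E)$. (C1) Every vertex has even degree. (C2) Every pair of distinct non-adjacent vertices has an even number (possibly zero) of common neighbours. (B3) For any three pairwise adjacent vertices $a,b,c\in V$, the following sum is even: the number of vertices $w\notin\{a,b,c\}$ adjacent to $a$ but to neither $b$ nor $c$, plus the number of vertices $w\notin\{a,b,c\}$ adjacent to both $b$ and $c$ but not to $a$. Reduced graph. For $v\in V$, the reduced graph $I/v$ has vertex set $V\setminus\{v\}$. Two distinct vertices $v_1,v_2$ of it are adjacent in $I/v$ if and only if either $v_1,v_2$ are adjacent in $I$ and at least one of them is not adjacent to $v$ in $I$, or $v_1,v_2$ are not adjacent in $I$ and both are adjacent to $v$ in $I$. A prime Gauss diagram $g$ satisfies the B-conditions if $I_g$ satisfies (C1), (C2) and (B3). It satisfies the GL-conditions if $I_g$ satisfies (C1), $I_g$ satisfies (C2), and for every vertex $v$ of $I_g$ the reduced graph $I_g/v$ satisfies (C2). *)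

theory Defs
  imports "HOL-Analysis.Analysis" "HOL-Library.Disjoint_Sets"
begin

section \<open>Gauss diagrams\<close>

definition gauss_diagram :: "nat \<Rightarrow> nat set set \<Rightarrow> bool" where
  "gauss_diagram n g \<longleftrightarrow>
     n \<ge> 1 \<and> partition_on {0..<2 * n} g \<and> card g = n \<and> (\<forall>c\<in>g. card c = 2)"

definition rotate_pt :: "nat \<Rightarrow> int \<Rightarrow> nat \<Rightarrow> nat" where
  "rotate_pt n s x = nat ((int x + s) mod int (2 * n))"

definition reflect_pt :: "nat \<Rightarrow> int \<Rightarrow> nat \<Rightarrow> nat" where
  "reflect_pt n s x = nat ((- int x + s) mod int (2 * n))"

definition diagram_iso :: "nat \<Rightarrow> nat set set \<Rightarrow> nat set set \<Rightarrow> bool" where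
  "diagram_iso n g h \<longleftrightarrow>
     gauss_diagram n g \<and> gauss_diagram n h \<and>
     (\<exists>s. h = (\<lambda>c. rotate_pt n s ` c) ` g \<or> h = (\<lambda>c. reflect_pt n s ` c) ` g)"

section \<open>Double occurrence words\<close>

definition double_occurrence_word :: "'a list \<Rightarrow> bool" where
  "double_occurrence_word w \<longleftrightarrow> (\<forall>a\<in>set w. count_list w a = 2)"

definition word_diagram :: "'a list \<Rightarrow> nat set set" where
  "word_diagram w = {{i, j} | i j. i < j \<and> j < length w \<and> w ! i = w ! j}"

section \<open>Generic closed curves and realizability\<close>

text \<open>The plane is \<open>complex\<close>, with its structure of a real vector space, and the circle is the
  real line modulo 1: a closed curve is a 1-periodic map, so that smoothness also holds across
  the endpoints of a period.\<close>

definition smooth_curve :: "(real \<Rightarrow> complex) \<Rightarrow> bool" where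
  "smooth_curve \<gamma> \<longleftrightarrow>
     (\<forall>k t. ((\<lambda>f u. vector_derivative f (at u)) ^^ k) \<gamma> differentiable (at t))"

definition immersed_closed_curve :: "(real \<Rightarrow> complex) \<Rightarrow> bool" where
  "immersed_closed_curve \<gamma> \<longleftrightarrow>
     (\<forall>t. \<gamma> (t + 1) = \<gamma> t) \<and> smooth_curve \<gamma> \<and> (\<forall>t. vector_derivative \<gamma> (at t) \<noteq> 0)"

definition self_intersections :: "(real \<Rightarrow> complex) \<Rightarrow> complex set" where
  "self_intersections \<gamma> = {p. \<exists>s\<in>{0..<1}. \<exists>t\<in>{0..<1}. s \<noteq> t \<and> \<gamma> s = p \<and> \<gamma> t = p}"

definition generic_closed_curve :: "(real \<Rightarrow> complex) \<Rightarrow> bool" where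
  "generic_closed_curve \<gamma> \<longleftrightarrow>
     immersed_closed_curve \<gamma> \<and>
     finite (self_intersections \<gamma>) \<and>
     (\<forall>p\<in>self_intersections \<gamma>. card {t\<in>{0..<1}. \<gamma> t = p} = 2) \<and>
     (\<forall>s\<in>{0..<1}. \<forall>t\<in>{0..<1}. s \<noteq> t \<and> \<gamma> s = \<gamma> t \<longrightarrow>
        span {vector_derivative \<gamma> (at s), vector_derivative \<gamma> (at t)} = UNIV)"

text \<open>The function \<open>lab\<close> names the double points; \<open>b\<close> is the base point of the traversal.\<close>

definition associated_word :: "(real \<Rightarrow> complex) \<Rightarrow> 'a list \<Rightarrow> bool" where
  "associated_word \<gamma> w \<longleftrightarrow>
     (\<exists>lab b. inj_on lab (self_intersections \<gamma>) \<and> \<gamma> b \<notin> self_intersections \<gamma> \<and>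
        w = map (\<lambda>t. lab (\<gamma> t))
              (sorted_list_of_set {t\<in>{b<..<b + 1}. \<gamma> t \<in> self_intersections \<gamma>}))"

definition realizable_word :: "'a list \<Rightarrow> bool" where
  "realizable_word w \<longleftrightarrow>
     double_occurrence_word w \<and> (\<exists>\<gamma>. generic_closed_curve \<gamma> \<and> associated_word \<gamma> w)"

definition realizable_diagram :: "nat \<Rightarrow> nat set set \<Rightarrow> bool" where
  "realizable_diagram n g \<longleftrightarrow>
     (\<exists>w :: nat list. realizable_word w \<and> diagram_iso n g (word_diagram w))"

section \<open>Simple graphs\<close>

record 'a graph =
  verts :: "'a set"
  adj :: "'a \<Rightarrow> 'a \<Rightarrow> bool"

definition simple_graph :: "'a graph \<Rightarrow> bool" where
  "simple_graph G \<longleftrightarrow>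
     (\<forall>u v. adj G u v \<longrightarrow> u \<in> verts G \<and> v \<in> verts G \<and> u \<noteq> v \<and> adj G v u)"

definition connected_graph :: "'a graph \<Rightarrow> bool" where
  "connected_graph G \<longleftrightarrow>
     verts G \<noteq> {} \<and> (\<forall>u\<in>verts G. \<forall>v\<in>verts G. (u, v) \<in> {(x, y). adj G x y}\<^sup>*)"

definition cond_C1 :: "'a graph \<Rightarrow> bool" where
  "cond_C1 G \<longleftrightarrow> (\<forall>v\<in>verts G. even (card {u\<in>verts G. adj G v u}))"

definition cond_C2 :: "'a graph \<Rightarrow> bool" where
  "cond_C2 G \<longleftrightarrow>
     (\<forall>u\<in>verts G. \<forall>v\<in>verts G. u \<noteq> v \<and> \<not> adj G u v \<longrightarrow>
        even (card {w\<in>verts G. adj G u w \<and> adj G v w}))"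

definition cond_B3 :: "'a graph \<Rightarrow> bool" where
  "cond_B3 G \<longleftrightarrow>
     (\<forall>a\<in>verts G. \<forall>b\<in>verts G. \<forall>c\<in>verts G. adj G a b \<and> adj G b c \<and> adj G a c \<longrightarrow>
        even (card {w\<in>verts G - {a, b, c}. adj G w a \<and> \<not> adj G w b \<and> \<not> adj G w c} +
              card {w\<in>verts G - {a, b, c}. adj G w b \<and> adj G w c \<and> \<not> adj G w a}))"

definition reduced_graph :: "'a graph \<Rightarrow> 'a \<Rightarrow> 'a graph" where
  "reduced_graph G v =
     \<lparr>verts = verts G - {v},
      adj = (\<lambda>x y. x \<in> verts G - {v} \<and> y \<in> verts G - {v} \<and> x \<noteq> y \<and>
               (adj G x y \<and> (\<not> adj G x v \<or> \<not> adj G y v) \<or>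
                \<not> adj G x y \<and> adj G x v \<and> adj G y v))\<rparr>"

section \<open>Interlacement graphs and the conditions on Gauss diagrams\<close>

definition interlaced :: "nat set \<Rightarrow> nat set \<Rightarrow> bool" where
  "interlaced c d \<longleftrightarrow>
     (\<exists>i j k l. c = {i, j} \<and> i < j \<and> d = {k, l} \<and> k < l \<and>
        (i < k \<and> k < j \<and> j < l \<or> k < i \<and> i < l \<and> l < j))"

definition interlacement_graph :: "nat set set \<Rightarrow> nat set graph" where
  "interlacement_graph g =
     \<lparr>verts = g, adj = (\<lambda>c d. c \<in> g \<and> d \<in> g \<and> interlaced c d)\<rparr>"

lemma simple_graph_interlacement_graph: "simple_graph (interlacement_graph g)"
  by (fastforce simp: simple_graph_def interlacement_graph_def interlaced_def doubleton_eq_iff)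

lemma simple_graph_reduced_graph: "simple_graph G \<Longrightarrow> simple_graph (reduced_graph G v)"
  unfolding simple_graph_def reduced_graph_def by auto

definition prime_diagram :: "nat set set \<Rightarrow> bool" where
  "prime_diagram g \<longleftrightarrow> connected_graph (interlacement_graph g)"

definition B_conditions :: "nat set set \<Rightarrow> bool" where
  "B_conditions g \<longleftrightarrow>
     cond_C1 (interlacement_graph g) \<and> cond_C2 (interlacement_graph g) \<and>
     cond_B3 (interlacement_graph g)"

definition GL_conditions :: "nat set set \<Rightarrow> bool" where
  "GL_conditions g \<longleftrightarrow>
     cond_C1 (interlacement_graph g) \<and> cond_C2 (interlacement_graph g) \<and>
     (\<forall>v\<in>verts (interlacement_graph g). cond_C2 (reduced_graph (interlacement_graph g) v))"

definition g0 :: "nat set set" where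
  "g0 = {{0, 5}, {1, 8}, {2, 9}, {3, 14}, {4, 15}, {6, 13}, {7, 12}, {10, 17}, {11, 16}}"

end

theory Submission
  imports Defs "HOL-Computational_Algebra.Polynomial"
begin

text \<open>A Gauss diagram is stored as the list of partners of its points. Three independent arguments meet in the theorem.

\<^bold>\<open>The diagram g0 has no curve.\<close> The double points of a curve with this diagram cut it into arcs that contain
a subdivided $K_{3,3}$: three arcs with common end points, forming a theta curve, and outside of it a connected
set that accumulates at an inner point of each of the three arcs. By the Jordan curve theorem and Janiszewski's
theorem no such set exists (\<open>no_face_touches_three_arcs\<close>). Only continuity and the pattern of coincidences of
the curve are used, and these are turned into a bi-infinite sequence of passage times, on which rotations and
reflections of the diagram act by reindexing (\<open>word_diagram_passage_times\<close>).

\<^bold>\<open>Closed lattice walks are curves.\<close> A closed walk by unit steps in the square lattice which never turns back,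
and which visits a lattice point twice only by going straight ahead in two perpendicular directions, becomes
a generic smooth curve when its corners are rounded. The rounded walk stays, during one unit of time, in one unit cell
and coincides with the walk where it passes from cell to cell, so its double points are exactly the crossings
of the walk (\<open>curve_coincidence\<close>). Realizability of a diagram is thereby reduced to checking a list of directions
(\<open>draws_realizable\<close>).

\<^bold>\<open>The candidates can be listed.\<close> By (C1) partners have opposite parity, and by (C2) for two chords that do not cross, of
which the first does not enclose the second, an even number of points under the first have
their partner under the second
(\<open>C2_disjoint\<close>, \<open>C2_nested\<close>). These conditions prune a search which chooses the partner
of the first free point again and again; it starts from a diagram rotated so that a chord spanning the fewest
points begins at 0 (\<open>normal_form\<close>). The search (\<open>search_complete\<close>) leaves several hundred diagrams with at most 9
chords. For each one there is a certificate: a lattice walk that draws it, an interval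
closed under partners that shows it is not prime, a triple of chords that violates (B3), or a rotation onto g0
(\<open>verdict_sound\<close>). The search and the checks are carried out by the simplifier.\<close>

section \<open>Theta curves\<close>

text \<open>The Jordan curve theorem for the closed curve formed by two arcs, in a form that treats its two sides alike.\<close>

lemma theta_sides:
  fixes c c' :: "real \<Rightarrow> complex"
  assumes "arc c" "arc c'" "pathstart c = a" "pathstart c' = a" "pathfinish c = b" "pathfinish c' = b"
    and "path_image c \<inter> path_image c' \<subseteq> {a, b}"
  obtains W W' where "open W" "connected W" "open W'" "connected W'" "W \<noteq> {}" "W' \<noteq> {}"
    "W \<inter> W' = {}" "W \<union> W' = - (path_image c \<union> path_image c')"
    "frontier W = path_image c \<union> path_image c'" "frontier W' = path_image c \<union> path_image c'"
proof -
  let ?j = "c +++ reversepath c'"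
  have sp: "simple_path ?j"
    by (rule simple_path_join_loop) (use assms in \<open>auto simp: arc_reversepath\<close>)
  have im: "path_image ?j = path_image c \<union> path_image c'"
    using assms by (simp add: path_image_join)
  have cl: "pathfinish ?j = pathstart ?j" using assms by simp
  obtain inner outer where J: "inner \<noteq> {}" "open inner" "connected inner"
    "outer \<noteq> {}" "open outer" "connected outer" "inner \<inter> outer = {}"
    "inner \<union> outer = - path_image ?j" "frontier inner = path_image ?j" "frontier outer = path_image ?j"
    by (rule Jordan_curve [OF sp cl]) blast
  show thesis
    by (rule that[OF J(2,3,5,6,1,4,7)]) (use J(8-10) in \<open>simp_all only: im\<close>)
qed

lemma connected_insert_closure:
  fixes S :: "'a::topological_space set"
  assumes "connected S" "y \<in> closure S" shows "connected (insert y S)"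
  by (rule connected_intermediate_closure[OF assms(1)]) (use assms closure_subset in auto)

text \<open>Each pair of the arcs bounds two sides. Call the side of $c_1 \cup c_2$ without $U$ the far side. Since $y_3$ lies in the closure of
$U$, the third arc lies on the side of $U$, so the far side avoids all three arcs. It accumulates at
$y_2$, as does $U$; hence $c_1 \cup c_3$ does not separate it from $U$, and neither does $c_2 \cup c_3$, by $y_1$. These two
closed curves meet in the connected set $c_3$, so by Janiszewski's theorem their union does not separate either.
But it contains $c_1 \cup c_2$, which does.\<close>

lemma no_face_touches_three_arcs:
  fixes c1 c2 c3 :: "real \<Rightarrow> complex" and U :: "complex set"
  assumes arcs: "arc c1" "arc c2" "arc c3"
    and start: "pathstart c1 = a" "pathstart c2 = a" "pathstart c3 = a"
    and finish: "pathfinish c1 = b" "pathfinish c2 = b" "pathfinish c3 = b"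
    and meet: "path_image c1 \<inter> path_image c2 \<subseteq> {a, b}" "path_image c1 \<inter> path_image c3 \<subseteq> {a, b}"
      "path_image c2 \<inter> path_image c3 \<subseteq> {a, b}"
    and U: "connected U" "U \<inter> (path_image c1 \<union> path_image c2 \<union> path_image c3) = {}"
    and y: "y1 \<in> path_image c1 - {a, b}" "y2 \<in> path_image c2 - {a, b}" "y3 \<in> path_image c3 - {a, b}"
    and cl: "y1 \<in> closure U" "y2 \<in> closure U" "y3 \<in> closure U"
  shows False
proof -
  let ?C1 = "path_image c1" and ?C2 = "path_image c2" and ?C3 = "path_image c3"
  obtain V V' where V: "open V" "connected V" "open V'" "connected V'" "V \<noteq> {}" "V' \<noteq> {}"
    "V \<inter> V' = {}" "V \<union> V' = - (?C1 \<union> ?C2)"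
    "frontier V = ?C1 \<union> ?C2" "frontier V' = ?C1 \<union> ?C2"
    using theta_sides[of c1 c2 a b] arcs start finish meet by metis
  have "U \<subseteq> V \<union> V'" using V(8) U(2) by blast
  moreover have "V \<inter> U = {} \<or> V' \<inter> U = {}"
    using connectedD[OF U(1) V(1,3)] V(7) \<open>U \<subseteq> V \<union> V'\<close> by blast
  ultimately obtain W W' where W: "open W" "connected W" "open W'" "connected W'" "W' \<noteq> {}"
    "W \<inter> W' = {}" "W \<union> W' = - (?C1 \<union> ?C2)" "frontier W' = ?C1 \<union> ?C2" and UW: "U \<subseteq> W"
  proof (cases "V' \<inter> U = {}")
    case True
    then have "U \<subseteq> V" using \<open>U \<subseteq> V \<union> V'\<close> by blast
    then show ?thesis by (rule that[OF V(1-4,6-8,10)])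
  next
    case False
    then have "U \<subseteq> V'" using \<open>V \<inter> U = {} \<or> V' \<inter> U = {}\<close> \<open>U \<subseteq> V \<union> V'\<close> by blast
    moreover have "V' \<inter> V = {}" "V' \<union> V = - (?C1 \<union> ?C2)" using V(7,8) by (simp_all only: Int_commute Un_commute)
    ultimately show ?thesis using that[OF V(3,4,1,2,5) _ _ V(9)] by blast
  qed
  have clU: "closure U \<inter> W' = {}"
    using UW W(6) open_Int_closure_eq_empty[OF W(3), of U] by blast
  have ends: "{a, b} \<subseteq> ?C1" using start finish by (metis pathstart_in_path_image pathfinish_in_path_image empty_subsetI insert_subset)
  have y3W: "y3 \<in> W"
    using y(3) cl(3) clU W(7) meet ends by blast
  let ?I3 = "?C3 - {a, b}"
  have conn3: "connected ?I3"
    using connected_simple_path_endless[of c3] arcs start finish by (simp add: arc_imp_simple_path)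
  have I3: "?I3 \<subseteq> W \<union> W'" using W(7) meet by blast
  have "?I3 \<inter> W' = {}"
    using connectedD[OF conn3 W(1,3)] W(6) I3 y3W y(3) by blast
  then have W'3: "W' \<inter> ?C3 = {}" using ends W(7) by blast
  have clW': "?C1 \<union> ?C2 \<subseteq> closure W'" using W(8) by (metis frontier_closures Int_subset_iff subset_refl)
  obtain u' where u': "u' \<in> W'" using W(5) by blast
  obtain u where u: "u \<in> U" using cl(1) by fastforce
  have conn: "connected (insert y U \<union> insert y W')" if "y \<in> {y1, y2}" for y
  proof (rule connected_Un)
    show "connected (insert y U)" using connected_insert_closure U(1) cl that by blast
    show "connected (insert y W')" using connected_insert_closure W(4) clW' y that by blast
  qed auto
  have c13: "connected_component (- (?C1 \<union> ?C3)) u u'"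
    unfolding connected_component_def
  proof (intro exI conjI)
    show "connected (insert y2 U \<union> insert y2 W')" using conn by blast
    have "U \<inter> (?C1 \<union> ?C3) = {}" "W' \<inter> (?C1 \<union> ?C3) = {}" using U(2) W(7) W'3 by blast+
    moreover have "y2 \<notin> ?C1 \<union> ?C3" using y(2) meet by blast
    ultimately show "insert y2 U \<union> insert y2 W' \<subseteq> - (?C1 \<union> ?C3)" by blast
  qed (use u u' in auto)
  have c23: "connected_component (- (?C2 \<union> ?C3)) u u'"
    unfolding connected_component_def
  proof (intro exI conjI)
    show "connected (insert y1 U \<union> insert y1 W')" using conn by blast
    have "U \<inter> (?C2 \<union> ?C3) = {}" "W' \<inter> (?C2 \<union> ?C3) = {}" using U(2) W(7) W'3 by blast+
    moreover have "y1 \<notin> ?C2 \<union> ?C3" using y(1) meet by blast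
    ultimately show "insert y1 U \<union> insert y1 W' \<subseteq> - (?C2 \<union> ?C3)" by blast
  qed (use u u' in auto)
  have "{a, b} \<subseteq> ?C3" using start finish by (metis pathstart_in_path_image pathfinish_in_path_image empty_subsetI insert_subset)
  then have eq: "(?C1 \<union> ?C3) \<inter> (?C2 \<union> ?C3) = ?C3" using meet by blast
  have "connected_component (- ((?C1 \<union> ?C3) \<union> (?C2 \<union> ?C3))) u u'"
  proof (rule Janiszewski[OF _ _ _ c13 c23])
    show "compact (?C1 \<union> ?C3)" "closed (?C2 \<union> ?C3)"
      using arcs by (simp_all add: compact_Un closed_Un arc_imp_path compact_path_image compact_imp_closed)
    show "connected ((?C1 \<union> ?C3) \<inter> (?C2 \<union> ?C3))"
      unfolding eq using arcs by (simp add: arc_imp_path connected_path_image)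
  qed
  then obtain T where T: "connected T" "T \<subseteq> - (?C1 \<union> ?C2)" "u \<in> T" "u' \<in> T"
    unfolding connected_component_def by blast
  show False using connectedD[OF T(1) W(1,3)] W(6,7) T u u' UW by blast
qed

section \<open>The forbidden pattern of passages\<close>

definition seg :: "(real \<Rightarrow> complex) \<Rightarrow> real \<Rightarrow> real \<Rightarrow> real \<Rightarrow> complex" where
  "seg \<gamma> u v = (\<lambda>x. \<gamma> (u + (v - u) * x))"

lemma pathstart_seg [simp]: "pathstart (seg \<gamma> u v) = \<gamma> u"
  and pathfinish_seg [simp]: "pathfinish (seg \<gamma> u v) = \<gamma> v"
  by (simp_all add: seg_def pathstart_def pathfinish_def)

lemma path_image_seg [simp]:
  assumes "u < v" shows "path_image (seg \<gamma> u v) = \<gamma> ` {u..v}"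
proof -
  have "(\<lambda>x. u + (v - u) * x) ` {0..1} = {u..v}"
    using image_affinity_atLeastAtMost[of "v - u" u 0 1] assms by (simp add: add.commute)
  then show ?thesis unfolding path_image_def seg_def by (metis image_image)
qed

lemma arc_seg:
  assumes "continuous_on UNIV \<gamma>" "u < v" "inj_on \<gamma> {u..v}" shows "arc (seg \<gamma> u v)"
  unfolding arc_def path_def
proof
  show "continuous_on {0..1} (seg \<gamma> u v)" unfolding seg_def
    by (rule continuous_on_compose2[OF assms(1)]) (auto intro!: continuous_intros)
  show "inj_on (seg \<gamma> u v) {0..1}"
  proof (rule inj_onI)
    fix x y :: real assume xy: "x \<in> {0..1}" "y \<in> {0..1}" and eq: "seg \<gamma> u v x = seg \<gamma> u v y"
    have "u + (v - u) * z \<in> {u..v}" if "z \<in> {0..1}" for z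
    proof -
      have "0 \<le> (v - u) * z" using assms(2) that by simp
      moreover have "(v - u) * z \<le> (v - u) * 1" using assms(2) that by (intro mult_left_mono) auto
      ultimately show ?thesis by simp
    qed
    then have "u + (v - u) * x = u + (v - u) * y"
      using inj_onD[OF assms(3)] eq xy unfolding seg_def by blast
    then show "x = y" using assms(2) by simp
  qed
qed

lemma closure_image_continuous:
  fixes \<gamma> :: "real \<Rightarrow> complex"
  assumes "continuous_on UNIV \<gamma>" "t \<in> closure S" shows "\<gamma> t \<in> closure (\<gamma> ` S)"
proof -
  have "\<gamma> ` closure S \<subseteq> closure (\<gamma> ` S)"
    by (rule image_closure_subset[OF continuous_on_subset[OF assms(1)]]) (auto simp: closure_subset)
  then show ?thesis using assms(2) by blast
qed

text \<open>The points of g0 are numbered here from its point 6, which makes every arc in use an interval of parameters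
inside one period. The theta curve has its poles at the
chords $\{3,14\}$ and $\{12,17\}$; its arcs run over the parameters from $T_{12}$ to $T_{14}$, from $T_{14}$ to $T_{17}$, and from
$T_3$ to $T_4$ followed by $T_{11}$ to $T_{12}$. The set $U$ is a star, joined at the chords $\{0,7\}$ and $\{1,6\}$, whose
tips approach the inner points $T_2$, $T_4$ and $T_8$ of the arcs.\<close>

lemma no_g0_curve:
  fixes \<gamma> :: "real \<Rightarrow> complex" and T :: "nat \<Rightarrow> real"
  assumes cont: "continuous_on UNIV \<gamma>"
    and mono: "\<And>i. i < 17 \<Longrightarrow> T i < T (Suc i)"
    and coin: "\<And>s t. T 0 \<le> s \<Longrightarrow> s < t \<Longrightarrow> t \<le> T 17 \<Longrightarrow> \<gamma> s = \<gamma> t \<longleftrightarrow>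
      (\<exists>(k, l) \<in> {(0, 7), (1, 6), (2, 13), (3, 14), (4, 11), (5, 10), (8, 15), (9, 16), (12, 17)}.
        s = T k \<and> t = T l)"
  shows False
proof -
  have m: "T 0 < T 1" "T 1 < T 2" "T 2 < T 3" "T 3 < T 4" "T 4 < T 5" "T 5 < T 6" "T 6 < T 7"
    "T 7 < T 8" "T 8 < T 9" "T 9 < T 10" "T 10 < T 11" "T 11 < T 12" "T 12 < T 13" "T 13 < T 14"
    "T 14 < T 15" "T 15 < T 16" "T 16 < T 17"
    using mono[of 0] mono[of 1] mono[of 2] mono[of 3] mono[of 4] mono[of 5] mono[of 6] mono[of 7]
      mono[of 8] mono[of 9] mono[of 10] mono[of 11] mono[of 12] mono[of 13] mono[of 14] mono[of 15]
      mono[of 16] by (simp_all add: eval_nat_numeral)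
  have eqs: "\<gamma> (T 0) = \<gamma> (T 7)" "\<gamma> (T 1) = \<gamma> (T 6)" "\<gamma> (T 2) = \<gamma> (T 13)" "\<gamma> (T 3) = \<gamma> (T 14)"
    "\<gamma> (T 4) = \<gamma> (T 11)" "\<gamma> (T 8) = \<gamma> (T 15)" "\<gamma> (T 12) = \<gamma> (T 17)"
    by (subst coin; use m in force)+
  have D: "s = T 0 \<and> t = T 7 \<or> s = T 1 \<and> t = T 6 \<or> s = T 2 \<and> t = T 13 \<or> s = T 3 \<and> t = T 14 \<or>
     s = T 4 \<and> t = T 11 \<or> s = T 5 \<and> t = T 10 \<or> s = T 8 \<and> t = T 15 \<or> s = T 9 \<and> t = T 16 \<or> s = T 12 \<and> t = T 17"
    if "T 0 \<le> s" "s < t" "t \<le> T 17" "\<gamma> s = \<gamma> t" for s t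
    using coin[OF that(1-3)] that(4) by simp
  have arcI: "arc (seg \<gamma> u v)" if "u < v" "T 0 \<le> u" "v \<le> T 17"
    "\<And>s t. u \<le> s \<Longrightarrow> s < t \<Longrightarrow> t \<le> v \<Longrightarrow> \<gamma> s \<noteq> \<gamma> t" for u v
  proof (rule arc_seg[OF cont that(1)], rule inj_onI)
    fix x y assume "x \<in> {u..v}" "y \<in> {u..v}" "\<gamma> x = \<gamma> y"
    then show "x = y" using that(4)[of x y] that(4)[of y x] by (cases x y rule: linorder_cases) auto
  qed
  have arcs: "arc (seg \<gamma> (T 12) (T 14))" "arc (seg \<gamma> (T 14) (T 17))" "arc (seg \<gamma> (T 3) (T 4))"
      "arc (seg \<gamma> (T 11) (T 12))"
    by (rule arcI; use m D in \<open>smt (verit)\<close>)+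
  have image_Int: "\<gamma> ` A \<inter> \<gamma> ` B \<subseteq> X" if "\<And>s t. s \<in> A \<Longrightarrow> t \<in> B \<Longrightarrow> \<gamma> s = \<gamma> t \<Longrightarrow> \<gamma> s \<in> X" for A B X
    using that by force
  let ?c1 = "reversepath (seg \<gamma> (T 12) (T 14))" and ?c2 = "seg \<gamma> (T 14) (T 17)"
    and ?c3 = "seg \<gamma> (T 3) (T 4) +++ seg \<gamma> (T 11) (T 12)"
  have i1: "path_image ?c1 = \<gamma> ` {T 12..T 14}" and i2: "path_image ?c2 = \<gamma> ` {T 14..T 17}"
    and i3: "path_image ?c3 = \<gamma> ` {T 3..T 4} \<union> \<gamma> ` {T 11..T 12}"
    using m eqs by (simp_all add: path_image_join)
  have a3: "arc ?c3"
  proof (rule arc_join[OF arcs(3,4)])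
    show "path_image (seg \<gamma> (T 3) (T 4)) \<inter> path_image (seg \<gamma> (T 11) (T 12)) \<subseteq> {pathstart (seg \<gamma> (T 11) (T 12))}"
      using m apply simp
      apply (rule image_Int)
      using D by (smt (verit) atLeastAtMost_iff insertI1)
  qed (use eqs in simp)
  have dist: "\<gamma> (T 2) \<notin> {\<gamma> (T 14), \<gamma> (T 17)}" "\<gamma> (T 4) \<notin> {\<gamma> (T 14), \<gamma> (T 17)}" "\<gamma> (T 8) \<notin> {\<gamma> (T 14), \<gamma> (T 17)}"
    using m D by (smt (verit) insertE empty_iff)+
  have "\<gamma> (T 13) \<in> \<gamma> ` {T 12..T 14}" "\<gamma> (T 15) \<in> \<gamma> ` {T 14..T 17}"
    and in3: "\<gamma> (T 4) \<in> \<gamma> ` {T 3..T 4}"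
    by (rule imageI; use m in \<open>simp only: atLeastAtMost_iff; linarith\<close>)+
  then have in1: "\<gamma> (T 2) \<in> \<gamma> ` {T 12..T 14}" and in2: "\<gamma> (T 8) \<in> \<gamma> ` {T 14..T 17}"
    by (simp_all only: eqs(3) eqs(6))
  let ?U = "\<gamma> ` {T 0..<T 2} \<union> \<gamma> ` {T 7..<T 8} \<union> \<gamma> ` {T 4<..T 6}"
  have conn: "connected (\<gamma> ` {x..<y})" "connected (\<gamma> ` {x<..y})" for x y
    by (rule connected_continuous_image[OF continuous_on_subset[OF cont]]; simp)+
  have U: "connected ?U"
  proof (intro connected_Un conn)
    have "\<gamma> (T 0) \<in> \<gamma> ` {T 0..<T 2}" "\<gamma> (T 7) \<in> \<gamma> ` {T 7..<T 8}"
      "\<gamma> (T 1) \<in> \<gamma> ` {T 0..<T 2}" "\<gamma> (T 6) \<in> \<gamma> ` {T 4<..T 6}"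
      by (rule imageI; use m in simp)+
    then show "\<gamma> ` {T 0..<T 2} \<inter> \<gamma> ` {T 7..<T 8} \<noteq> {}"
      "(\<gamma> ` {T 0..<T 2} \<union> \<gamma> ` {T 7..<T 8}) \<inter> \<gamma> ` {T 4<..T 6} \<noteq> {}"
      using eqs(1,2) by (metis IntI UnI1 empty_iff)+
  qed
  have cl: "\<gamma> (T 2) \<in> closure ?U" "\<gamma> (T 4) \<in> closure ?U" "\<gamma> (T 8) \<in> closure ?U"
    using closure_image_continuous[OF cont, of "T 2" "{T 0..<T 2}"] closure_image_continuous[OF cont, of "T 4" "{T 4<..T 6}"]
      closure_image_continuous[OF cont, of "T 8" "{T 7..<T 8}"] m by (auto simp: closure_Un)
  have disj: "\<gamma> ` A \<inter> \<gamma> ` B = {}" if "(A, B) \<in> {{T 0..<T 2}, {T 7..<T 8}, {T 4<..T 6}} \<times> {{T 12..T 14}, {T 14..T 17}, {T 3..T 4}, {T 11..T 12}}" for A B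
  proof -
    have "\<gamma> s \<noteq> \<gamma> t" if "s \<in> A" "t \<in> B" for s t
      using \<open>(A, B) \<in> _\<close> that D[of s t] D[of t s] m
      apply (simp only: mem_Sigma_iff insert_iff empty_iff simp_thms)
      apply (elim conjE disjE; hypsubst; simp only: atLeastAtMost_iff atLeastLessThan_iff greaterThanAtMost_iff; smt (verit))
      done
    then show ?thesis by blast
  qed
  show False
  proof (rule no_face_touches_three_arcs[of ?c1 ?c2 ?c3 "\<gamma> (T 14)" "\<gamma> (T 17)" ?U "\<gamma> (T 2)" "\<gamma> (T 8)" "\<gamma> (T 4)"])
    show "path_image ?c1 \<inter> path_image ?c2 \<subseteq> {\<gamma> (T 14), \<gamma> (T 17)}" unfolding i1 i2
      by (rule image_Int) (use m D eqs in \<open>smt (verit) atLeastAtMost_iff insertI1 insertI2\<close>)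
    have "\<gamma> ` {T 12..T 14} \<inter> \<gamma> ` {T 3..T 4} \<subseteq> {\<gamma> (T 14), \<gamma> (T 17)}"
      "\<gamma> ` {T 12..T 14} \<inter> \<gamma> ` {T 11..T 12} \<subseteq> {\<gamma> (T 14), \<gamma> (T 17)}"
      by (rule image_Int; use m D eqs in \<open>smt (verit) atLeastAtMost_iff insertI1 insertI2\<close>)+
    then show "path_image ?c1 \<inter> path_image ?c3 \<subseteq> {\<gamma> (T 14), \<gamma> (T 17)}" unfolding i1 i3 by blast
    have "\<gamma> ` {T 14..T 17} \<inter> \<gamma> ` {T 3..T 4} \<subseteq> {\<gamma> (T 14), \<gamma> (T 17)}"
      "\<gamma> ` {T 14..T 17} \<inter> \<gamma> ` {T 11..T 12} \<subseteq> {\<gamma> (T 14), \<gamma> (T 17)}"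
      by (rule image_Int; use m D eqs in \<open>smt (verit) atLeastAtMost_iff insertI1 insertI2\<close>)+
    then show "path_image ?c2 \<inter> path_image ?c3 \<subseteq> {\<gamma> (T 14), \<gamma> (T 17)}" unfolding i2 i3 by blast
    show "?U \<inter> (path_image ?c1 \<union> path_image ?c2 \<union> path_image ?c3) = {}" unfolding i1 i2 i3
      using disj by (simp add: Int_Un_distrib Int_Un_distrib2)
    show "arc ?c1" using arcs(1) by (rule arc_reversepath)
    show "\<gamma> (T 2) \<in> path_image ?c1 - {\<gamma> (T 14), \<gamma> (T 17)}" using in1 dist i1 by simp
    show "\<gamma> (T 8) \<in> path_image ?c2 - {\<gamma> (T 14), \<gamma> (T 17)}" using in2 dist i2 by simp
    show "\<gamma> (T 4) \<in> path_image ?c3 - {\<gamma> (T 14), \<gamma> (T 17)}" using in3 dist i3 by simp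
  qed (use cl in \<open>simp_all only: arcs a3 U eqs(4,7) pathstart_reversepath pathfinish_reversepath pathstart_seg pathfinish_seg pathstart_join pathfinish_join\<close>)
qed

section \<open>Passage times of a generic curve\<close>

lemma periodic_int:
  fixes \<gamma> :: "real \<Rightarrow> 'a"
  assumes "\<And>t. \<gamma> (t + 1) = \<gamma> t" shows "\<gamma> (t + of_int k) = \<gamma> t"
proof -
  have *: "\<gamma> (t + of_nat n) = \<gamma> t" for t n
    by (induction n) (use assms in \<open>auto simp: add.assoc[symmetric] add.commute[of 1]\<close>)
  show ?thesis
  proof (cases "k \<ge> 0")
    case True
    then show ?thesis using *[of t "nat k"] by simp
  next
    case False
    then show ?thesis using *[of "t + of_int k" "nat (- k)"] by simp
  qed
qed

lemma doubleton_in_word_diagram: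
  assumes "i \<noteq> j" "i < length w" "j < length w" "w ! i = w ! j"
  shows "{i, j} \<in> word_diagram w"
proof (cases "i < j")
  case True
  then show ?thesis unfolding word_diagram_def using assms by blast
next
  case False
  then have "j < i" "{i, j} = {j, i}" using assms(1) by auto
  then show ?thesis unfolding word_diagram_def using assms by (metis (mono_tags, lifting) mem_Collect_eq)
qed

text \<open>Indexing the passages by all integers, with period $m$ in the index and period 1 in time, removes the base
point of the traversal: rotating or reflecting the diagram only changes the indexing.\<close>

lemma word_diagram_passage_times:
  fixes w :: "'a list"
  assumes per: "\<And>t. \<gamma> (t + 1) = \<gamma> t" and aw: "associated_word \<gamma> w"
    and len: "length w = m" "m > 0"
  obtains \<tau> :: "int \<Rightarrow> real"
  where "\<And>k. \<tau> k < \<tau> (k + 1)" "\<And>k. \<tau> (k + int m) = \<tau> k + 1"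
    "\<And>s t. \<gamma> s = \<gamma> t \<longleftrightarrow> s - t \<in> \<int> \<or>
       (\<exists>k l. s = \<tau> k \<and> t = \<tau> l \<and> {nat (k mod int m), nat (l mod int m)} \<in> word_diagram w)"
proof -
  obtain lab b where lab: "inj_on lab (self_intersections \<gamma>)" and b: "\<gamma> b \<notin> self_intersections \<gamma>"
    and w: "w = map (\<lambda>t. lab (\<gamma> t)) (sorted_list_of_set {t\<in>{b<..<b + 1}. \<gamma> t \<in> self_intersections \<gamma>})"
    using aw unfolding associated_word_def by blast
  define X where "X = {t\<in>{b<..<b + 1}. \<gamma> t \<in> self_intersections \<gamma>}"
  define ts where "ts = sorted_list_of_set X"
  have lts: "length ts = m" using w len by (simp add: ts_def X_def)
  have fX: "finite X" using lts len(2) by (metis ts_def sorted_list_of_set.fold_insort_key.infinite list.size(3) less_irrefl)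
  have sts: "set ts = X" "sorted_wrt (<) ts" using fX by (auto simp: ts_def strict_sorted_list_of_set)
  have tsX: "ts ! i \<in> X" if "i < m" for i using that lts sts by (metis nth_mem)
  define \<tau> where "\<tau> k = ts ! nat (k mod int m) + of_int (k div int m)" for k :: int
  have mpos: "int m > 0" using len by simp
  have nm: "nat (k mod int m) < m" for k using mpos by (simp add: nat_less_iff)
  have P: "\<gamma> (t + of_int k) = \<gamma> t" for t k using periodic_int[of \<gamma>] per by blast
  have wi: "w ! i = lab (\<gamma> (ts ! i))" if "i < m" for i
    using that lts w by (simp add: ts_def X_def)
  show thesis
  proof (rule that[of \<tau>])
    fix k :: int
    have \<tau>_eq: "\<tau> (int m * q + int r) = ts ! r + of_int q" if "r < m" for q r
      using that by (simp add: \<tau>_def)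
    define q r where "q = k div int m" and "r = nat (k mod int m)"
    have k: "k = int m * q + int r" and r: "r < m"
      using mpos by (simp_all add: q_def r_def nat_less_iff)
    show "\<tau> k < \<tau> (k + 1)"
    proof (cases "Suc r < m")
      case True
      have "ts ! r < ts ! Suc r" using sts(2) True lts by (simp add: sorted_wrt_iff_nth_less)
      moreover have "k + 1 = int m * q + int (Suc r)" using k by simp
      ultimately have "\<tau> k = ts ! r + of_int q" "\<tau> (k + 1) = ts ! Suc r + of_int q"
        using k \<tau>_eq[OF r, of q] \<tau>_eq[OF True, of q] by (simp_all only:)
      then show ?thesis using \<open>ts ! r < ts ! Suc r\<close> by simp
    next
      case False
      then have "k + 1 = int m * (q + 1) + int 0" using k r by (simp add: algebra_simps)
      moreover have "ts ! r < b + 1" "b < ts ! 0" using tsX[of r] tsX[of 0] r unfolding X_def by auto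
      ultimately show ?thesis using k \<tau>_eq[OF r, of q] \<tau>_eq[OF len(2), of "q + 1"] by simp
    qed
    show "\<tau> (k + int m) = \<tau> k + 1" unfolding \<tau>_def using mpos by simp
  next
    fix s t
    have hit: "\<exists>k. s = \<tau> k" if "\<gamma> s \<in> self_intersections \<gamma>" for s
    proof -
      define n where "n = \<lfloor>s - b\<rfloor>"
      have g: "\<gamma> (s - of_int n) = \<gamma> s" using P[of "s - of_int n" n] by simp
      have "s - of_int n \<noteq> b" using b that g by metis
      moreover have "b \<le> s - of_int n" "s - of_int n < b + 1" unfolding n_def by linarith+
      ultimately have "s - of_int n \<in> X" using that g unfolding X_def by auto
      then obtain i where i: "i < m" "ts ! i = s - of_int n" using sts(1) lts by (metis in_set_conv_nth)
      have "s = \<tau> (int i + int m * n)" unfolding \<tau>_def using i by simp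
      then show ?thesis by blast
    qed
    have g\<tau>: "\<gamma> (\<tau> k) = \<gamma> (ts ! nat (k mod int m))" for k unfolding \<tau>_def by (rule P)
    show "\<gamma> s = \<gamma> t \<longleftrightarrow> s - t \<in> \<int> \<or>
       (\<exists>k l. s = \<tau> k \<and> t = \<tau> l \<and> {nat (k mod int m), nat (l mod int m)} \<in> word_diagram w)" (is "?L \<longleftrightarrow> ?R1 \<or> ?R2")
    proof
      assume ?L
      show "?R1 \<or> ?R2"
      proof (cases ?R1)
        case False
        have fr: "\<gamma> (frac t) = \<gamma> t" for t using P[of "frac t" "\<lfloor>t\<rfloor>"] by (simp add: frac_def)
        have "frac s \<noteq> frac t"
        proof
          assume "frac s = frac t"
          then have "s - t = of_int (\<lfloor>s\<rfloor> - \<lfloor>t\<rfloor>)" by (simp add: frac_def)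
          then show False using False by (metis Ints_of_int)
        qed
        have si: "\<gamma> s \<in> self_intersections \<gamma>"
          unfolding self_intersections_def
          by (rule CollectI, rule bexI[of _ "frac s"], rule bexI[of _ "frac t"])
            (use fr \<open>?L\<close> \<open>frac s \<noteq> frac t\<close> in \<open>simp_all add: frac_lt_1\<close>)
        then obtain k l where kl: "s = \<tau> k" "t = \<tau> l" using hit \<open>?L\<close> by metis
        let ?i = "nat (k mod int m)" and ?j = "nat (l mod int m)"
        have "?i \<noteq> ?j"
        proof
          assume "?i = ?j"
          then have "s - t = of_int (k div int m - l div int m)" using kl by (simp add: \<tau>_def)
          then show False using False by (metis Ints_of_int)
        qed
        moreover have "w ! ?i = w ! ?j" using wi nm g\<tau> kl \<open>?L\<close> by metis
        ultimately have "{?i, ?j} \<in> word_diagram w"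
          using nm[of k] nm[of l] len(1) by (intro doubleton_in_word_diagram) simp_all
        then show ?thesis using kl by blast
      qed auto
    next
      assume "?R1 \<or> ?R2"
      then show ?L
      proof
        assume ?R1
        then obtain n where "s = t + of_int n" by (metis Ints_cases diff_eq_eq add.commute)
        then show ?L using P by simp
      next
        assume ?R2
        then obtain k l where kl: "s = \<tau> k" "t = \<tau> l" and *: "{nat (k mod int m), nat (l mod int m)} \<in> word_diagram w" by blast
        have "w ! nat (k mod int m) = w ! nat (l mod int m)"
          using * unfolding word_diagram_def by (auto simp: doubleton_eq_iff)
        then have "lab (\<gamma> s) = lab (\<gamma> t)" using wi nm g\<tau> kl by simp
        moreover have "\<gamma> (\<tau> k) \<in> self_intersections \<gamma>" for k
          using tsX[OF nm[of k]] g\<tau>[of k] unfolding X_def by simp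
        ultimately show ?L using lab kl by (simp add: inj_on_eq_iff)
      qed
    qed
  qed
qed

lemma generic_closed_curve_continuous:
  assumes "generic_closed_curve \<gamma>" shows "continuous_on UNIV \<gamma>"
proof -
  have "\<gamma> differentiable at t" for t
  proof -
    have "((\<lambda>f u. vector_derivative f (at u)) ^^ 0) \<gamma> differentiable at t"
      using assms unfolding generic_closed_curve_def immersed_closed_curve_def smooth_curve_def by blast
    then show ?thesis by simp
  qed
  then show ?thesis
    by (intro continuous_at_imp_continuous_on ballI differentiable_imp_continuous_within)
qed

lemma length_word_diagram:
  assumes "double_occurrence_word w" "gauss_diagram n (word_diagram w)" shows "length w = 2 * n"
proof -
  have U: "\<Union> (word_diagram w) = {0..<2 * n}"
    using assms(2) by (simp add: gauss_diagram_def partition_on_def)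
  have "\<Union> (word_diagram w) = {0..<length w}"
  proof (intro equalityI subsetI)
    fix i assume i: "i \<in> {0..<length w}"
    let ?J = "{j. j < length w \<and> w ! i = w ! j}"
    have "count_list w (w ! i) = card ?J"
      unfolding count_list_eq_length_filter length_filter_conv_card ..
    then have "card ?J = 2" using assms(1) i by (simp add: double_occurrence_word_def)
    then have "?J \<noteq> {i}" by force
    moreover have "i \<in> ?J" using i by simp
    ultimately obtain j where "j < length w" "w ! i = w ! j" "i \<noteq> j" by blast
    then have "{i, j} \<in> word_diagram w" using i by (intro doubleton_in_word_diagram) auto
    then show "i \<in> \<Union> (word_diagram w)" by blast
  qed (auto simp: word_diagram_def)
  then have "{0..<length w} = {0..<2 * n}" using U by simp
  then show ?thesis by (metis card_atLeastLessThan diff_zero)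
qed

text \<open>Rotations ($e = 1$) and reflections ($e = -1$) together.\<close>

definition act :: "nat \<Rightarrow> int \<Rightarrow> int \<Rightarrow> nat \<Rightarrow> nat" where
  "act n e s x = nat ((e * int x + s) mod int (2 * n))"

lemma rotate_pt_eq_act: "rotate_pt n s = act n 1 s" and reflect_pt_eq_act: "reflect_pt n s = act n (- 1) s"
  by (simp_all add: fun_eq_iff act_def rotate_pt_def reflect_pt_def)

lemma diagram_iso_act:
  "diagram_iso n g h \<longleftrightarrow> gauss_diagram n g \<and> gauss_diagram n h \<and>
     (\<exists>e\<in>{1, -1}. \<exists>s. h = (`) (act n e s) ` g)"
  by (auto simp: diagram_iso_def rotate_pt_eq_act reflect_pt_eq_act)

lemma act_less: "n > 0 \<Longrightarrow> act n e s x < 2 * n"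
  by (simp add: act_def nat_less_iff)

lemma int_act: "n > 0 \<Longrightarrow> int (act n e s x) = (e * int x + s) mod int (2 * n)"
  by (simp add: act_def)

lemma act_act: "n > 0 \<Longrightarrow> act n e' s' (act n e s x) = act n (e' * e) (e' * s + s') x"
proof -
  assume "n > 0"
  then have "(e' * int (act n e s x) + s') mod int (2 * n) = (e' * (e * int x + s) + s') mod int (2 * n)"
    unfolding int_act[OF \<open>n > 0\<close>] by (metis mod_add_left_eq mod_mult_right_eq)
  then show ?thesis unfolding act_def[of n e' s'] act_def[of n "e' * e"] by (simp add: algebra_simps)
qed

lemma act_inverse:
  assumes "n > 0" "e \<in> {1, -1}" "x < 2 * n" shows "act n e (- e * s) (act n e s x) = x"
proof -
  have "act n e (- e * s) (act n e s x) = act n (e * e) (e * s + - e * s) x"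
    by (rule act_act) fact
  also have "\<dots> = x" using assms by (auto simp: act_def)
  finally show ?thesis .
qed

lemma inj_on_act: "n > 0 \<Longrightarrow> e \<in> {1, -1} \<Longrightarrow> inj_on (act n e s) {0..<2 * n}"
  by (rule inj_on_inverseI[of _ "act n e (- e * s)"], rule act_inverse) auto

text \<open>The renumbering of the points of g0 used by \<open>no_g0_curve\<close>.\<close>

lemma g0_cut:
  "i < j \<and> j < 18 \<and> P \<and> Q \<and> {(i + 6) mod 18, (j + 6) mod 18} \<in> g0 \<longleftrightarrow>
   P \<and> Q \<and> (i, j) \<in> {(0, 7), (1, 6), (2, 13), (3, 14), (4, 11), (5, 10), (8, 15), (9, 16), (12, 17::nat)}"
  (is "?L \<longleftrightarrow> ?R")
proof
  assume L: ?L
  have inv: "i = ((i + 6) mod 18 + 12) mod 18" if "i < 18" for i :: nat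
    using that by presburger
  obtain a b where ab: "a = (i + 6) mod 18" "b = (j + 6) mod 18" by blast
  have "i = (a + 12) mod 18" "j = (b + 12) mod 18" using inv[of i] inv[of j] L ab by auto
  moreover have "{a, b} \<in> g0" using L ab by blast
  ultimately have "(i, j) \<in> {(0, 7), (1, 6), (2, 13), (3, 14), (4, 11), (5, 10), (8, 15), (9, 16), (12, 17::nat)} \<or> j < i"
    unfolding g0_def insert_iff empty_iff doubleton_eq_iff by (elim disjE conjE) simp_all
  moreover have "\<not> j < i" using L by simp
  ultimately show ?R using L by blast
next
  assume ?R
  then show ?L unfolding g0_def insert_iff empty_iff doubleton_eq_iff Pair_inject
    by (elim disjE conjE) simp_all
qed

lemma g0_not_realizable: "\<not> realizable_diagram 9 g0"
proof
  assume "realizable_diagram 9 g0"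
  then obtain w :: "nat list" and \<gamma> where w: "double_occurrence_word w" "generic_closed_curve \<gamma>" "associated_word \<gamma> w"
    and iso: "diagram_iso 9 g0 (word_diagram w)"
    unfolding realizable_diagram_def realizable_word_def by blast
  obtain e s where g: "gauss_diagram 9 g0" "gauss_diagram 9 (word_diagram w)" and e: "e \<in> {1, -1}"
    and weq: "word_diagram w = (`) (act 9 e s) ` g0"
    using iso unfolding diagram_iso_act by blast
  have len: "length w = 18" using length_word_diagram[OF w(1) g(2)] by simp
  have per: "\<gamma> (t + 1) = \<gamma> t" for t using w(2) by (simp add: generic_closed_curve_def immersed_closed_curve_def)
  obtain \<tau> :: "int \<Rightarrow> real" where step: "\<And>k. \<tau> k < \<tau> (k + 1)" and wrap: "\<And>k. \<tau> (k + 18) = \<tau> k + 1"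
    and coin: "\<And>s t. \<gamma> s = \<gamma> t \<longleftrightarrow> s - t \<in> \<int> \<or>
       (\<exists>k l. s = \<tau> k \<and> t = \<tau> l \<and> {nat (k mod 18), nat (l mod 18)} \<in> word_diagram w)"
    by (rule word_diagram_passage_times[OF per w(3) len]) auto
  have mono: "\<tau> k < \<tau> l \<longleftrightarrow> k < l" for k l
  proof -
    have "\<tau> k < \<tau> (k + 1 + int n)" for k n
    proof (induction n)
      case (Suc n)
      then show ?case using less_trans[OF Suc step[of "k + 1 + int n"]] by (simp add: algebra_simps)
    qed (simp add: step)
    from this[of k "nat (l - k - 1)"] this[of l "nat (k - l - 1)"]
    show ?thesis by (cases k l rule: linorder_cases) auto
  qed
  define T where "T i = e * \<tau> (s + e * (int i + 6))" for i
  define \<delta> where "\<delta> t = \<gamma> (of_int e * t)" for t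
  have ee: "real_of_int e * (real_of_int e * x) = x" for x using e by auto
  have T_iff: "T i < T j \<longleftrightarrow> i < j" for i j using e mono by (auto simp: T_def)
  have pair: "{nat ((s + e * (int i + 6)) mod 18), nat ((s + e * (int j + 6)) mod 18)} \<in> word_diagram w \<longleftrightarrow>
     {(i + 6) mod 18, (j + 6) mod 18} \<in> g0" for i j
  proof -
    have eq: "nat ((s + e * (int i + 6)) mod 18) = act 9 e s ((i + 6) mod 18)" for i
    proof -
      have "(e * int ((i + 6) mod 18) + s) mod 18 = (e * (int i + 6) + s) mod 18"
        by (simp add: zmod_int) (metis mod_add_left_eq mod_mult_right_eq)
      then show ?thesis by (simp add: act_def add.commute)
    qed
    have sub: "c \<subseteq> {0..<18}" if "c \<in> g0" for c
      using g(1) that unfolding gauss_diagram_def partition_on_def by auto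
    have inj: "inj_on (act 9 e s) {0..<18}" using inj_on_act[of 9 e s] e by simp
    have "act 9 e s ` {(i + 6) mod 18, (j + 6) mod 18} \<in> (`) (act 9 e s) ` g0 \<longleftrightarrow> {(i + 6) mod 18, (j + 6) mod 18} \<in> g0"
      using inj_on_image_eq_iff[OF inj sub, of _ "{(i + 6) mod 18, (j + 6) mod 18}"] by auto
    then show ?thesis unfolding weq eq by simp
  qed
  show False
  proof (rule no_g0_curve[of \<delta> T])
    show "continuous_on UNIV \<delta>" unfolding \<delta>_def
      by (rule continuous_on_compose2[OF generic_closed_curve_continuous[OF w(2)]]) (auto intro!: continuous_intros)
    show "T i < T (Suc i)" for i by (simp add: T_iff)
  next
    fix x y assume xy: "T 0 \<le> x" "x < y" "y \<le> T 17"
    have "s + 24 = s + 6 + 18" "s - 6 = s - 24 + 18" by simp_all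
    then have "\<tau> (s + 24) = \<tau> (s + 6) + 1" "\<tau> (s - 6) = \<tau> (s - 24) + 1"
      using wrap by (simp_all only:)
    then have "T 18 = T 0 + 1" using e by (auto simp: T_def)
    then have "y - x < 1" using xy T_iff[of 17 18] by simp
    have "y - x \<notin> \<int>"
    proof
      assume "y - x \<in> \<int>"
      then obtain z where z: "y - x = of_int z" by (auto elim: Ints_cases)
      then have "0 < z" "z < 1" using \<open>y - x < 1\<close> xy(2) by (metis diff_gt_0_iff_gt of_int_0_less_iff of_int_less_1_iff)+
      then show False by simp
    qed
    then have "e * x - e * y \<notin> \<int>"
      using e minus_in_Ints_iff[of "y - x"] by auto
    moreover have "(e * x = \<tau> k \<and> e * y = \<tau> l \<and> P) \<longleftrightarrow> (x = e * \<tau> k \<and> y = e * \<tau> l \<and> P)" for k l P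
      using ee by metis
    ultimately have "\<delta> x = \<delta> y \<longleftrightarrow> (\<exists>k l. x = e * \<tau> k \<and> y = e * \<tau> l \<and> {nat (k mod 18), nat (l mod 18)} \<in> word_diagram w)"
      by (simp only: \<delta>_def coin simp_thms)
    also have "\<dots> \<longleftrightarrow> (\<exists>i j. i < j \<and> j < 18 \<and> x = T i \<and> y = T j \<and> {(i + 6) mod 18, (j + 6) mod 18} \<in> g0)"
    proof
      assume "\<exists>k l. x = e * \<tau> k \<and> y = e * \<tau> l \<and> {nat (k mod 18), nat (l mod 18)} \<in> word_diagram w"
      then obtain k l where kl: "x = e * \<tau> k" "y = e * \<tau> l" "{nat (k mod 18), nat (l mod 18)} \<in> word_diagram w"
        by blast
      have idx: "\<exists>i. k = s + e * (int i + 6) \<and> i < 18" if "T 0 \<le> e * \<tau> k" "e * \<tau> k \<le> T 17" for k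
      proof -
        have k: "k = s + e * ((e * (k - s) - 6) + 6)" using e by auto
        have "0 \<le> e * (k - s) - 6" "e * (k - s) - 6 \<le> 17"
          using that e mono[of k "s + 6"] mono[of "s + 23" k] mono[of "s - 6" k] mono[of k "s - 23"]
          by (auto simp: T_def not_less[symmetric])
        then show ?thesis using k by (intro exI[of _ "nat (e * (k - s) - 6)"]) auto
      qed
      obtain i j where ij: "k = s + e * (int i + 6)" "i < 18" "l = s + e * (int j + 6)" "j < 18"
      proof -
        have "T 0 \<le> e * \<tau> k" "e * \<tau> k \<le> T 17" "T 0 \<le> e * \<tau> l" "e * \<tau> l \<le> T 17"
          using kl(1,2) xy by auto
        then show thesis using that idx[of k] idx[of l] by blast
      qed
      then show "\<exists>i j. i < j \<and> j < 18 \<and> x = T i \<and> y = T j \<and> {(i + 6) mod 18, (j + 6) mod 18} \<in> g0"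
        using kl xy pair[of i j] by (auto simp: T_def[symmetric] T_iff)
    next
      assume "\<exists>i j. i < j \<and> j < 18 \<and> x = T i \<and> y = T j \<and> {(i + 6) mod 18, (j + 6) mod 18} \<in> g0"
      then show "\<exists>k l. x = e * \<tau> k \<and> y = e * \<tau> l \<and> {nat (k mod 18), nat (l mod 18)} \<in> word_diagram w"
        unfolding T_def using pair by blast
    qed
    also have "\<dots> \<longleftrightarrow> (\<exists>(k, l) \<in> {(0, 7), (1, 6), (2, 13), (3, 14), (4, 11), (5, 10), (8, 15), (9, 16), (12, 17)}. x = T k \<and> y = T l)"
      unfolding g0_cut by blast
    finally show "\<delta> x = \<delta> y \<longleftrightarrow> (\<exists>(k, l) \<in> {(0, 7), (1, 6), (2, 13), (3, 14), (4, 11), (5, 10), (8, 15), (9, 16), (12, 17)}. x = T k \<and> y = T l)" .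
  qed
qed

section \<open>A smooth ramp\<close>

text \<open>Being differentiable $k$ times, defined by a chain of explicit derivatives so that closure under the arithmetic
operations is proved by induction on $k$.\<close>

primrec Ck :: "nat \<Rightarrow> (real \<Rightarrow> 'a::real_normed_vector) \<Rightarrow> bool" where
  "Ck 0 f = True"
| "Ck (Suc k) f = (\<exists>f'. (\<forall>x. (f has_vector_derivative f' x) (at x)) \<and> Ck k f')"

lemma Ck_SucI: "(\<And>x. (f has_vector_derivative f' x) (at x)) \<Longrightarrow> Ck k f' \<Longrightarrow> Ck (Suc k) f"
  by auto

lemma Ck_Suc_imp: "Ck (Suc k) f \<Longrightarrow> Ck k f"
  by (induction k arbitrary: f) auto

lemma Ck_const: "Ck k (\<lambda>x. c)"
  by (induction k arbitrary: c) (auto intro: has_vector_derivative_const)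

lemma Ck_ident: "Ck k (\<lambda>x. x)"
  by (cases k) (auto intro!: exI[of _ "\<lambda>x. 1"] Ck_const)

lemma Ck_add: "Ck k f \<Longrightarrow> Ck k g \<Longrightarrow> Ck k (\<lambda>x. f x + g x)"
proof (induction k arbitrary: f g)
  case (Suc k)
  then obtain f' g' where "\<And>x. (f has_vector_derivative f' x) (at x)" "Ck k f'"
    "\<And>x. (g has_vector_derivative g' x) (at x)" "Ck k g'" by auto
  then show ?case
    by (intro Ck_SucI[of _ "\<lambda>x. f' x + g' x"] has_vector_derivative_add Suc.IH)
qed simp

lemma Ck_scaleR:
  fixes f :: "real \<Rightarrow> real"
  shows "Ck k f \<Longrightarrow> Ck k g \<Longrightarrow> Ck k (\<lambda>x. f x *\<^sub>R g x)"
proof (induction k arbitrary: f g)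
  case (Suc k)
  then obtain f' g' where *: "\<And>x. (f has_vector_derivative f' x) (at x)" "Ck k f'"
    "\<And>x. (g has_vector_derivative g' x) (at x)" "Ck k g'" by auto
  have "((\<lambda>x. f x *\<^sub>R g x) has_vector_derivative f x *\<^sub>R g' x + f' x *\<^sub>R g x) (at x)" for x
    using *(1,3) by (intro has_vector_derivative_scaleR) (auto simp: has_real_derivative_iff_has_vector_derivative)
  moreover have "Ck k (\<lambda>x. f x *\<^sub>R g' x + f' x *\<^sub>R g x)"
    using Suc.prems[THEN Ck_Suc_imp] * by (intro Ck_add Suc.IH) auto
  ultimately show ?case by (rule Ck_SucI)
qed simp

lemma Ck_mult:
  fixes f g :: "real \<Rightarrow> real"
  shows "Ck k f \<Longrightarrow> Ck k g \<Longrightarrow> Ck k (\<lambda>x. f x * g x)"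
  using Ck_scaleR[of k f g] by simp

lemma Ck_affine: "Ck k f \<Longrightarrow> Ck k (\<lambda>x. f (a * x + b))"
proof (induction k arbitrary: f)
  case (Suc k)
  then obtain f' where *: "\<And>x. (f has_vector_derivative f' x) (at x)" "Ck k f'" by auto
  have "((\<lambda>x. f (a * x + b)) has_vector_derivative a *\<^sub>R f' (a * x + b)) (at x)" for x
  proof -
    have "((\<lambda>x. a * x + b) has_vector_derivative a) (at x)"
      unfolding has_real_derivative_iff_has_vector_derivative[symmetric] by (auto intro!: derivative_eq_intros)
    from vector_diff_chain_at[OF this *(1)] show ?thesis by (simp add: o_def)
  qed
  then show ?case
    by (rule Ck_SucI) (intro Ck_scaleR Ck_const Suc.IH *)
qed simp

lemma Ck_inverse:
  fixes f :: "real \<Rightarrow> real"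
  assumes "\<And>x. f x \<noteq> 0" shows "Ck k f \<Longrightarrow> Ck k (\<lambda>x. inverse (f x))"
proof (induction k)
  case (Suc k)
  then obtain f' where *: "\<And>x. (f has_vector_derivative f' x) (at x)" "Ck k f'" by auto
  have "((\<lambda>x. inverse (f x)) has_vector_derivative (- 1) * (f' x * (inverse (f x) * inverse (f x)))) (at x)" for x
    using *(1)[of x] assms[of x] unfolding has_real_derivative_iff_has_vector_derivative[symmetric]
    by (auto intro!: derivative_eq_intros)
  moreover have "Ck k (\<lambda>x. (- 1) * (f' x * (inverse (f x) * inverse (f x))))"
    using Suc.IH[OF Ck_Suc_imp[OF Suc.prems]] * by (intro Ck_mult Ck_const)
  ultimately show ?case by (rule Ck_SucI)
qed simp

text \<open>Functions $p(1/x) e^{-1/x}$, extended by 0 to $x \le 0$. The derivative of such a function is again of this form, which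
makes all of them smooth.\<close>

definition flat :: "real poly \<Rightarrow> real \<Rightarrow> real" where
  "flat p x = (if x > 0 then poly p (inverse x) * exp (- inverse x) else 0)"

lemma poly_exp_minus_tendsto_0: "((\<lambda>y. poly p y * exp (- y)) \<longlongrightarrow> 0) at_top" for p :: "real poly"
proof -
  have "((\<lambda>y. \<Sum>i\<le>degree p. coeff p i * (y ^ i / exp y)) \<longlongrightarrow> (\<Sum>i\<le>degree p. coeff p i * 0)) at_top"
    by (intro tendsto_sum tendsto_mult tendsto_const tendsto_power_div_exp_0)
  then show ?thesis by (simp add: poly_altdef sum_distrib_right exp_minus divide_inverse mult.assoc)
qed

lemma flat_has_derivative:
  "(flat p has_vector_derivative flat ([:0, 0, 1:] * (p - pderiv p)) x) (at x)"
  unfolding has_real_derivative_iff_has_vector_derivative[symmetric]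
proof (cases x "0::real" rule: linorder_cases)
  case less
  have "((\<lambda>x. 0) has_real_derivative 0) (at x)" by simp
  then have "(flat p has_real_derivative 0) (at x)"
    by (rule has_field_derivative_transform_within_open[of _ _ _ "{..<0}"]) (use less in \<open>auto simp: flat_def\<close>)
  then show "(flat p has_real_derivative flat ([:0, 0, 1:] * (p - pderiv p)) x) (at x)" using less by (simp add: flat_def)
next
  case greater
  have "((\<lambda>x. poly p (inverse x) * exp (- inverse x)) has_real_derivative
      poly ([:0, 0, 1:] * (p - pderiv p)) (inverse x) * exp (- inverse x)) (at x)"
    using greater by (auto intro!: derivative_eq_intros poly_DERIV[THEN DERIV_chain2] simp: field_simps)
  then have "(flat p has_real_derivative poly ([:0, 0, 1:] * (p - pderiv p)) (inverse x) * exp (- inverse x)) (at x)"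
    by (rule has_field_derivative_transform_within_open[of _ _ _ "{0<..}"]) (use greater in \<open>auto simp: flat_def\<close>)
  then show "(flat p has_real_derivative flat ([:0, 0, 1:] * (p - pderiv p)) x) (at x)" using greater by (simp add: flat_def)
next
  case equal
  have "((\<lambda>h. flat p h / h) \<longlongrightarrow> 0) (at_left 0)"
    by (rule tendsto_eventually) (auto simp: flat_def eventually_at_filter)
  moreover have "((\<lambda>h. flat p h / h) \<longlongrightarrow> 0) (at_right 0)"
  proof -
    have "((\<lambda>h. poly (pCons 0 p) (inverse h) * exp (- inverse h)) \<longlongrightarrow> 0) (at_right 0)"
      by (rule filterlim_compose[OF poly_exp_minus_tendsto_0 filterlim_inverse_at_top_right])
    then show ?thesis
      by (rule Lim_transform_eventually) (auto simp: flat_def eventually_at_filter divide_inverse mult_ac)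
  qed
  ultimately have "((\<lambda>h. flat p h / h) \<longlongrightarrow> 0) (at 0)" by (simp add: filterlim_split_at)
  then show "(flat p has_real_derivative flat ([:0, 0, 1:] * (p - pderiv p)) x) (at x)"
    using equal by (simp add: DERIV_def flat_def)
qed

lemma Ck_flat: "Ck k (flat p)"
  by (induction k arbitrary: p) (auto intro: flat_has_derivative)

lemma flat_1_pos: "x > 0 \<Longrightarrow> flat 1 x > 0" and flat_1_nonneg: "flat 1 x \<ge> 0" and flat_nonpos: "x \<le> 0 \<Longrightarrow> flat p x = 0"
  by (simp_all add: flat_def)

text \<open>Dividing by the symmetric sum makes the values at $u$ and $-u$ add up to 1.\<close>

definition smooth_step :: "real \<Rightarrow> real" where
  "smooth_step u = flat 1 (1 / 4 + u) * inverse (flat 1 (1 / 4 + u) + flat 1 (1 / 4 - u))"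

lemma step_denominator_pos: "flat 1 (1 / 4 + u) + flat 1 (1 / 4 - u) > 0"
proof (cases "u > - (1 / 4)")
  case True
  then show ?thesis using flat_1_pos[of "1 / 4 + u"] flat_1_nonneg[of "1 / 4 - u"] by linarith
next
  case False
  then show ?thesis using flat_1_pos[of "1 / 4 - u"] flat_1_nonneg[of "1 / 4 + u"] by linarith
qed

lemma Ck_smooth_step: "Ck k smooth_step"
proof -
  have 1: "Ck k (\<lambda>u. flat 1 (1 / 4 + u))" using Ck_affine[OF Ck_flat, of k 1 1 "1 / 4"] by (simp add: add.commute)
  have 2: "Ck k (\<lambda>u. flat 1 (1 / 4 - u))" using Ck_affine[OF Ck_flat, of k 1 "- 1" "1 / 4"] by simp
  have "Ck k (\<lambda>u. flat 1 (1 / 4 + u) * inverse (flat 1 (1 / 4 + u) + flat 1 (1 / 4 - u)))"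
    using step_denominator_pos by (intro Ck_mult Ck_inverse Ck_add 1 2) (simp add: less_imp_neq[symmetric])
  then show ?thesis unfolding smooth_step_def[abs_def] .
qed

lemma smooth_step_0: "u \<le> - (1 / 4) \<Longrightarrow> smooth_step u = 0"
  by (simp add: smooth_step_def flat_nonpos)

lemma smooth_step_minus: "smooth_step u + smooth_step (- u) = 1"
  using step_denominator_pos[of u] by (simp add: smooth_step_def divide_inverse[symmetric] add_divide_distrib[symmetric] add.commute)

lemma smooth_step_1: "u \<ge> 1 / 4 \<Longrightarrow> smooth_step u = 1"
  using smooth_step_minus[of u] smooth_step_0[of "- u"] by simp

lemma smooth_step_bounds: "0 \<le> smooth_step u" "smooth_step u \<le> 1"
proof -
  show 0: "0 \<le> smooth_step u" for u
    using step_denominator_pos[of u] flat_1_nonneg[of "1 / 4 + u"] by (simp add: smooth_step_def)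
  show "smooth_step u \<le> 1" using smooth_step_minus[of u] 0[of "- u"] by linarith
qed

text \<open>The identity switched on between $-1/4$ and $1/4$. It dips below 0 for negative $u$, which does no harm: what matters is
that the ramps of $u$ and $-u$ differ by exactly $u$.\<close>

definition ramp :: "real \<Rightarrow> real" where
  "ramp u = u * smooth_step u"

lemma Ck_ramp: "Ck k ramp"
  unfolding ramp_def[abs_def] by (intro Ck_mult Ck_ident Ck_smooth_step)

lemma ramp_simps: "u \<le> - (1 / 4) \<Longrightarrow> ramp u = 0" "u \<ge> 1 / 4 \<Longrightarrow> ramp u = u" "ramp 0 = 0"
  by (simp_all add: ramp_def smooth_step_0 smooth_step_1)

lemma ramp_minus: "ramp u - ramp (- u) = u"
  using smooth_step_minus[of u] by (simp add: ramp_def) (metis distrib_left mult.right_neutral)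

lemma ramp_abs_le: "\<bar>ramp u\<bar> \<le> \<bar>u\<bar>"
  using smooth_step_bounds[of u] by (auto simp: ramp_def abs_mult mult_left_le)

lemma ramp_derivative:
  obtains ramp' where "\<And>u. (ramp has_real_derivative ramp' u) (at u)" "\<And>u. ramp' u + ramp' (- u) = 1"
proof -
  obtain r where r: "\<And>u. (ramp has_real_derivative r u) (at u)"
    using Ck_ramp[of "Suc 0"] by (auto simp: has_real_derivative_iff_has_vector_derivative)
  have "((\<lambda>u. ramp u - ramp (- u)) has_real_derivative r u + r (- u)) (at u)" for u
    by (auto intro!: derivative_eq_intros r DERIV_chain2[OF r])
  then have "((\<lambda>u. u) has_real_derivative r u + r (- u)) (at u)" for u by (simp add: ramp_minus)
  then have "r u + r (- u) = 1" for u by (rule DERIV_unique) simp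
  then show thesis using that[of r] r by blast
qed

section \<open>Smooth corners\<close>

text \<open>The iterated derivatives in the definition of a smooth curve only depend on local behaviour, so pieces may be
replaced by globally defined smooth functions.\<close>

definition locally_smooth :: "(real \<Rightarrow> complex) \<Rightarrow> bool" where
  "locally_smooth f \<longleftrightarrow> (\<forall>t. \<exists>g S. open S \<and> t \<in> S \<and> (\<forall>k. Ck k g) \<and> (\<forall>u\<in>S. f u = g u))"

lemma locally_smooth_derivative:
  assumes "locally_smooth f"
  shows "locally_smooth (\<lambda>u. vector_derivative f (at u))" "f differentiable at t"
proof -
  have *: "\<exists>g S. open S \<and> t \<in> S \<and> (\<forall>k. Ck k g) \<and> (\<forall>u\<in>S. (f has_vector_derivative g u) (at u))" for t
  proof -
    obtain g S where g: "open S" "t \<in> S" "\<And>k. Ck k g" "\<And>u. u \<in> S \<Longrightarrow> f u = g u"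
      using assms unfolding locally_smooth_def by meson
    let ?g' = "\<lambda>u. vector_derivative g (at u)"
    have "(\<forall>u. (g has_vector_derivative ?g' u) (at u)) \<and> Ck k ?g'" for k
    proof -
      obtain g' where "\<forall>u. (g has_vector_derivative g' u) (at u)" "Ck k g'" using g(3)[of "Suc k"] by auto
      moreover from this(1) have "g' = ?g'" by (metis vector_derivative_at)
      ultimately show ?thesis by simp
    qed
    moreover have "(f has_vector_derivative ?g' u) (at u)" if "u \<in> S" for u
      by (rule has_vector_derivative_transform_within_open[OF _ g(1) that]) (use calculation g(4) in auto)
    ultimately show ?thesis using g(1,2) by blast
  qed
  show "locally_smooth (\<lambda>u. vector_derivative f (at u))"
    unfolding locally_smooth_def
  proof
    fix t
    obtain g S where g: "open S" "t \<in> S" "\<forall>k. Ck k g" "\<forall>u\<in>S. (f has_vector_derivative g u) (at u)"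
      using * by blast
    then have "\<forall>u\<in>S. vector_derivative f (at u) = g u" by (simp add: vector_derivative_at)
    then show "\<exists>g S. open S \<and> t \<in> S \<and> (\<forall>k. Ck k g) \<and> (\<forall>u\<in>S. vector_derivative f (at u) = g u)"
      using g by blast
  qed
  show "f differentiable at t"
    using * differentiableI_vector by blast
qed

lemma smooth_curveI:
  assumes "locally_smooth \<gamma>" shows "smooth_curve \<gamma>"
proof -
  have "locally_smooth (((\<lambda>f u. vector_derivative f (at u)) ^^ k) \<gamma>)" for k
    by (induction k) (use assms locally_smooth_derivative(1) in auto)
  then show ?thesis unfolding smooth_curve_def using locally_smooth_derivative(2) by blast
qed

text \<open>A rounded corner at $p$, entered in direction $a$ and left in direction $b$. Because of \<open>ramp_minus\<close> it is a
straight line when $a = b$, so that corners and straight passages need not be distinguished. The same identity yields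
the injectivity below, and its derivative shows that the velocity does not vanish.\<close>

definition corner :: "complex \<Rightarrow> complex \<Rightarrow> complex \<Rightarrow> real \<Rightarrow> complex" where
  "corner p a b u = p + (- ramp (- u)) *\<^sub>R a + ramp u *\<^sub>R b"

lemma Ck_corner: "Ck k (corner p a b)"
proof -
  have "Ck k (\<lambda>u. - ramp (- u))"
    using Ck_mult[OF Ck_const[of k "- 1"] Ck_affine[OF Ck_ramp, of k "- 1" 0]] by simp
  then show ?thesis unfolding corner_def[abs_def] by (intro Ck_add Ck_scaleR Ck_const Ck_ramp)
qed

lemma corner_straight: "corner p a a u = p + u *\<^sub>R a"
  using ramp_minus[of u] by (simp add: corner_def algebra_simps flip: scaleR_left.diff)

lemma corner_before: "u \<le> - (1 / 4) \<Longrightarrow> corner p a b u = p + u *\<^sub>R a"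
  and corner_after: "u \<ge> 1 / 4 \<Longrightarrow> corner p a b u = p + u *\<^sub>R b"
  by (simp_all add: corner_def ramp_simps)

lemma corner_has_derivative:
  obtains r where "\<And>p a b u. (corner p a b has_vector_derivative r (- u) *\<^sub>R a + r u *\<^sub>R b) (at u)"
    "\<And>u. r u + r (- u) = (1 :: real)"
proof -
  obtain r where r: "\<And>u. (ramp has_real_derivative r u) (at u)" "\<And>u. r u + r (- u) = 1"
    using ramp_derivative by metis
  have "(corner p a b has_vector_derivative r (- u) *\<^sub>R a + r u *\<^sub>R b) (at u)" for p a b u
  proof -
    have "((\<lambda>u. - ramp (- u)) has_real_derivative r (- u)) (at u)"
      by (auto intro!: derivative_eq_intros DERIV_chain2[OF r(1)])
    from has_vector_derivative_scaleR[OF this has_vector_derivative_const[of a]]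
      has_vector_derivative_scaleR[OF r(1) has_vector_derivative_const[of b]]
    show ?thesis unfolding corner_def[abs_def]
      using has_vector_derivative_add[OF has_vector_derivative_add[OF has_vector_derivative_const[of p]]] by fastforce
  qed
  then show thesis using r(2) that by blast
qed

definition unit_dir :: "complex \<Rightarrow> bool" where
  "unit_dir a \<longleftrightarrow> a \<in> {1, -1, \<i>, -\<i>}"

lemma unit_dirs_cases:
  assumes "unit_dir a" "unit_dir b" "b \<noteq> - a"
  obtains "b = a" | "Re a = 0" "Im b = 0" "\<bar>Im a\<bar> = 1" "\<bar>Re b\<bar> = 1" | "Im a = 0" "Re b = 0" "\<bar>Re a\<bar> = 1" "\<bar>Im b\<bar> = 1"
  using assms unfolding unit_dir_def by (auto simp: complex_eq_iff)

lemma corner_inj: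
  assumes "unit_dir a" "unit_dir b" "b \<noteq> - a" "corner p a b u = corner p a b v" shows "u = v"
  using assms(1-3)
proof (cases rule: unit_dirs_cases)
  case 1
  then show ?thesis using assms(1,4) by (auto simp: corner_straight unit_dir_def)
next
  case 2
  have "Re (corner p a b w) = Re p + ramp w * Re b" "Im (corner p a b w) = Im p + (- ramp (- w)) * Im a" for w
    unfolding corner_def using 2(1,2) by simp_all
  then have "ramp u * Re b = ramp v * Re b" "ramp (- u) * Im a = ramp (- v) * Im a"
    using assms(4) by (smt (verit) mult_minus_left)+
  moreover have "Re b \<noteq> 0" "Im a \<noteq> 0" using 2(3,4) by linarith+
  ultimately have "ramp (- u) = ramp (- v)" "ramp u = ramp v" by (metis mult_right_cancel)+
  then show ?thesis using ramp_minus[of u] ramp_minus[of v] by linarith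
next
  case 3
  have "Im (corner p a b w) = Im p + ramp w * Im b" "Re (corner p a b w) = Re p + (- ramp (- w)) * Re a" for w
    unfolding corner_def using 3(1,2) by simp_all
  then have "ramp u * Im b = ramp v * Im b" "ramp (- u) * Re a = ramp (- v) * Re a"
    using assms(4) by (smt (verit) mult_minus_left)+
  moreover have "Im b \<noteq> 0" "Re a \<noteq> 0" using 3(3,4) by linarith+
  ultimately have "ramp (- u) = ramp (- v)" "ramp u = ramp v" by (metis mult_right_cancel)+
  then show ?thesis using ramp_minus[of u] ramp_minus[of v] by linarith
qed

lemma corner_velocity_nonzero:
  assumes "unit_dir a" "unit_dir b" "b \<noteq> - a" "x + y = (1 :: real)" shows "y *\<^sub>R a + x *\<^sub>R b \<noteq> 0"
  using assms(1-3)
proof (cases rule: unit_dirs_cases)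
  case 1
  then have "y *\<^sub>R a + x *\<^sub>R b = a" using assms(4) by (metis add.commute scaleR_left.add scaleR_one)
  then show ?thesis using assms(1) by (auto simp: unit_dir_def)
next
  case 2
  then show ?thesis using assms(4) by (auto simp: complex_eq_iff)
next
  case 3
  then show ?thesis using assms(4) by (auto simp: complex_eq_iff)
qed

lemma corner_in_cell:
  assumes "unit_dir a" "unit_dir b" "b \<noteq> - a"
  shows "\<bar>Re (corner p a b u) - Re p\<bar> \<le> \<bar>u\<bar>" "\<bar>Im (corner p a b u) - Im p\<bar> \<le> \<bar>u\<bar>"
proof -
  have "\<bar>Re (corner p a b u) - Re p\<bar> \<le> \<bar>u\<bar> \<and> \<bar>Im (corner p a b u) - Im p\<bar> \<le> \<bar>u\<bar>"
    using assms
  proof (cases rule: unit_dirs_cases)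
    case 1
    then show ?thesis using assms(1) by (auto simp: corner_straight unit_dir_def)
  qed (use ramp_abs_le[of u] ramp_abs_le[of "- u"] in \<open>auto simp: corner_def abs_mult\<close>)
  then show "\<bar>Re (corner p a b u) - Re p\<bar> \<le> \<bar>u\<bar>" "\<bar>Im (corner p a b u) - Im p\<bar> \<le> \<bar>u\<bar>" by auto
qed

section \<open>Curves along lattice walks\<close>

text \<open>The walk is indexed by all integers with period \<open>m\<close>; the points $k$ and $l$ are different visits of the walk
when $m$ does not divide $k - l$.\<close>

locale grid_walk =
  fixes m :: nat and X Y :: "int \<Rightarrow> int"
  assumes m_pos: "m > 0"
    and periodic: "X (k + int m) = X k" "Y (k + int m) = Y k"
    and unit_step: "\<bar>X (k + 1) - X k\<bar> + \<bar>Y (k + 1) - Y k\<bar> = 1"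
    and no_uturn: "X (k + 2) \<noteq> X k \<or> Y (k + 2) \<noteq> Y k"
    and straight: "X k = X l \<Longrightarrow> Y k = Y l \<Longrightarrow> \<not> int m dvd k - l \<Longrightarrow>
        X (k + 1) - X k = X k - X (k - 1) \<and> Y (k + 1) - Y k = Y k - Y (k - 1)"
    and perpendicular: "X k = X l \<Longrightarrow> Y k = Y l \<Longrightarrow> \<not> int m dvd k - l \<Longrightarrow>
        (X (k + 1) - X k) * (X (l + 1) - X l) + (Y (k + 1) - Y k) * (Y (l + 1) - Y l) = 0"
begin

definition P :: "int \<Rightarrow> complex" where "P k = Complex (of_int (X k)) (of_int (Y k))"
definition d :: "int \<Rightarrow> complex" where "d k = P (k + 1) - P k"
definition piece :: "int \<Rightarrow> real \<Rightarrow> complex" where "piece k = corner (P k) (d (k - 1)) (d k)"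
definition idx :: "real \<Rightarrow> int" where "idx t = \<lfloor>real m * t + 1 / 2\<rfloor>"
definition curve :: "real \<Rightarrow> complex" where "curve t = piece (idx t) (real m * t - idx t)"
definition crossing :: "int \<Rightarrow> bool" where
  "crossing k \<longleftrightarrow> (\<exists>l. X k = X l \<and> Y k = Y l \<and> \<not> int m dvd k - l)"

lemma periodic_mult: "X (k + int m * q) = X k" "Y (k + int m * q) = Y k"
proof -
  have *: "X (k + int m * int n) = X k \<and> Y (k + int m * int n) = Y k" for k n
    by (induction n) (use periodic[of "k + int m * int _"] in \<open>auto simp: algebra_simps\<close>)
  have "X (k + int m * q) = X k \<and> Y (k + int m * q) = Y k"
  proof (cases "q \<ge> 0")
    case True
    then show ?thesis using *[of k "nat q"] by simp
  next
    case False
    then show ?thesis using *[of "k + int m * q" "nat (- q)"] by (simp add: algebra_simps)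
  qed
  then show "X (k + int m * q) = X k" "Y (k + int m * q) = Y k" by auto
qed

lemma P_eq_iff: "P k = P l \<longleftrightarrow> X k = X l \<and> Y k = Y l"
  by (simp add: P_def)

lemma P_periodic: "P (k + int m * q) = P k"
  by (simp add: P_eq_iff periodic_mult)

lemma piece_periodic: "piece (k + int m * q) = piece k"
  using P_periodic[of k q] P_periodic[of "k - 1" q] P_periodic[of "k + 1" q]
  by (simp add: piece_def d_def algebra_simps)

lemma piece_cong_dvd: "int m dvd k - l \<Longrightarrow> piece k = piece l"
  using piece_periodic[of l] by (metis add_diff_cancel_left' diff_add_cancel dvdE add.commute)

lemma unit_dir_d: "unit_dir (d k)"
proof -
  have "(X (k + 1) - X k, Y (k + 1) - Y k) \<in> {(1, 0), (-1, 0), (0, 1), (0, -1)}"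
    using unit_step[of k] by auto
  then show ?thesis by (auto simp: unit_dir_def d_def P_def complex_eq_iff)
qed

lemma d_not_reversed: "d k \<noteq> - d (k - 1)"
proof -
  have "X (k + 1) \<noteq> X (k - 1) \<or> Y (k + 1) \<noteq> Y (k - 1)"
    using no_uturn[of "k - 1"] by (simp add: add.commute)
  then show ?thesis by (auto simp: d_def P_def complex_eq_iff)
qed

lemma idx_bounds: "real m * t - idx t \<ge> - (1 / 2)" "real m * t - idx t < 1 / 2"
  unfolding idx_def by linarith+

text \<open>Past a quarter of a unit step both neighbouring corners have become the same straight segment, so every piece
describes the curve on an interval longer than one step. This overlap gives smoothness at the transitions.\<close>

lemma curve_near:
  assumes "\<bar>real m * t - of_int k\<bar> < 3 / 4" shows "curve t = piece k (real m * t - of_int k)"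
proof -
  have "idx t = k \<or> idx t = k + 1 \<or> idx t = k - 1"
    using assms idx_bounds[of t] by linarith
  then show ?thesis
  proof (elim disjE)
    assume i: "idx t = k + 1"
    then have "curve t = P (k + 1) + (real m * t - (k + 1)) *\<^sub>R d k"
      using assms idx_bounds[of t] unfolding curve_def piece_def by (subst corner_before) auto
    moreover have "piece k (real m * t - of_int k) = P k + (real m * t - k) *\<^sub>R d k"
      using i assms idx_bounds[of t] unfolding piece_def by (subst corner_after) auto
    moreover have "P (k + 1) = P k + d k" by (simp add: d_def)
    ultimately show ?thesis by (simp add: scaleR_left_diff_distrib scaleR_left_distrib)
  next
    assume i: "idx t = k - 1"
    then have "curve t = P (k - 1) + (real m * t - (k - 1)) *\<^sub>R d (k - 1)"
      using assms idx_bounds[of t] unfolding curve_def piece_def by (subst corner_after) auto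
    moreover have "piece k (real m * t - of_int k) = P k + (real m * t - k) *\<^sub>R d (k - 1)"
      using i assms idx_bounds[of t] unfolding piece_def by (subst corner_before) auto
    moreover have "P k = P (k - 1) + d (k - 1)" by (simp add: d_def)
    ultimately show ?thesis by (simp add: scaleR_left_diff_distrib scaleR_left_distrib)
  qed (simp add: curve_def)
qed

lemma curve_periodic: "curve (t + 1) = curve t"
proof -
  have "idx (t + 1) = idx t + int m"
    unfolding idx_def by (simp add: algebra_simps floor_add_int flip: floor_add_int)
  then show ?thesis using piece_periodic[of "idx t" 1] by (simp add: curve_def algebra_simps)
qed

lemma curve_at: "curve (of_int k / real m) = P k"
  using curve_near[of "of_int k / real m" k] m_pos by (simp add: piece_def corner_def ramp_simps)

lemma curve_locally_smooth: "locally_smooth curve"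
  unfolding locally_smooth_def
proof
  fix t
  define k where "k = idx t"
  let ?S = "{u. \<bar>real m * u - of_int k\<bar> < 3 / 4}"
  have "open ?S" by (intro open_Collect_less continuous_intros)
  moreover have "t \<in> ?S" using idx_bounds[of t] unfolding k_def mem_Collect_eq by linarith
  moreover have "Ck j (\<lambda>u. piece k (real m * u - of_int k))" for j
    using Ck_affine[OF Ck_corner, of j _ _ _ "real m" "- of_int k"] by (simp add: piece_def)
  ultimately show "\<exists>g S. open S \<and> t \<in> S \<and> (\<forall>k. Ck k g) \<and> (\<forall>u\<in>S. curve u = g u)"
    by (intro exI[of _ "\<lambda>u. piece k (real m * u - of_int k)"] exI[of _ ?S]) (auto intro: curve_near)
qed

lemma curve_velocity:
  obtains r :: "real \<Rightarrow> real" where "\<And>k t. \<bar>real m * t - of_int k\<bar> < 3 / 4 \<Longrightarrow>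
      (curve has_vector_derivative real m *\<^sub>R (r (- (real m * t - of_int k)) *\<^sub>R d (k - 1) + r (real m * t - of_int k) *\<^sub>R d k)) (at t)"
    "\<And>u. r u + r (- u) = 1"
proof -
  obtain r where r: "\<And>p a b u. (corner p a b has_vector_derivative r (- u) *\<^sub>R a + r u *\<^sub>R b) (at u)"
    "\<And>u. r u + r (- u) = (1 :: real)"
    using corner_has_derivative by blast
  show thesis
  proof (rule that[of r])
    fix k t assume t: "\<bar>real m * t - of_int k\<bar> < 3 / 4"
    let ?S = "{u. \<bar>real m * u - of_int k\<bar> < 3 / 4}"
    have lin: "((\<lambda>u. real m * u - of_int k) has_vector_derivative real m) (at t)"
      unfolding has_real_derivative_iff_has_vector_derivative[symmetric] by (auto intro!: derivative_eq_intros)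
    have "((\<lambda>u. piece k (real m * u - of_int k)) has_vector_derivative
        real m *\<^sub>R (r (- (real m * t - of_int k)) *\<^sub>R d (k - 1) + r (real m * t - of_int k) *\<^sub>R d k)) (at t)"
      using vector_diff_chain_at[OF lin r(1)] by (simp add: o_def piece_def)
    then show "(curve has_vector_derivative real m *\<^sub>R (r (- (real m * t - of_int k)) *\<^sub>R d (k - 1) + r (real m * t - of_int k) *\<^sub>R d k)) (at t)"
      by (rule has_vector_derivative_transform_within_open[of _ _ _ ?S])
        (use t curve_near in \<open>auto intro!: open_Collect_less continuous_intros\<close>)
  qed (rule r(2))
qed

lemma immersed_curve: "immersed_closed_curve curve"
proof -
  have "vector_derivative curve (at t) \<noteq> 0" for t
  proof -
    obtain r where r: "\<And>k t. \<bar>real m * t - of_int k\<bar> < 3 / 4 \<Longrightarrow>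
      (curve has_vector_derivative real m *\<^sub>R (r (- (real m * t - of_int k)) *\<^sub>R d (k - 1) + r (real m * t - of_int k) *\<^sub>R d k)) (at t)"
      "\<And>u :: real. r u + r (- u) = (1 :: real)" by (rule curve_velocity) blast
    define u where "u = real m * t - idx t"
    have "\<bar>real m * t - of_int (idx t)\<bar> < 3 / 4" using idx_bounds[of t] by linarith
    from vector_derivative_at[OF r(1)[OF this]]
    have "vector_derivative curve (at t) = real m *\<^sub>R (r (- u) *\<^sub>R d (idx t - 1) + r u *\<^sub>R d (idx t))"
      by (simp add: u_def)
    then show ?thesis
      using corner_velocity_nonzero[OF unit_dir_d unit_dir_d d_not_reversed r(2)] m_pos by simp
  qed
  then show ?thesis
    unfolding immersed_closed_curve_def using curve_periodic smooth_curveI[OF curve_locally_smooth] by blast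
qed

lemma crossing_straight: "crossing k \<Longrightarrow> d (k - 1) = d k"
  unfolding crossing_def using straight[of k] by (auto simp: d_def P_def complex_eq_iff simp flip: of_int_diff)

lemma crossing_perpendicular:
  assumes "P k = P l" "\<not> int m dvd k - l"
  shows "Re (d k) * Re (d l) + Im (d k) * Im (d l) = 0"
proof -
  have "(X (k + 1) - X k) * (X (l + 1) - X l) + (Y (k + 1) - Y k) * (Y (l + 1) - Y l) = 0"
    using assms perpendicular unfolding P_eq_iff by blast
  then have "of_int ((X (k + 1) - X k) * (X (l + 1) - X l) + (Y (k + 1) - Y k) * (Y (l + 1) - Y l)) = (0 :: real)"
    by simp
  then show ?thesis by (simp add: d_def P_def)
qed

lemma crossingI: "P k = P l \<Longrightarrow> \<not> int m dvd k - l \<Longrightarrow> crossing k \<and> crossing l"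
  unfolding crossing_def P_eq_iff by (metis dvd_diff_commute)

lemma diff_Ints_of_dvd:
  assumes "int m dvd k - l" "real m * s - k = real m * t - l" shows "s - t \<in> \<int>"
proof -
  obtain q where q: "k - l = int m * q" using assms(1) by (rule dvdE)
  have "real m * (s - t) = of_int (k - l)" using assms(2) by (simp add: algebra_simps)
  then have "real m * (s - t) = real m * of_int q" using q by simp
  then show ?thesis using m_pos by simp
qed

text \<open>Inside its unit time interval a piece stays in the open unit cell around its lattice point, and at the initial time it is at
the midpoint of a lattice edge, on the boundary of the cell. Two coinciding points in the interior therefore
belong to the same lattice point, where the walk crosses itself straight and perpendicularly; coinciding edge
midpoints belong to one edge, which cannot be used twice without turning back or violating perpendicularity.\<close>

lemma curve_coincidence:
  assumes eq: "curve s = curve t"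
  shows "s - t \<in> \<int> \<or> (\<exists>k l. real m * s = of_int k \<and> real m * t = of_int l \<and> P k = P l \<and> \<not> int m dvd k - l)"
proof -
  define k l u v where "k = idx s" and "l = idx t" and "u = real m * s - k" and "v = real m * t - l"
  have u: "- (1 / 2) \<le> u" "u < 1 / 2" and v: "- (1 / 2) \<le> v" "v < 1 / 2"
    using idx_bounds[of s] idx_bounds[of t] by (auto simp: k_def l_def u_def v_def)
  have pieces: "piece k u = piece l v" using eq by (simp add: curve_def k_def l_def u_def v_def)
  have same: "s - t \<in> \<int>" if "int m dvd k - l" "u = v"
    using diff_Ints_of_dvd[of k l s t] that by (simp add: u_def v_def)
  have cell: "\<bar>Re (piece j w) - X j\<bar> \<le> \<bar>w\<bar>" "\<bar>Im (piece j w) - Y j\<bar> \<le> \<bar>w\<bar>" for j w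
    using corner_in_cell[OF unit_dir_d unit_dir_d d_not_reversed, of "P j" j w] by (simp_all add: piece_def P_def)
  have half: "2 * Re (piece j (- (1 / 2))) = X j + X (j - 1)" "2 * Im (piece j (- (1 / 2))) = Y j + Y (j - 1)" for j
  proof -
    have "piece j (- (1 / 2)) = P j + (- (1 / 2)) *\<^sub>R d (j - 1)"
      unfolding piece_def by (rule corner_before) simp
    then have "Re (piece j (- (1 / 2))) = X j - 1 / 2 * (real_of_int (X j) - X (j - 1))"
      "Im (piece j (- (1 / 2))) = Y j - 1 / 2 * (real_of_int (Y j) - Y (j - 1))"
      by (simp_all add: d_def P_def)
    moreover have "2 * (x - 1 / 2 * (x - y)) = x + y" for x y :: real by argo
    ultimately show "2 * Re (piece j (- (1 / 2))) = X j + X (j - 1)" "2 * Im (piece j (- (1 / 2))) = Y j + Y (j - 1)"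
      by (simp_all only: of_int_add)
  qed
  \<comment> \<open>One coordinate of the midpoint of an edge is a half-integer, so it is in no open cell.\<close>
  have odd: "odd (X j + X (j - 1)) \<or> odd (Y j + Y (j - 1))" for j
    using unit_step[of "j - 1"] by simp presburger
  have mixed: False if "piece i (- (1 / 2)) = piece j w" "- (1 / 2) < w" "w < 1 / 2" for i j w
  proof -
    have "\<bar>w\<bar> < 1 / 2" using that by auto
    then have "\<bar>real_of_int (X i + X (i - 1) - 2 * X j)\<bar> < 1" "\<bar>real_of_int (Y i + Y (i - 1) - 2 * Y j)\<bar> < 1"
      using cell[where j = j and w = w] half[of i] that(1) by (auto simp: abs_if split: if_splits)
    then have "X i + X (i - 1) = 2 * X j" "Y i + Y (i - 1) = 2 * Y j" by linarith+
    then show False using odd[of i] by simp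
  qed
  consider "u \<noteq> - (1 / 2)" "v \<noteq> - (1 / 2)" | "u = - (1 / 2)" "v = - (1 / 2)"
    using mixed[of k l v] mixed[of l k u] pieces u v by fastforce
  then show ?thesis
  proof cases
    case 1
    have "\<bar>u\<bar> < 1 / 2" "\<bar>v\<bar> < 1 / 2" using 1 u v by auto
    then have "\<bar>real_of_int (X k - X l)\<bar> < 1" "\<bar>real_of_int (Y k - Y l)\<bar> < 1"
      using cell[where j = k and w = u] cell[where j = l and w = v] unfolding pieces of_int_diff by linarith+
    then have P: "P k = P l" by (simp add: P_eq_iff) linarith
    show ?thesis
    proof (cases "int m dvd k - l")
      case True
      then have "piece l u = piece l v" using pieces piece_cong_dvd by metis
      then have "u = v" unfolding piece_def by (rule corner_inj[OF unit_dir_d unit_dir_d d_not_reversed])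
      then show ?thesis using same True by blast
    next
      case False
      then have "d (k - 1) = d k" "d (l - 1) = d l" using crossing_straight crossingI P by blast+
      then have "u *\<^sub>R d k = v *\<^sub>R d l" using pieces P by (simp add: piece_def corner_straight)
      then have "u * Re (d k) = v * Re (d l)" "u * Im (d k) = v * Im (d l)" by (simp_all add: complex_eq_iff)
      then have "u = 0 \<and> v = 0"
        using crossing_perpendicular[OF P False] unit_dir_d[of k] unit_dir_d[of l] unfolding unit_dir_def by auto
      then have "real m * s = k" "real m * t = l" by (simp_all add: u_def v_def)
      then show ?thesis using P False by blast
    qed
  next
    case 2
    have "real_of_int (X k + X (k - 1)) = real_of_int (X l + X (l - 1))" "real_of_int (Y k + Y (k - 1)) = real_of_int (Y l + Y (l - 1))"
      using half[of k] half[of l] pieces 2 by simp_all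
    then have "X k + X (k - 1) = X l + X (l - 1)" "Y k + Y (k - 1) = Y l + Y (l - 1)" by linarith+
    then consider "X k = X l" "Y k = Y l" "X (k - 1) = X (l - 1)" "Y (k - 1) = Y (l - 1)"
      | "X k = X (l - 1)" "Y k = Y (l - 1)" "X (k - 1) = X l" "Y (k - 1) = Y l"
      using unit_step[of "k - 1"] unit_step[of "l - 1"] by (simp; smt (verit))
    then show ?thesis
    proof cases
      case a: 1
      have "int m dvd k - l"
      proof (rule ccontr)
        assume n: "\<not> int m dvd k - l"
        have P: "P k = P l" using a by (simp add: P_eq_iff)
        then have "d (k - 1) = d k" "d (l - 1) = d l" using crossing_straight crossingI n by blast+
        moreover have "d (k - 1) = d (l - 1)" using a by (simp add: d_def P_def)
        ultimately have "d k = d l" by simp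
        then show False using crossing_perpendicular[OF P n] unit_dir_d[of l] unfolding unit_dir_def by auto
      qed
      then show ?thesis using same 2 by simp
    next
      case b: 2
      have P: "P k = P (l - 1)" using b by (simp add: P_eq_iff)
      have "d (k - 1) = - d (l - 1)" using b by (simp add: d_def P_def complex_eq_iff)
      moreover have False if n: "\<not> int m dvd k - (l - 1)"
      proof -
        have "d (k - 1) = d k" using crossing_straight crossingI P n by blast
        then have "d k = - d (l - 1)" using \<open>d (k - 1) = - d (l - 1)\<close> by simp
        then show False using crossing_perpendicular[OF P n] unit_dir_d[of "l - 1"] unfolding unit_dir_def by auto
      qed
      moreover have False if "int m dvd k - (l - 1)"
      proof -
        obtain q where q: "k = l - 1 + int m * q" using \<open>int m dvd k - (l - 1)\<close> by (metis add_diff_cancel_left' diff_add_cancel dvdE add.commute)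
        then have "k + 1 = l + int m * q" by simp
        then have "P (k + 1) = P l" "P k = P (l - 1)" using q P_periodic by metis+
        then have "d k = d (l - 1)" by (simp add: d_def)
        then show False using \<open>d (k - 1) = - d (l - 1)\<close> d_not_reversed[of k] by simp
      qed
      ultimately show ?thesis by blast
    qed
  qed
qed

lemma mod_representative:
  obtains i where "i < m" "int m dvd k - int i" "P (int i) = P k"
proof -
  define i where "i = nat (k mod int m)"
  have "int i = k mod int m" using m_pos by (simp add: i_def)
  moreover have "k - k mod int m = int m * (k div int m)" by (simp add: minus_mod_eq_mult_div)
  ultimately have eq: "k = int i + int m * (k div int m)" by simp
  then have "P (int i) = P k" using P_periodic by metis
  moreover have "i < m" using m_pos by (simp add: i_def nat_less_iff)
  moreover have "int m dvd k - int i" using eq by (metis add_diff_cancel_left' dvd_triv_left)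
  ultimately show thesis using that by blast
qed

lemma not_dvd_small: "i < m \<Longrightarrow> j < m \<Longrightarrow> int m dvd int i - int j \<longleftrightarrow> i = j"
proof
  assume "i < m" "j < m" "int m dvd int i - int j"
  then have "\<bar>int i - int j\<bar> < int m" by linarith
  then show "i = j" using \<open>int m dvd int i - int j\<close> dvd_imp_le_int[of "int i - int j" "int m"] by fastforce
qed simp

lemma param_in_unit: "i < m \<Longrightarrow> of_int (int i) / real m \<in> {0..<1}"
  by simp

lemma self_intersections_curve:
  "self_intersections curve = {P (int i) | i j. i < m \<and> j < m \<and> i \<noteq> j \<and> P (int i) = P (int j)}" (is "_ = ?R")
proof (intro equalityI subsetI)
  fix p assume "p \<in> self_intersections curve"
  then obtain s t where st: "s \<in> {0..<1}" "t \<in> {0..<1}" "s \<noteq> t" "curve s = p" "curve t = p"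
    unfolding self_intersections_def by blast
  have "s - t \<notin> \<int>"
  proof
    assume "s - t \<in> \<int>"
    then obtain z where "s - t = of_int z" by (auto elim: Ints_cases)
    then have "real_of_int z < 1" "- 1 < real_of_int z" using st(1,2) by auto
    then have "z = 0" by linarith
    then show False using st(3) \<open>s - t = of_int z\<close> by simp
  qed
  then obtain k l where kl: "real m * s = of_int k" "P k = P l" "\<not> int m dvd k - l"
    using curve_coincidence[of s t] st by auto
  have "s = of_int k / real m" using kl(1) m_pos by (simp add: field_simps)
  then have "p = P k" using curve_at[of k] st(4) by simp
  obtain i where i: "i < m" "int m dvd k - int i" "P (int i) = P k" by (rule mod_representative)
  obtain j where j: "j < m" "int m dvd l - int j" "P (int j) = P l" by (rule mod_representative)
  have "i \<noteq> j"
  proof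
    assume "i = j"
    then have "int m dvd (k - int i) - (l - int i)" using i(2) j(2) by (metis dvd_diff)
    then show False using kl(3) by simp
  qed
  then show "p \<in> ?R" using i j kl(2) \<open>p = P k\<close> by (metis (mono_tags, lifting) mem_Collect_eq)
next
  fix p assume "p \<in> ?R"
  then obtain i j where ij: "i < m" "j < m" "i \<noteq> j" "p = P (int i)" "P (int i) = P (int j)" by blast
  then show "p \<in> self_intersections curve"
    unfolding self_intersections_def
    using param_in_unit[of i] param_in_unit[of j] curve_at[of "int i"] curve_at[of "int j"] m_pos
    by (intro CollectI bexI[of _ "of_int (int i) / real m"] bexI[of _ "of_int (int j) / real m"]) (auto simp: field_simps)
qed

lemma curve_fibre:
  assumes "p \<in> self_intersections curve" "curve t = p"
  shows "\<exists>k. real m * t = of_int k"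
proof -
  obtain i j where "p = P (int i)" using assms(1) unfolding self_intersections_curve by blast
  then have "curve t = curve (of_int (int i) / real m)" using assms(2) curve_at[of "int i"] by simp
  from curve_coincidence[OF this] show ?thesis
  proof
    assume "t - of_int (int i) / real m \<in> \<int>"
    then obtain z where "t - of_int (int i) / real m = of_int z" by (auto elim: Ints_cases)
    then have "real m * t = of_int (int i + int m * z)" using m_pos by (simp add: field_simps)
    then show ?thesis by blast
  qed blast
qed

lemma unit_dirs_perpendicular:
  assumes "unit_dir a" "unit_dir b" "Re a * Re b + Im a * Im b = 0" shows "Re a = 0 \<longleftrightarrow> Re b \<noteq> 0"
  using assms unfolding unit_dir_def by auto

lemma no_triple_point:
  assumes "i < m" "j < m" "k < m" "i \<noteq> j" "P (int i) = P (int j)" "P (int k) = P (int i)"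
  shows "k = i \<or> k = j"
proof (rule ccontr)
  assume "\<not> (k = i \<or> k = j)"
  then have "Re (d i) * Re (d j) + Im (d i) * Im (d j) = 0" "Re (d k) * Re (d i) + Im (d k) * Im (d i) = 0"
    "Re (d k) * Re (d j) + Im (d k) * Im (d j) = 0"
    using assms by (intro crossing_perpendicular; simp add: not_dvd_small)+
  then show False using unit_dirs_perpendicular[OF unit_dir_d unit_dir_d] by blast
qed

lemma fibre_eq:
  assumes "i < m" "j < m" "i \<noteq> j" "P (int i) = P (int j)"
  shows "{t\<in>{0..<1}. curve t = P (int i)} = {of_int (int i) / real m, of_int (int j) / real m}"
proof (intro equalityI subsetI)
  fix t assume t: "t \<in> {t\<in>{0..<1}. curve t = P (int i)}"
  have "P (int i) \<in> self_intersections curve" unfolding self_intersections_curve using assms by blast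
  then obtain k where k: "real m * t = of_int k" using curve_fibre t by blast
  then have k': "t = of_int k / real m" using m_pos by (simp add: field_simps)
  have "0 \<le> real_of_int k" "real_of_int k < real m" using t k m_pos by (auto simp: k[symmetric])
  then have "k = int (nat k)" "nat k < m" by auto
  moreover have "P k = P (int i)" using t k' curve_at by auto
  ultimately have "nat k = i \<or> nat k = j" using no_triple_point[OF assms(1,2) _ assms(3,4), of "nat k"] by metis
  then have "k = int i \<or> k = int j" using \<open>k = int (nat k)\<close> by metis
  then show "t \<in> {of_int (int i) / real m, of_int (int j) / real m}" using k' by auto
next
  fix t assume "t \<in> {of_int (int i) / real m, of_int (int j) / real m}"
  then show "t \<in> {t\<in>{0..<1}. curve t = P (int i)}"
    using param_in_unit[OF assms(1)] param_in_unit[OF assms(2)] curve_at[of "int i"] curve_at[of "int j"] assms(4) by auto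
qed

lemma span_perpendicular:
  assumes "unit_dir a" "unit_dir b" "Re a * Re b + Im a * Im b = 0" "c \<noteq> 0"
  shows "span {c *\<^sub>R a, c *\<^sub>R b} = UNIV"
proof -
  have "z \<in> span {c *\<^sub>R a, c *\<^sub>R b}" for z
  proof -
    let ?x = "(Re z * Re a + Im z * Im a) / c" and ?y = "(Re z * Re b + Im z * Im b) / c"
    have "z = ?x *\<^sub>R (c *\<^sub>R a) + ?y *\<^sub>R (c *\<^sub>R b)"
      using assms unfolding unit_dir_def by (auto simp: complex_eq_iff)
    then show ?thesis by (metis span_add span_base span_mul insertI1 insertI2)
  qed
  then show ?thesis by blast
qed

end

context grid_walk
begin

lemma generic_curve: "generic_closed_curve curve"
  unfolding generic_closed_curve_def
proof (intro conjI ballI impI)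
  show "immersed_closed_curve curve" by (rule immersed_curve)
  have "self_intersections curve \<subseteq> (\<lambda>i. P (int i)) ` {..<m}" unfolding self_intersections_curve by auto
  then show "finite (self_intersections curve)" by (rule finite_subset) simp
next
  fix p assume "p \<in> self_intersections curve"
  then obtain i j where ij: "i < m" "j < m" "i \<noteq> j" "p = P (int i)" "P (int i) = P (int j)"
    unfolding self_intersections_curve by blast
  have "card {a, b} = 2" if "a \<noteq> b" for a b :: real using that by simp
  moreover have "of_int (int i) / real m \<noteq> of_int (int j) / real m" using ij(3) m_pos by simp
  ultimately have "card {of_int (int i) / real m, of_int (int j) / real m} = 2" by blast
  then have "card {t\<in>{0..<1}. curve t = P (int i)} = 2" by (simp only: fibre_eq[OF ij(1,2,3,5)])
  then show "card {t\<in>{0..<1}. curve t = p} = 2" by (simp only: ij(4))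
next
  fix s t :: real assume "s \<in> {0..<1}" "t \<in> {0..<1}" "s \<noteq> t \<and> curve s = curve t"
  then have "curve s \<in> self_intersections curve"
    unfolding self_intersections_def mem_Collect_eq by (intro bexI[of _ s] bexI[of _ t]) simp_all
  then obtain i j where ij: "i < m" "j < m" "i \<noteq> j" "curve s = P (int i)" "P (int i) = P (int j)"
    unfolding self_intersections_curve by blast
  have "s \<in> {t\<in>{0..<1}. curve t = P (int i)}" "t \<in> {t\<in>{0..<1}. curve t = P (int i)}"
    using \<open>s \<in> _\<close> \<open>t \<in> _\<close> \<open>s \<noteq> t \<and> _\<close> ij(4) by simp_all
  then have st: "s \<in> {of_int (int i) / real m, of_int (int j) / real m}" "t \<in> {of_int (int i) / real m, of_int (int j) / real m}"
    unfolding fibre_eq[OF ij(1,2,3,5)] .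
  obtain r where r: "\<And>k t. \<bar>real m * t - of_int k\<bar> < 3 / 4 \<Longrightarrow>
      (curve has_vector_derivative real m *\<^sub>R (r (- (real m * t - of_int k)) *\<^sub>R d (k - 1) + r (real m * t - of_int k) *\<^sub>R d k)) (at t)"
      "\<And>u :: real. r u + r (- u) = (1 :: real)" by (rule curve_velocity) blast
  have v: "vector_derivative curve (at (of_int k / real m)) = real m *\<^sub>R d k" if "crossing k" for k
  proof -
    have "(curve has_vector_derivative real m *\<^sub>R (r 0 *\<^sub>R d k + r 0 *\<^sub>R d k)) (at (of_int k / real m))"
      using r(1)[of "of_int k / real m" k] crossing_straight[OF that] m_pos by simp
    moreover have "r 0 *\<^sub>R d k + r 0 *\<^sub>R d k = d k" using r(2)[of 0] by (metis minus_zero scaleR_left_distrib scaleR_one)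
    ultimately show ?thesis by (simp add: vector_derivative_at)
  qed
  have "crossing i \<and> crossing j" using crossingI[of i j] ij by (simp add: not_dvd_small)
  then have vij: "vector_derivative curve (at (of_int (int i) / real m)) = real m *\<^sub>R d i"
    "vector_derivative curve (at (of_int (int j) / real m)) = real m *\<^sub>R d j" using v by blast+
  have "Re (d i) * Re (d j) + Im (d i) * Im (d j) = 0"
    using crossing_perpendicular[OF ij(5)] ij(1-3) by (simp add: not_dvd_small)
  then have sp: "span {real m *\<^sub>R d i, real m *\<^sub>R d j} = UNIV"
    using span_perpendicular[OF unit_dir_d unit_dir_d] m_pos by simp
  have "{vector_derivative curve (at s), vector_derivative curve (at t)} = {real m *\<^sub>R d i, real m *\<^sub>R d j}"
    using st \<open>s \<noteq> t \<and> _\<close> vij by (auto simp: insert_commute)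
  then show "span {vector_derivative curve (at s), vector_derivative curve (at t)} = UNIV" using sp by simp
qed

definition passages :: "nat list" where
  "passages = filter (\<lambda>i. \<exists>j<m. j \<noteq> i \<and> P (int i) = P (int j)) [0..<m]"

lemma distinct_passages: "distinct passages"
  unfolding passages_def by (intro distinct_filter distinct_upt)

lemma passage_iff: "i \<in> set passages \<longleftrightarrow> i < m \<and> P (int i) \<in> self_intersections curve"
  unfolding passages_def self_intersections_curve by auto

lemma realizable_passages:
  fixes lab :: "complex \<Rightarrow> 'a"
  assumes lab: "inj_on lab (self_intersections curve)"
  shows "realizable_word (map (\<lambda>i. lab (P (int i))) passages)"
proof -
  let ?w = "map (\<lambda>i. lab (P (int i))) passages"
  have "double_occurrence_word ?w"
    unfolding double_occurrence_word_def
  proof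
    fix a assume "a \<in> set ?w"
    then obtain i where i: "i \<in> set passages" "a = lab (P (int i))" by auto
    then obtain j where j: "i < m" "j < m" "j \<noteq> i" "P (int i) = P (int j)" unfolding passages_def by auto
    let ?p = "\<lambda>k. a = lab (P (int k))"
    have "count_list ?w a = length (filter ?p passages)"
      by (simp only: count_list_eq_length_filter filter_map o_def length_map)
    moreover have "length (filter ?p passages) = card (set (filter ?p passages))"
      using distinct_card[OF distinct_filter[OF distinct_passages]] by metis
    moreover have "set (filter ?p passages) = {i, j}"
    proof -
      have "a = lab (P (int k)) \<longleftrightarrow> P (int k) = P (int i)" if "k \<in> set passages" for k
        using inj_on_eq_iff[OF lab] that i passage_iff by metis
      then have "set (filter ?p passages) = {k \<in> set passages. P (int k) = P (int i)}" by auto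
      moreover have "j \<in> set passages" using i(1) j(2,4) passage_iff by metis
      moreover have "k = i \<or> k = j" if "k \<in> set passages" "P (int k) = P (int i)" for k
        using no_triple_point[of i j k] j that passage_iff by metis
      ultimately show ?thesis using i(1) j(4) by auto
    qed
    ultimately show "count_list ?w a = 2" using j(3) by (metis card_2_iff)
  qed
  moreover have "associated_word curve ?w"
    unfolding associated_word_def
  proof (intro exI conjI)
    \<comment> \<open>The base point is the middle of the edge that leads to the visit with index 0.\<close>
    let ?b = "- 1 / (2 * real m)"
    show "inj_on lab (self_intersections curve)" by (rule lab)
    show "curve ?b \<notin> self_intersections curve"
    proof
      assume "curve ?b \<in> self_intersections curve"
      then obtain k where "real m * ?b = of_int k" using curve_fibre by blast
      then have "- 1 = 2 * real_of_int k" using m_pos by (simp add: field_simps)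
      then have "- 1 = 2 * k" by linarith
      then show False by presburger
    qed
    have "{t \<in> {?b<..<?b + 1}. curve t \<in> self_intersections curve} = set (map (\<lambda>i. of_int (int i) / real m) passages)"
    proof (intro equalityI subsetI)
      fix t assume t: "t \<in> {t \<in> {?b<..<?b + 1}. curve t \<in> self_intersections curve}"
      then obtain k where k: "real m * t = of_int k" using curve_fibre by blast
      then have t': "t = of_int k / real m" using m_pos by (simp add: field_simps)
      have "- 1 / 2 < real_of_int k" "real_of_int k < real m - 1 / 2"
        using t m_pos unfolding t' by (auto simp: field_simps)
      then have "0 \<le> k" "k < int m" by linarith+
      then obtain i where i: "k = int i" "i < m" using nonneg_int_cases[of k] by auto
      then have "i \<in> set passages" using t curve_at[of k] t' by (simp add: passage_iff)
      then show "t \<in> set (map (\<lambda>i. of_int (int i) / real m) passages)" using t' i by auto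
    next
      fix t assume "t \<in> set (map (\<lambda>i. of_int (int i) / real m) passages)"
      then obtain i where i: "t = of_int (int i) / real m" "i \<in> set passages" by auto
      then have "i < m" "curve t \<in> self_intersections curve" using passage_iff[of i] curve_at[of "int i"] by auto
      then show "t \<in> {t \<in> {?b<..<?b + 1}. curve t \<in> self_intersections curve}"
      proof -
        have "?b < t" using m_pos unfolding i(1) by (simp add: field_simps)
        moreover have "real i + 1 \<le> real m" using \<open>i < m\<close> by linarith
        then have "t < ?b + 1" using m_pos unfolding i(1) by (simp add: field_simps)
        ultimately show ?thesis using \<open>curve t \<in> _\<close> by simp
      qed
    qed
    moreover have "sorted_wrt (<) (map (\<lambda>i. of_int (int i) / real m) passages)"
      unfolding passages_def using m_pos
      by (auto simp: sorted_wrt_map divide_strict_right_mono intro!: sorted_wrt_mono_rel[OF _ sorted_wrt_filter[OF sorted_wrt_upt]])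
    ultimately have "sorted_list_of_set {t \<in> {?b<..<?b + 1}. curve t \<in> self_intersections curve} = map (\<lambda>i. of_int (int i) / real m) passages"
      using sorted_list_of_set.idem_if_sorted_distinct strict_sorted_iff by metis
    then show "?w = map (\<lambda>t. lab (curve t)) (sorted_list_of_set {t \<in> {?b<..<?b + 1}. curve t \<in> self_intersections curve})"
      by (simp only: map_map o_def curve_at)
  qed
  ultimately show ?thesis unfolding realizable_word_def using generic_curve by blast
qed

end

section \<open>Diagrams as lists of partners, walks as lists of steps\<close>

definition chord_diagram :: "nat list \<Rightarrow> nat set set" where
  "chord_diagram t = {{i, t ! i} | i. i < length t}"

definition matching :: "nat list \<Rightarrow> bool" where
  "matching t \<longleftrightarrow> (\<forall>i<length t. t ! i < length t \<and> t ! i \<noteq> i \<and> t ! (t ! i) = i)"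

lemma matchingD:
  assumes "matching t" "i < length t"
  shows "t ! i < length t" "t ! i \<noteq> i" "t ! (t ! i) = i"
  using assms by (auto simp: matching_def)

lemma dia_partition:
  assumes "matching t" shows "partition_on {0..<length t} (chord_diagram t)"
proof (rule partition_onI)
  have "i \<in> \<Union> (chord_diagram t) \<longleftrightarrow> i < length t" for i
  proof
    assume "i < length t"
    then have "{i, t ! i} \<in> chord_diagram t" by (auto simp: chord_diagram_def)
    then show "i \<in> \<Union> (chord_diagram t)" by blast
  qed (use matchingD[OF assms] in \<open>auto simp: chord_diagram_def\<close>)
  then show "\<Union> (chord_diagram t) = {0..<length t}" by (intro set_eqI) (simp only: atLeastLessThan_iff le0 simp_thms)
  show "{} \<notin> chord_diagram t" by (auto simp: chord_diagram_def)
  show "disjnt p q" if "p \<in> chord_diagram t" "q \<in> chord_diagram t" "p \<noteq> q" for p q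
    using that matchingD(3)[OF assms] unfolding chord_diagram_def disjnt_def by (clarsimp simp: doubleton_eq_iff) metis
qed

lemma card_dia:
  assumes "matching t" "c \<in> chord_diagram t" shows "card c = 2"
  using assms(2) matchingD(2)[OF assms(1)] by (fastforce simp: chord_diagram_def)

lemma gauss_diagram_dia:
  assumes "matching t" "length t = 2 * n" "n > 0" shows "gauss_diagram n (chord_diagram t)"
proof -
  have fin: "finite (chord_diagram t)" using dia_partition[OF assms(1)] by (rule finite_elements[rotated]) simp
  have "(\<Sum>c\<in>chord_diagram t. card c) = card (\<Union> (chord_diagram t))"
    using dia_partition[OF assms(1)] fin card_dia[OF assms(1)]
    by (intro card_Union_disjoint[symmetric]) (auto simp: partition_on_def card_ge_0_finite)
  also have "\<dots> = 2 * n" using dia_partition[OF assms(1)] assms(2) by (simp add: partition_on_def)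
  finally have "card (chord_diagram t) = n" using card_dia[OF assms(1)] by simp
  then show ?thesis unfolding gauss_diagram_def using dia_partition[OF assms(1)] assms card_dia[OF assms(1)] by simp
qed

lemma gauss_diagram_is_dia:
  assumes "gauss_diagram n g"
  obtains t where "matching t" "length t = 2 * n" "g = chord_diagram t"
proof -
  have part: "partition_on {0..<2 * n} g" and two: "\<And>c. c \<in> g \<Longrightarrow> card c = 2"
    using assms by (auto simp: gauss_diagram_def)
  have "\<exists>j. j \<noteq> i \<and> {i, j} \<in> g" if "i < 2 * n" for i
  proof -
    have "i \<in> \<Union> g" using part that by (simp add: partition_on_def)
    then obtain c where c: "c \<in> g" "i \<in> c" by blast
    then obtain x y where "c = {x, y}" "x \<noteq> y" using two by (metis card_2_iff)
    then show ?thesis using c by (metis insertE insert_commute singletonD)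
  qed
  then obtain f where f: "\<And>i. i < 2 * n \<Longrightarrow> f i \<noteq> i \<and> {i, f i} \<in> g" by metis
  have uniq: "c = c'" if "c \<in> g" "c' \<in> g" "x \<in> c" "x \<in> c'" for c c' x
    using part that unfolding partition_on_def disjoint_def by blast
  have lt: "f i < 2 * n" if "i < 2 * n" for i
    using f[OF that] part unfolding partition_on_def by auto
  have inv: "f (f i) = i" if "i < 2 * n" for i
  proof -
    have "{i, f i} = {f i, f (f i)}"
      by (rule uniq[of _ _ "f i"]) (use f[OF that] f[OF lt[OF that]] in auto)
    then show ?thesis using f[OF lt[OF that]] by (auto simp: doubleton_eq_iff)
  qed
  define t where "t = map f [0..<2 * n]"
  have t: "length t = 2 * n" "\<And>i. i < 2 * n \<Longrightarrow> t ! i = f i" by (simp_all add: t_def)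
  have "matching t" unfolding matching_def using t f lt inv by simp
  moreover have "g = chord_diagram t"
  proof (intro equalityI subsetI)
    fix c assume "c \<in> g"
    then have "c \<noteq> {}" "c \<subseteq> {0..<2 * n}" using part by (auto simp: partition_on_def)
    then obtain i where i: "i \<in> c" "i < 2 * n" by fastforce
    then have "c = {i, f i}" using uniq[OF \<open>c \<in> g\<close>, of "{i, f i}" i] f by auto
    then show "c \<in> chord_diagram t" unfolding chord_diagram_def using t i by auto
  next
    fix c assume "c \<in> chord_diagram t"
    then show "c \<in> g" unfolding chord_diagram_def using t f by auto
  qed
  ultimately show thesis using that t(1) by blast
qed

lemma diagram_iso_refl: "gauss_diagram n g \<Longrightarrow> diagram_iso n g g"
proof -
  assume g: "gauss_diagram n g"
  have "act n 1 0 ` c = c" if "c \<in> g" for c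
  proof -
    have "x < 2 * n" if "x \<in> c" for x
      using g \<open>c \<in> g\<close> that by (auto simp: gauss_diagram_def partition_on_def)
    then have "int x < 2 * int n" if "x \<in> c" for x using that by fastforce
    then have "act n 1 0 x = x" if "x \<in> c" for x using that by (simp add: act_def)
    then show ?thesis by force
  qed
  then have "(`) (act n 1 0) ` g = g" by force
  then show ?thesis unfolding diagram_iso_act using g by (metis insertI1)
qed

datatype dir = E | N | W | S

fun dx :: "dir \<Rightarrow> int" where "dx E = 1" | "dx N = 0" | "dx W = - 1" | "dx S = 0"
fun dy :: "dir \<Rightarrow> int" where "dy E = 0" | "dy N = 1" | "dy W = 0" | "dy S = - 1"

datatype tag = Hor | Ver | Plain

text \<open>How a marked visit passes through its lattice point; only the first two kinds may share a point with another visit.\<close>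

fun cross_tag :: "dir \<Rightarrow> dir \<Rightarrow> tag" where
  "cross_tag E E = Hor" | "cross_tag W W = Hor" | "cross_tag N N = Ver" | "cross_tag S S = Ver"
| "cross_tag _ _ = Plain"

fun turnable :: "dir \<Rightarrow> dir \<Rightarrow> bool" where
  "turnable E W = False" | "turnable W E = False" | "turnable N S = False" | "turnable S N = False"
| "turnable _ _ = True"

text \<open>A walk is given as one list of directions for each arc between consecutive passages of the diagram; the flag marks
the start of an arc, which is where the crossings have to be.\<close>

fun steps :: "dir list list \<Rightarrow> (bool \<times> dir) list" where
  "steps [] = []"
| "steps ([] # es) = steps es"
| "steps ((c # cs) # es) = (True, c) # map (Pair False) cs @ steps es"

fun track :: "dir \<Rightarrow> int \<Rightarrow> int \<Rightarrow> (bool \<times> dir) list \<Rightarrow> (tag \<times> int \<times> int) list" where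
  "track p x y [] = []"
| "track p x y ((b, c) # s) = (if b then cross_tag p c else Plain, x, y) # track c (x + dx c) (y + dy c) s"

fun no_turn_back :: "dir \<Rightarrow> (bool \<times> dir) list \<Rightarrow> bool" where
  "no_turn_back p [] = True"
| "no_turn_back p ((b, c) # s) = (turnable p c \<and> no_turn_back c s)"

fun endpoint :: "int \<Rightarrow> int \<Rightarrow> (bool \<times> dir) list \<Rightarrow> int \<times> int" where
  "endpoint x y [] = (x, y)"
| "endpoint x y ((b, c) # s) = endpoint (x + dx c) (y + dy c) s"

fun compatible :: "tag \<times> int \<times> int \<Rightarrow> tag \<times> int \<times> int \<Rightarrow> bool" where
  "compatible (a, x, y) (b, x', y') = (x = x' \<longrightarrow> y = y' \<longrightarrow> (a = Hor \<and> b = Ver \<or> a = Ver \<and> b = Hor))"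

text \<open>The start $(20, 20)$ keeps the coordinates positive, where arithmetic with numerals is simplest. The list \<open>ps\<close> holds
the places of the passages in order.\<close>

definition draws :: "dir list list \<Rightarrow> nat list \<Rightarrow> bool" where
  "draws w t \<longleftrightarrow> (let s = steps w; p = snd (last s); its = track p 20 20 s;
       ps = map snd (filter (\<lambda>i. fst i \<noteq> Plain) its) in
     s \<noteq> [] \<and> no_turn_back p s \<and> endpoint 20 20 s = (20, 20) \<and> sorted_wrt compatible its \<and>
     length ps = length t \<and> (\<forall>i<length t. ps ! i = ps ! (t ! i)))"

lemma length_track: "length (track p x y s) = length s"
  by (induction p x y s rule: track.induct) auto

lemma track_nth:
  "k < length s \<Longrightarrow> track p x y s ! k =
     (if fst (s ! k) then cross_tag (if k = 0 then p else snd (s ! (k - 1))) (snd (s ! k)) else Plain,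
      x + sum_list (map (dx \<circ> snd) (take k s)), y + sum_list (map (dy \<circ> snd) (take k s)))"
proof (induction p x y s arbitrary: k rule: track.induct)
  case (2 p x y b c s)
  then show ?case by (cases k) (auto simp: nth_Cons' split: if_splits)
qed simp

lemma no_turn_back_nth: "no_turn_back p s \<Longrightarrow> k < length s \<Longrightarrow> turnable (if k = 0 then p else snd (s ! (k - 1))) (snd (s ! k))"
proof (induction p s arbitrary: k rule: no_turn_back.induct)
  case (2 p b c s)
  show ?case
  proof (cases k)
    case (Suc j)
    then have "turnable (if j = 0 then c else snd (s ! (j - 1))) (snd (s ! j))" using 2 by simp
    then show ?thesis using Suc by (cases j) auto
  qed (use 2 in simp)
qed simp

lemma endpoint_eq: "endpoint x y s = (x + sum_list (map (dx \<circ> snd) s), y + sum_list (map (dy \<circ> snd) s))"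
  by (induction x y s rule: endpoint.induct) auto

lemma filter_eq_map_nth: "filter P xs = map (nth xs) (filter (\<lambda>i. P (xs ! i)) [0..<length xs])"
  by (metis (no_types, lifting) filter_cong filter_map map_nth comp_def)

lemma draws_realizable:
  assumes d: "draws w t" and t: "matching t" "length t = 2 * n" "n > 0"
  shows "realizable_diagram n (chord_diagram t)"
proof -
  define s where "s = steps w"
  define p where "p = snd (last s)"
  define its where "its = track p 20 20 s"
  define ps where "ps = map snd (filter (\<lambda>i. fst i \<noteq> Plain) its)"
  define m where "m = length s"
  have s: "m > 0" "no_turn_back p s" "endpoint 20 20 s = (20, 20)" "sorted_wrt compatible its"
    "length ps = length t" "\<And>i. i < length t \<Longrightarrow> ps ! i = ps ! (t ! i)"
    using d unfolding draws_def Let_def s_def[symmetric] p_def[symmetric] its_def[symmetric] ps_def[symmetric] m_def by auto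
  define c where "c k = snd (s ! nat (k mod int m))" for k
  define X where "X k = 20 + sum_list (map (dx \<circ> snd) (take (nat (k mod int m)) s))" for k
  define Y where "Y k = 20 + sum_list (map (dy \<circ> snd) (take (nat (k mod int m)) s))" for k
  have nm: "nat (k mod int m) < m" for k using s(1) by (simp add: nat_less_iff)
  have next_case: "nat ((k + 1) mod int m) = Suc (nat (k mod int m)) \<or> nat (k mod int m) = m - 1 \<and> nat ((k + 1) mod int m) = 0" for k
  proof (cases "k mod int m = int m - 1")
    case True
    then have "(k + 1) mod int m = 0" using s(1) by (metis mod_add_left_eq diff_add_cancel mod_self)
    then show ?thesis using True by (simp add: nat_diff_distrib)
  next
    case False
    then have "k mod int m + 1 < int m" using pos_mod_bound[of "int m" k] s(1) by linarith
    then have "(k + 1) mod int m = k mod int m + 1"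
      using s(1) by (metis mod_add_left_eq mod_pos_pos_trivial pos_mod_sign add_nonneg_nonneg of_nat_0_less_iff zero_le_one)
    then show ?thesis using s(1) by (simp add: nat_add_distrib)
  qed
  have total: "sum_list (map (dx \<circ> snd) s) = 0" "sum_list (map (dy \<circ> snd) s) = 0"
    using s(3) by (simp_all add: endpoint_eq)
  have step: "X (k + 1) - X k = dx (c k)" "Y (k + 1) - Y k = dy (c k)" for k
  proof -
    let ?i = "nat (k mod int m)"
    have tk: "take (Suc ?i) s = take ?i s @ [s ! ?i]" using nm[of k] by (simp add: m_def take_Suc_conv_app_nth)
    have "X (k + 1) = 20 + sum_list (map (dx \<circ> snd) (take (Suc ?i) s)) \<and> Y (k + 1) = 20 + sum_list (map (dy \<circ> snd) (take (Suc ?i) s))"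
      using next_case[of k] total s(1) by (auto simp: X_def Y_def m_def)
    then show "X (k + 1) - X k = dx (c k)" "Y (k + 1) - Y k = dy (c k)"
      unfolding tk by (simp_all add: X_def Y_def c_def)
  qed
  have prev: "(if nat (k mod int m) = 0 then p else snd (s ! (nat (k mod int m) - 1))) = c (k - 1)" for k
    using next_case[of "k - 1"] s(1) by (auto simp: c_def p_def last_conv_nth m_def)
  have its_nth: "its ! nat (k mod int m) = (if fst (s ! nat (k mod int m)) then cross_tag (c (k - 1)) (c k) else Plain, X k, Y k)" for k
    using track_nth[of "nat (k mod int m)" s p 20 20] nm[of k] unfolding prev
    by (simp add: its_def m_def X_def Y_def c_def)
  have len: "length its = m" by (simp add: its_def length_track m_def)
  have turn: "turnable (c (k - 1)) (c k)" for k
    using no_turn_back_nth[OF s(2), of "nat (k mod int m)"] nm[of k] unfolding prev by (simp add: m_def c_def)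
  have cross: "(fst (its ! nat (k mod int m)) = Hor \<and> fst (its ! nat (l mod int m)) = Ver) \<or>
      (fst (its ! nat (k mod int m)) = Ver \<and> fst (its ! nat (l mod int m)) = Hor)"
    if "X k = X l" "Y k = Y l" "\<not> int m dvd k - l" for k l
  proof -
    let ?i = "nat (k mod int m)" and ?j = "nat (l mod int m)"
    have "?i \<noteq> ?j"
    proof
      assume "?i = ?j"
      then have "k mod int m = l mod int m" using s(1) by (simp add: nat_eq_iff)
      then show False using that(3) by (simp add: mod_eq_dvd_iff)
    qed
    moreover have "compatible (its ! i) (its ! j)" if "i < j" "j < m" for i j
      using s(4) that len by (simp add: sorted_wrt_iff_nth_less)
    ultimately show ?thesis
      using its_nth[of k] its_nth[of l] that(1,2) nm[of k] nm[of l]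
      by (cases ?i ?j rule: linorder_cases) (metis compatible.simps fst_conv)+
  qed
  have tag: "cross_tag a b = Hor \<Longrightarrow> b = a \<and> a \<in> {E, W}" "cross_tag a b = Ver \<Longrightarrow> b = a \<and> a \<in> {N, S}" for a b
    by (cases a; cases b; simp)+
  have fst_its: "fst (its ! nat (k mod int m)) = Hor \<Longrightarrow> c k = c (k - 1) \<and> c k \<in> {E, W}"
    "fst (its ! nat (k mod int m)) = Ver \<Longrightarrow> c k = c (k - 1) \<and> c k \<in> {N, S}" for k
    using its_nth[of k] tag[of "c (k - 1)" "c k"] by (auto split: if_splits)
  interpret grid_walk m X Y
  proof
    fix k l
    show "X (k + int m) = X k" "Y (k + int m) = Y k" by (simp_all add: X_def Y_def)
    show "\<bar>X (k + 1) - X k\<bar> + \<bar>Y (k + 1) - Y k\<bar> = 1" unfolding step by (cases "c k") auto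
    have "X (k + 2) - X k = dx (c (k + 1)) + dx (c k)" "Y (k + 2) - Y k = dy (c (k + 1)) + dy (c k)"
      using step[of "k + 1"] step[of k] by (simp_all add: algebra_simps)
    then show "X (k + 2) \<noteq> X k \<or> Y (k + 2) \<noteq> Y k"
      using turn[of "k + 1"] by (cases "c k"; cases "c (k + 1)") auto
    assume kl: "X k = X l" "Y k = Y l" "\<not> int m dvd k - l"
    show "X (k + 1) - X k = X k - X (k - 1) \<and> Y (k + 1) - Y k = Y k - Y (k - 1)"
      using cross[OF kl] fst_its[of k] step[of "k - 1"] step[of k] by auto
    show "(X (k + 1) - X k) * (X (l + 1) - X l) + (Y (k + 1) - Y k) * (Y (l + 1) - Y l) = 0"
      unfolding step using cross[OF kl] fst_its[of k] fst_its[of l] by auto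
  qed (rule s(1))
  have nat_mod: "nat (int i mod int m) = i" if "i < m" for i using that by simp
  define fk where "fk = filter (\<lambda>i. fst (its ! i) \<noteq> Plain) [0..<m]"
  have ps_fk: "ps = map (\<lambda>i. snd (its ! i)) fk"
    unfolding ps_def fk_def by (subst filter_eq_map_nth) (simp add: len)
  have snd_its: "snd (its ! i) = (X (int i), Y (int i))" if "i < m" for i
    using its_nth[of "int i"] that by simp
  have P_fk: "P (int (fk ! a)) = P (int (fk ! b)) \<longleftrightarrow> ps ! a = ps ! b" if "a < length fk" "b < length fk" for a b
  proof -
    have "fk ! a \<in> set fk" "fk ! b \<in> set fk" using that by auto
    then have "fk ! a < m" "fk ! b < m" by (auto simp: fk_def)
    then show ?thesis using that by (simp add: ps_fk snd_its P_eq_iff)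
  qed
  have lfk: "length fk = length t" using s(5) ps_fk by simp
  have dfk: "distinct fk" by (simp add: fk_def)
  have "passages = fk"
    unfolding passages_def fk_def
  proof (rule filter_cong[OF refl])
    fix i assume "i \<in> set [0..<m]"
    then have i: "i < m" by simp
    show "(\<exists>j<m. j \<noteq> i \<and> P (int i) = P (int j)) \<longleftrightarrow> fst (its ! i) \<noteq> Plain"
    proof
      assume "\<exists>j<m. j \<noteq> i \<and> P (int i) = P (int j)"
      then obtain j where "j < m" "j \<noteq> i" "X (int i) = X (int j)" "Y (int i) = Y (int j)" by (auto simp: P_eq_iff)
      then show "fst (its ! i) \<noteq> Plain" using cross[of "int i" "int j"] i not_dvd_small[of i j] by auto
    next
      assume "fst (its ! i) \<noteq> Plain"
      then have "i \<in> set fk" using i by (simp add: fk_def)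
      then obtain a where a: "a < length fk" "fk ! a = i" by (metis in_set_conv_nth)
      let ?b = "t ! a"
      have b: "?b < length fk" "?b \<noteq> a" using matchingD[OF t(1)] a lfk by auto
      have "P (int i) = P (int (fk ! ?b))" using P_fk[OF a(1) b(1)] s(6) a lfk by auto
      moreover have "fk ! ?b \<noteq> i" using dfk a b by (metis nth_eq_iff_index_eq)
      moreover have "fk ! ?b < m" using nth_mem[OF b(1)] by (simp add: fk_def)
      ultimately show "\<exists>j<m. j \<noteq> i \<and> P (int i) = P (int j)" by blast
    qed
  qed
  \<comment> \<open>Any injective naming of the double points by natural numbers will do.\<close>
  define lab where "lab z = (LEAST i. P (int i) = z)" for z
  have lab: "P (int (lab (P (int i)))) = P (int i)" for i unfolding lab_def by (rule LeastI) (rule refl)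
  have lab_inj: "inj_on lab (self_intersections curve)"
    by (rule inj_on_inverseI[of _ "\<lambda>i. P (int i)"]) (use lab in \<open>auto simp: self_intersections_curve\<close>)
  define v where "v = map (\<lambda>i. lab (P (int i))) passages"
  have "realizable_word v" unfolding v_def by (rule realizable_passages[OF lab_inj])
  moreover have "word_diagram v = chord_diagram t"
  proof -
    have lv: "length v = length t" using \<open>passages = fk\<close> lfk by (simp add: v_def)
    have v_eq: "v ! a = v ! b \<longleftrightarrow> P (int (fk ! a)) = P (int (fk ! b))" if "a < length t" "b < length t" for a b
      using that lab lfk unfolding v_def \<open>passages = fk\<close> by (metis length_map nth_map)
    have same: "v ! a = v ! b \<longleftrightarrow> b = t ! a" if "a < length t" "b < length t" "a \<noteq> b" for a b
    proof
      assume "b = t ! a"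
      then show "v ! a = v ! b" using v_eq P_fk s(6) that lfk by auto
    next
      assume "v ! a = v ! b"
      then have ab: "P (int (fk ! b)) = P (int (fk ! a))" using v_eq that by simp
      let ?c = "t ! a"
      have c: "?c < length t" "?c \<noteq> a" using matchingD[OF t(1)] that by auto
      have ac: "P (int (fk ! a)) = P (int (fk ! ?c))" using P_fk s(6) that(1) c(1) lfk by auto
      have "fk ! k < m" if "k < length t" for k using nth_mem[of k fk] that lfk by (auto simp: fk_def)
      moreover have "fk ! a \<noteq> fk ! ?c" using dfk c that lfk by (metis nth_eq_iff_index_eq)
      ultimately have "fk ! b = fk ! a \<or> fk ! b = fk ! ?c"
        using no_triple_point[of "fk ! a" "fk ! ?c" "fk ! b"] ab ac that c by auto
      then show "b = ?c" using dfk that c lfk by (metis nth_eq_iff_index_eq)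
    qed
    show ?thesis
    proof (intro equalityI subsetI)
      fix x assume "x \<in> word_diagram v"
      then obtain i j where "x = {i, j}" "i < j" "j < length t" "v ! i = v ! j"
        unfolding word_diagram_def lv by blast
      then show "x \<in> chord_diagram t" using same[of i j] by (auto simp: chord_diagram_def)
    next
      fix x assume "x \<in> chord_diagram t"
      then obtain i where i: "x = {i, t ! i}" "i < length t" unfolding chord_diagram_def by blast
      then show "x \<in> word_diagram v"
        using same[of i "t ! i"] matchingD[OF t(1) i(2)] lv doubleton_in_word_diagram[of i "t ! i" v] by auto
    qed
  qed
  ultimately show ?thesis
    unfolding realizable_diagram_def using diagram_iso_refl[OF gauss_diagram_dia[OF t]] by auto
qed

section \<open>The graph conditions in terms of end points\<close>

definition graph_iso :: "('a \<Rightarrow> 'b) \<Rightarrow> 'a graph \<Rightarrow> 'b graph \<Rightarrow> bool" where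
  "graph_iso f G H \<longleftrightarrow> bij_betw f (verts G) (verts H) \<and>
     (\<forall>u\<in>verts G. \<forall>v\<in>verts G. adj H (f u) (f v) \<longleftrightarrow> adj G u v)"

lemma graph_isoD:
  assumes "graph_iso f G H"
  shows "verts H = f ` verts G" "inj_on f (verts G)"
    "\<And>u v. u \<in> verts G \<Longrightarrow> v \<in> verts G \<Longrightarrow> adj H (f u) (f v) \<longleftrightarrow> adj G u v"
  using assms by (auto simp: graph_iso_def bij_betw_def)

lemma card_iso:
  assumes "graph_iso f G H" "\<And>w. w \<in> verts G \<Longrightarrow> Q (f w) \<longleftrightarrow> R w"
  shows "card {w \<in> verts H. Q w} = card {w \<in> verts G. R w}"
proof -
  have "{w \<in> verts H. Q w} = f ` {w \<in> verts G. R w}"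
    using assms(2) by (auto simp: graph_isoD(1)[OF assms(1)])
  moreover have "inj_on f {w \<in> verts G. R w}" using graph_isoD(2)[OF assms(1)] by (rule inj_on_subset) auto
  ultimately show ?thesis by (simp add: card_image)
qed

lemma cond_C1_iso:
  assumes "graph_iso f G H" "cond_C1 G" shows "cond_C1 H"
  unfolding cond_C1_def
proof
  fix v assume "v \<in> verts H"
  then obtain v' where v: "v' \<in> verts G" "v = f v'" using graph_isoD(1)[OF assms(1)] by auto
  have "card {u \<in> verts H. adj H v u} = card {u \<in> verts G. adj G v' u}"
    by (rule card_iso[OF assms(1)]) (use v graph_isoD(3)[OF assms(1)] in auto)
  then show "even (card {u \<in> verts H. adj H v u})" using assms(2) v unfolding cond_C1_def by simp
qed

lemma cond_C2_iso:
  assumes "graph_iso f G H" "cond_C2 G" shows "cond_C2 H"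
  unfolding cond_C2_def
proof (intro ballI impI)
  fix u v assume uv: "u \<in> verts H" "v \<in> verts H" "u \<noteq> v \<and> \<not> adj H u v"
  then obtain u' v' where v: "u' \<in> verts G" "u = f u'" "v' \<in> verts G" "v = f v'" using graph_isoD(1)[OF assms(1)] by auto
  have "card {w \<in> verts H. adj H u w \<and> adj H v w} = card {w \<in> verts G. adj G u' w \<and> adj G v' w}"
    by (rule card_iso[OF assms(1)]) (use v graph_isoD(3)[OF assms(1)] in auto)
  moreover have "u' \<noteq> v' \<and> \<not> adj G u' v'" using uv(3) v graph_isoD(3)[OF assms(1)] by auto
  ultimately show "even (card {w \<in> verts H. adj H u w \<and> adj H v w})" using assms(2) v unfolding cond_C2_def by simp
qed

lemma cond_B3_iso:
  assumes "graph_iso f G H" "cond_B3 G" shows "cond_B3 H"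
  unfolding cond_B3_def
proof (intro ballI impI)
  fix a b c assume abc: "a \<in> verts H" "b \<in> verts H" "c \<in> verts H" "adj H a b \<and> adj H b c \<and> adj H a c"
  then obtain a' b' c' where v: "a' \<in> verts G" "a = f a'" "b' \<in> verts G" "b = f b'" "c' \<in> verts G" "c = f c'"
    using graph_isoD(1)[OF assms(1)] by auto
  note I = graph_isoD(3)[OF assms(1)]
  have E: "f w \<notin> {a, b, c} \<longleftrightarrow> w \<notin> {a', b', c'}" if "w \<in> verts G" for w
    using that v graph_isoD(2)[OF assms(1)] by (auto simp: inj_on_eq_iff)
  have S: "{w \<in> V - X. Q w} = {w \<in> V. w \<notin> X \<and> Q w}" for V X and Q :: "'z \<Rightarrow> bool" by auto
  have "card {w\<in>verts H - {a, b, c}. adj H w a \<and> \<not> adj H w b \<and> \<not> adj H w c} =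
    card {w\<in>verts G - {a', b', c'}. adj G w a' \<and> \<not> adj G w b' \<and> \<not> adj G w c'}" unfolding S
    by (rule card_iso[OF assms(1)]) (use v I E in auto)
  moreover have "card {w\<in>verts H - {a, b, c}. adj H w b \<and> adj H w c \<and> \<not> adj H w a} =
    card {w\<in>verts G - {a', b', c'}. adj G w b' \<and> adj G w c' \<and> \<not> adj G w a'}" unfolding S
    by (rule card_iso[OF assms(1)]) (use v I E in auto)
  moreover have "adj G a' b' \<and> adj G b' c' \<and> adj G a' c'" using abc(4) v I by auto
  ultimately show "even (card {w\<in>verts H - {a, b, c}. adj H w a \<and> \<not> adj H w b \<and> \<not> adj H w c} +
      card {w\<in>verts H - {a, b, c}. adj H w b \<and> adj H w c \<and> \<not> adj H w a})"
    using assms(2) v unfolding cond_B3_def by simp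
qed

lemma connected_graph_iso:
  assumes "graph_iso f G H" "connected_graph G" "simple_graph G" shows "connected_graph H"
proof -
  have "(f u, f v) \<in> {(x, y). adj H x y}\<^sup>*" if "(u, v) \<in> {(x, y). adj G x y}\<^sup>*" for u v
    using that
  proof (induction rule: rtrancl_induct)
    case (step y z)
    then have "adj G y z" "y \<in> verts G" "z \<in> verts G" using assms(3) unfolding simple_graph_def by auto
    then have "(f y, f z) \<in> {(x, y). adj H x y}" using graph_isoD(3)[OF assms(1)] by simp
    then show ?case using step.IH by (rule rtrancl_into_rtrancl[rotated])
  qed simp
  then show ?thesis using assms(2) unfolding connected_graph_def graph_isoD(1)[OF assms(1)] by blast
qed

lemma reduced_graph_iso:
  assumes "graph_iso f G H" "v \<in> verts G" shows "graph_iso f (reduced_graph G v) (reduced_graph H (f v))"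
  unfolding graph_iso_def
proof (intro conjI ballI)
  note D = graph_isoD[OF assms(1)]
  have "f ` (verts G - {v}) = verts H - {f v}" using D(1,2) assms(2) by (auto simp: inj_on_eq_iff)
  moreover have "inj_on f (verts G - {v})" using D(2) by (rule inj_on_subset) auto
  ultimately show "bij_betw f (verts (reduced_graph G v)) (verts (reduced_graph H (f v)))"
    by (simp add: bij_betw_def reduced_graph_def)
  fix x y assume "x \<in> verts (reduced_graph G v)" "y \<in> verts (reduced_graph G v)"
  then have xy: "x \<in> verts G" "x \<noteq> v" "y \<in> verts G" "y \<noteq> v" by (auto simp: reduced_graph_def)
  then have "f x \<in> verts H - {f v}" "f y \<in> verts H - {f v}" "f x = f y \<longleftrightarrow> x = y"
    using D(1,2) assms(2) by (auto simp: inj_on_eq_iff)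
  then show "adj (reduced_graph H (f v)) (f x) (f y) \<longleftrightarrow> adj (reduced_graph G v) x y"
    using xy D(3) assms(2) unfolding reduced_graph_def by simp
qed

definition inside :: "nat \<Rightarrow> nat \<Rightarrow> nat \<Rightarrow> bool" where
  "inside i j x \<longleftrightarrow> i < x \<and> x < j"

text \<open>In this form the condition can be read off either end of the second chord; the second
alternative in the last hypothesis allows a chord to be compared with itself.\<close>

lemma interlaced_inside:
  assumes "i < j" "x \<noteq> y" "{i, j} \<inter> {x, y} = {} \<or> {i, j} = {x, y}"
  shows "interlaced {i, j} {x, y} \<longleftrightarrow> inside i j x \<noteq> inside i j y"
proof -
  have *: "interlaced {i, j} {k, l} \<longleftrightarrow> (i < k \<and> k < j \<and> j < l \<or> k < i \<and> i < l \<and> l < j)" if "k < l" for k l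
    unfolding interlaced_def using assms(1) that by (auto simp: doubleton_eq_iff)
  show ?thesis
  proof (cases "x < y")
    case True
    then show ?thesis using assms unfolding *[OF True] inside_def by (auto simp: doubleton_eq_iff)
  next
    case False
    then have "y < x" using assms(2) by simp
    then show ?thesis using assms unfolding insert_commute[of x y] *[OF \<open>y < x\<close>] inside_def by (auto simp: doubleton_eq_iff)
  qed
qed

lemma interlaced_dia:
  assumes "matching t" "i < length t" "x < length t" "i < t ! i"
  shows "interlaced {i, t ! i} {x, t ! x} \<longleftrightarrow> inside i (t ! i) x \<noteq> inside i (t ! i) (t ! x)"
proof (rule interlaced_inside[OF assms(4)])
  show "x \<noteq> t ! x" using matchingD[OF assms(1,3)] by simp
  show "{i, t ! i} \<inter> {x, t ! x} = {} \<or> {i, t ! i} = {x, t ! x}"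
    using matchingD(3)[OF assms(1,3)] matchingD(3)[OF assms(1,2)] by auto
qed

lemma interlaced_commute: "interlaced c d \<longleftrightarrow> interlaced d c"
  unfolding interlaced_def by blast

lemma even_card_involution:
  assumes "finite A" "\<And>x. x \<in> A \<Longrightarrow> f x \<in> A \<and> f x \<noteq> x \<and> f (f x) = x" shows "even (card A)"
  using assms
proof (induction A rule: finite_psubset_induct)
  case (psubset A)
  show ?case
  proof (cases "A = {}")
    case False
    then obtain x where x: "x \<in> A" by blast
    let ?B = "A - {x, f x}"
    have "even (card ?B)"
    proof (rule psubset.IH)
      show "?B \<subset> A" using x by blast
      fix y assume y: "y \<in> ?B"
      then have "f y \<noteq> x" "f y \<noteq> f x" using psubset.prems x by (metis Diff_iff insertCI)+
      then show "f y \<in> ?B \<and> f y \<noteq> y \<and> f (f y) = y" using y psubset.prems by auto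
    qed
    moreover have "card A = card ?B + card {x, f x}"
      using psubset.prems[OF x] x psubset.hyps(1) by (subst card_Diff_subset) (auto intro: card_mono simp: card_mono)
    moreover have "card {x, f x} = 2" using psubset.prems[OF x] by (metis card_2_iff)
    ultimately show ?thesis by simp
  qed simp
qed

text \<open>If a chord with the property $R$ always has exactly one end with the property $Q$, counting chords becomes
counting points.\<close>

lemma card_chords_by_endpoint:
  assumes "\<And>x. Q x \<Longrightarrow> x < length t" "\<And>x. Q x \<Longrightarrow> R {x, t ! x}"
    and "\<And>x. x < length t \<Longrightarrow> R {x, t ! x} \<Longrightarrow> Q x \<or> Q (t ! x)" and "\<And>x. Q x \<Longrightarrow> \<not> Q (t ! x)" "matching t"
  shows "card {c \<in> chord_diagram t. R c} = card {x. Q x}"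
proof -
  have "{c \<in> chord_diagram t. R c} = (\<lambda>x. {x, t ! x}) ` {x. Q x}"
  proof (intro equalityI subsetI)
    fix c assume "c \<in> {c \<in> chord_diagram t. R c}"
    then obtain x where x: "x < length t" "c = {x, t ! x}" "R c" by (auto simp: chord_diagram_def)
    then have c': "c = {t ! x, t ! (t ! x)}" using matchingD(3)[OF assms(5) x(1)] by (metis insert_commute)
    have "Q x \<or> Q (t ! x)" using assms(3)[OF x(1)] x by blast
    then show "c \<in> (\<lambda>x. {x, t ! x}) ` {x. Q x}"
      using image_eqI[of c "\<lambda>x. {x, t ! x}" x "{x. Q x}"] image_eqI[of c "\<lambda>x. {x, t ! x}" "t ! x" "{x. Q x}"] x(2) c'
      by (metis mem_Collect_eq)
  qed (use assms(1,2) in \<open>auto simp: chord_diagram_def\<close>)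
  moreover have "inj_on (\<lambda>x. {x, t ! x}) {x. Q x}"
    by (rule inj_onI) (use assms(4) in \<open>auto simp: doubleton_eq_iff\<close>)
  ultimately show ?thesis by (simp add: card_image)
qed

text \<open>The points under a chord whose partner is also under it come in pairs; the others belong to the
crossing chords.\<close>

lemma C1_odd_length:
  assumes t: "matching t" and C1: "cond_C1 (interlacement_graph (chord_diagram t))" and i: "i < length t" "i < t ! i"
  shows "odd (t ! i - i)"
proof -
  let ?I = "\<lambda>x. inside i (t ! i) x"
  have il: "?I x \<Longrightarrow> x < length t" for x using matchingD(1)[OF t i(1)] by (simp add: inside_def)
  have "{i, t ! i} \<in> chord_diagram t" using i by (auto simp: chord_diagram_def)
  then have "even (card {c \<in> chord_diagram t. interlaced {i, t ! i} c})"
    using C1 unfolding cond_C1_def interlacement_graph_def by simp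
  also have "card {c \<in> chord_diagram t. interlaced {i, t ! i} c} = card {x. ?I x \<and> \<not> ?I (t ! x)}"
    by (rule card_chords_by_endpoint) (use t i il interlaced_dia[OF t i(1) _ i(2)] matchingD[OF t] in auto)
  finally have "even (card {x. ?I x \<and> \<not> ?I (t ! x)})" .
  moreover have "even (card {x. ?I x \<and> ?I (t ! x)})"
    by (rule even_card_involution[of _ "nth t"]) (use il matchingD[OF t] in \<open>auto intro: finite_subset[of _ "{..<length t}"]\<close>)
  moreover have "card {x. ?I x} = card {x. ?I x \<and> \<not> ?I (t ! x)} + card {x. ?I x \<and> ?I (t ! x)}"
    using il by (subst card_Un_disjoint[symmetric]) (auto intro!: arg_cong[of _ _ card] intro: finite_subset[of _ "{..<length t}"])
  moreover have "card {x. ?I x} = t ! i - Suc i"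
    by (simp add: inside_def flip: greaterThanLessThan_iff)
  ultimately show ?thesis using i(2) by (metis Suc_diff_Suc even_Suc even_add)
qed

lemma conj_absorb_membership: "{w \<in> G. A w \<and> w \<in> G \<and> B w} = {w \<in> G. A w \<and> B w}"
  by auto

lemma C2_even_common:
  assumes t: "matching t" and C2: "cond_C2 (interlacement_graph (chord_diagram t))"
    and i: "i < length t" "i < t ! i" and k: "k < length t" "k < t ! k" and ik: "i \<noteq> k"
    and non: "\<not> interlaced {i, t ! i} {k, t ! k}"
  shows "even (card {x. inside i (t ! i) x \<and> \<not> inside i (t ! i) (t ! x) \<and>
     inside k (t ! k) x \<noteq> inside k (t ! k) (t ! x)})"
proof -
  have il: "inside i (t ! i) x \<Longrightarrow> x < length t" for x using matchingD(1)[OF t i(1)] by (simp add: inside_def)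
  have "{i, t ! i} \<in> chord_diagram t" "{k, t ! k} \<in> chord_diagram t" "{i, t ! i} \<noteq> {k, t ! k}" using i k ik by (auto simp: chord_diagram_def doubleton_eq_iff)
  then have "even (card {c \<in> chord_diagram t. interlaced {i, t ! i} c \<and> interlaced {k, t ! k} c})"
    using C2 non unfolding cond_C2_def interlacement_graph_def by (simp add: conj_absorb_membership)
  also have "card {c \<in> chord_diagram t. interlaced {i, t ! i} c \<and> interlaced {k, t ! k} c} =
     card {x. inside i (t ! i) x \<and> \<not> inside i (t ! i) (t ! x) \<and> inside k (t ! k) x \<noteq> inside k (t ! k) (t ! x)}"
    by (rule card_chords_by_endpoint)
      (use t i il interlaced_dia[OF t i(1) _ i(2)] interlaced_dia[OF t k(1) _ k(2)] matchingD[OF t] in auto)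
  finally show ?thesis .
qed

lemma C2_disjoint:
  assumes t: "matching t" and C2: "cond_C2 (interlacement_graph (chord_diagram t))"
    and "i < t ! i" "t ! i < k" "k < t ! k" "k < length t"
  shows "even (card {x. inside i (t ! i) x \<and> inside k (t ! k) (t ! x)})"
proof -
  have i: "i < length t" using assms by simp
  have non: "\<not> interlaced {i, t ! i} {k, t ! k}"
    using interlaced_dia[OF t i assms(6) assms(3)] assms by (auto simp: inside_def)
  have "{x. inside i (t ! i) x \<and> \<not> inside i (t ! i) (t ! x) \<and> inside k (t ! k) x \<noteq> inside k (t ! k) (t ! x)} =
    {x. inside i (t ! i) x \<and> inside k (t ! k) (t ! x)}"
    using assms(3-5) by (auto simp: inside_def)
  then show ?thesis using C2_even_common[OF t C2 i assms(3) assms(6) assms(5) _ non] assms by simp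
qed

text \<open>By (C1) the number of points under the inner chord is even. Those whose partner leaves the outer chord correspond to the
common neighbours; the others are the points counted here.\<close>

lemma C2_nested:
  assumes t: "matching t" and C1: "cond_C1 (interlacement_graph (chord_diagram t))" and C2: "cond_C2 (interlacement_graph (chord_diagram t))"
    and "k < i" "i < t ! i" "t ! i < t ! k" "k < length t"
  shows "even (card {x. inside i (t ! i) x \<and> inside k (t ! k) (t ! x)})"
proof -
  have i: "i < length t" using assms matchingD(1)[OF t, of k] by simp
  have k: "k < t ! k" using assms by simp
  have il: "inside i (t ! i) x \<Longrightarrow> x < length t" for x using matchingD(1)[OF t i] by (simp add: inside_def)
  have non: "\<not> interlaced {i, t ! i} {k, t ! k}"
    using interlaced_dia[OF t i assms(7) assms(5)] assms by (auto simp: inside_def)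
  have "{x. inside i (t ! i) x \<and> \<not> inside i (t ! i) (t ! x) \<and> inside k (t ! k) x \<noteq> inside k (t ! k) (t ! x)} =
    {x. inside i (t ! i) x \<and> \<not> inside k (t ! k) (t ! x)}"
    using assms(4-6) by (auto simp: inside_def)
  then have "even (card {x. inside i (t ! i) x \<and> \<not> inside k (t ! k) (t ! x)})"
    using C2_even_common[OF t C2 i assms(5) assms(7) k _ non] assms by simp
  moreover have "card {x. inside i (t ! i) x} = card {x. inside i (t ! i) x \<and> \<not> inside k (t ! k) (t ! x)} +
     card {x. inside i (t ! i) x \<and> inside k (t ! k) (t ! x)}"
    using il by (subst card_Un_disjoint[symmetric]) (auto intro!: arg_cong[of _ _ card] intro: finite_subset[of _ "{..<length t}"])
  moreover have "card {x. inside i (t ! i) x} = t ! i - Suc i"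
    by (simp add: inside_def flip: greaterThanLessThan_iff)
  ultimately show ?thesis using C1_odd_length[OF t C1 i assms(5)] assms(5) by (metis Suc_diff_Suc even_Suc even_add)
qed

section \<open>Enumeration of the candidates\<close>

text \<open>The most recent point comes first, since the search extends the diagram at this end.\<close>

definition history :: "nat list \<Rightarrow> nat \<Rightarrow> (nat \<times> nat) list" where
  "history t j = rev (map (\<lambda>x. (x, t ! x)) [0..<j])"

lemma hist_simps [simp]: "history t 0 = []" "history t (Suc j) = (j, t ! j) # history t j"
  by (simp_all add: history_def)

lemma set_hist: "set (history t j) = {(x, t ! x) | x. x < j}"
  by (auto simp: history_def)

text \<open>Parity of the number of points after $a$ that have their partner strictly between $c$ and $d$.\<close>

fun evenly :: "nat \<Rightarrow> nat \<Rightarrow> nat \<Rightarrow> (nat \<times> nat) list \<Rightarrow> bool" where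
  "evenly a c d [] = True"
| "evenly a c d ((x, y) # h) = (if x = a then True else if c < y \<and> y < d then \<not> evenly a c d h else evenly a c d h)"

text \<open>The condition of \<open>C2_disjoint\<close> for the new chord from $e$ to $f$ and every chord completed before $e$. It is decided by the
past alone, since all points under the completed chord already have partners.\<close>

fun opening_ok :: "nat \<Rightarrow> nat \<Rightarrow> (nat \<times> nat) list \<Rightarrow> bool" where
  "opening_ok e f [] = True"
| "opening_ok e f ((x, y) # h) = ((y < x \<longrightarrow> evenly y e f h) \<and> opening_ok e f h)"

text \<open>The condition of \<open>C2_nested\<close> for the chord from $a$ to $i$, just completed, and every open chord around it.\<close>

fun closing_ok :: "nat \<Rightarrow> nat \<Rightarrow> (nat \<times> nat) list \<Rightarrow> (nat \<times> nat) list \<Rightarrow> bool" where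
  "closing_ok i a k [] = True"
| "closing_ok i a k ((x, y) # h) = ((x < a \<and> i < y \<longrightarrow> evenly a x y k) \<and> closing_ok i a k h)"

fun opener :: "nat \<Rightarrow> (nat \<times> nat) list \<Rightarrow> nat" where
  "opener i [] = 0"
| "opener i ((x, y) # h) = (if y = i then x else opener i h)"

fun picks :: "'a list \<Rightarrow> 'a list \<Rightarrow> ('a \<times> 'a list) list" where
  "picks C [] = []"
| "picks C (b # B) = (b, C @ B) # picks (C @ [b]) B"

text \<open>The lists $A$ and $B$ hold the points without partner, those of the parity of the next point and those of the other parity;
they change roles with every step. The next point is free exactly if it is the first entry of $A$.\<close>

fun complete :: "nat \<Rightarrow> nat \<Rightarrow> nat list \<Rightarrow> nat list \<Rightarrow> nat list \<Rightarrow> (nat \<times> nat) list \<Rightarrow> (nat \<times> nat) list list" where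
  "complete l u [] A B h = [h]"
| "complete l u (i # is) A B h =
    (if A \<noteq> [] \<and> hd A = i
     then concat (map (\<lambda>(b, R). if i + l \<le> b \<and> b \<le> i + u \<and> opening_ok i b h
                                then complete l u is R (tl A) ((i, b) # h) else []) (picks [] B))
     else if closing_ok i (opener i h) h h then complete l u is B A ((i, opener i h) # h) else [])"

lemma evenly_hist:
  "a < j \<Longrightarrow> evenly a c d (history t j) \<longleftrightarrow> even (card {x. a < x \<and> x < j \<and> c < t ! x \<and> t ! x < d})"
proof (induction j)
  case (Suc j)
  show ?case
  proof (cases "j = a")
    case True
    have "{x. a < x \<and> x < Suc a \<and> c < t ! x \<and> t ! x < d} = {}" by auto
    then have "even (card {x. a < x \<and> x < Suc a \<and> c < t ! x \<and> t ! x < d})"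
      by (simp only: card.empty even_zero)
    then show ?thesis using True by simp
  next
    case False
    then have a: "a < j" using Suc.prems by simp
    let ?A = "{x. a < x \<and> x < j \<and> c < t ! x \<and> t ! x < d}"
    have fin: "finite ?A" by (rule finite_subset[of _ "{..<j}"]) auto
    have "{x. a < x \<and> x < Suc j \<and> c < t ! x \<and> t ! x < d} = (if c < t ! j \<and> t ! j < d then insert j ?A else ?A)"
      using a by (auto simp: less_Suc_eq)
    then show ?thesis using Suc.IH[OF a] a fin False by simp
  qed
qed simp

lemma opening_ok_hist: "opening_ok e f (history t j) \<longleftrightarrow> (\<forall>x<j. t ! x < x \<longrightarrow> evenly (t ! x) e f (history t x))"
  by (induction j) (auto simp: less_Suc_eq)

lemma closing_ok_hist: "closing_ok i a k (history t j) \<longleftrightarrow> (\<forall>x<j. x < a \<and> i < t ! x \<longrightarrow> evenly a x (t ! x) k)"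
  by (induction j) (auto simp: less_Suc_eq)

lemma opener_hist:
  assumes t: "matching t" and i: "i < length t" "t ! i < i" shows "opener i (history t i) = t ! i"
proof -
  have "opener i (history t j) = t ! i" if "t ! i < j" "j \<le> i" for j
    using that
  proof (induction j)
    case (Suc j)
    show ?case
    proof (cases "j = t ! i")
      case True
      then show ?thesis using matchingD(3)[OF t i(1)] by simp
    next
      case False
      then have "t ! j \<noteq> i" using matchingD(3)[OF t, of j] Suc.prems i by auto
      then show ?thesis using Suc False by simp
    qed
  qed simp
  then show ?thesis using i(2) by simp
qed

lemma picks_member: "b \<in> set B \<Longrightarrow> distinct B \<Longrightarrow> (b, C @ filter (\<lambda>x. x \<noteq> b) B) \<in> set (picks C B)"
proof (induction B arbitrary: C)
  case (Cons a B)
  show ?case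
  proof (cases "a = b")
    case True
    then have "filter (\<lambda>x. x \<noteq> b) B = B" using Cons.prems by (auto simp: filter_id_conv)
    then show ?thesis using True by simp
  next
    case False
    then show ?thesis using Cons.IH[of "C @ [a]"] Cons.prems by simp
  qed
qed simp

definition free_points :: "nat list \<Rightarrow> nat \<Rightarrow> bool \<Rightarrow> nat list" where
  "free_points t i p = filter (\<lambda>x. even x = p \<and> i \<le> t ! x) [i..<length t]"

locale gauss_word =
  fixes t :: "nat list" and l u :: nat
  assumes t: "matching t"
    and C1: "cond_C1 (interlacement_graph (chord_diagram t))" and C2: "cond_C2 (interlacement_graph (chord_diagram t))"
    and lengths: "x < t ! x \<Longrightarrow> t ! x < length t \<Longrightarrow> x + l \<le> t ! x \<and> t ! x \<le> x + u"
begin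

lemma parity: "i < length t \<Longrightarrow> even (t ! i) \<noteq> even i"
proof -
  assume i: "i < length t"
  have "odd (t ! j - j)" if "j < length t" "j < t ! j" for j using C1_odd_length[OF t C1 that] .
  from this[of i] this[of "t ! i"] show ?thesis
    using matchingD[OF t i] i by (cases "i < t ! i") (auto simp: even_diff_nat)
qed

lemma free_points_opening:
  assumes i: "i < length t" "i < t ! i"
  shows "free_points t i (even i) = i # free_points t (Suc i) (even i)"
    and "filter (\<lambda>x. x \<noteq> t ! i) (free_points t i (odd i)) = free_points t (Suc i) (odd i)"
    and "t ! i \<in> set (free_points t i (odd i))"
proof -
  have iff: "i \<le> t ! x \<longleftrightarrow> Suc i \<le> t ! x \<or> x = t ! i" if "x < length t" for x
  proof -
    have "t ! x = i \<longleftrightarrow> x = t ! i" using matchingD(3)[OF t that] matchingD(3)[OF t i(1)] by metis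
    then show ?thesis by auto
  qed
  have up: "[i..<length t] = i # [Suc i..<length t]" using i by (simp add: upt_conv_Cons)
  show "free_points t i (even i) = i # free_points t (Suc i) (even i)"
    unfolding free_points_def up using i parity[OF i(1)] by (auto intro!: filter_cong simp: iff)
  show "filter (\<lambda>x. x \<noteq> t ! i) (free_points t i (odd i)) = free_points t (Suc i) (odd i)"
    unfolding free_points_def up using i iff matchingD(3)[OF t i(1)] by (auto intro!: filter_cong simp: filter_filter)
  show "t ! i \<in> set (free_points t i (odd i))"
    unfolding free_points_def using i parity[OF i(1)] matchingD[OF t i(1)] by auto
qed

lemma free_points_closing:
  assumes i: "i < length t" "t ! i < i"
  shows "free_points t i p = free_points t (Suc i) p"
proof -
  have iff: "i \<le> t ! x \<longleftrightarrow> Suc i \<le> t ! x" if "x < length t" "i < x" for x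
  proof -
    have "t ! x \<noteq> i" using matchingD(3)[OF t that(1)] i that by (metis less_asym)
    then show ?thesis by auto
  qed
  have up: "[i..<length t] = i # [Suc i..<length t]" using i by (simp add: upt_conv_Cons)
  show ?thesis unfolding free_points_def up using i by (auto intro!: filter_cong simp: iff)
qed

text \<open>The branch that follows the diagram $t$ survives every test.\<close>

lemma complete_step:
  assumes i: "i < length t"
  shows "set (complete l u [Suc i..<length t] (free_points t (Suc i) (even (Suc i))) (free_points t (Suc i) (odd (Suc i))) (history t (Suc i)))
    \<subseteq> set (complete l u [i..<length t] (free_points t i (even i)) (free_points t i (odd i)) (history t i))"
proof (cases "i < t ! i")
  case True
  note F = free_points_opening[OF i True]
  have ti: "t ! i < length t" "t ! (t ! i) = i" using matchingD[OF t i] by auto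
  have "opening_ok i (t ! i) (history t i)"
    unfolding opening_ok_hist
  proof (intro allI impI)
    fix x assume x: "x < i" "t ! x < x"
    have xl: "x < length t" using x i by simp
    have tx: "t ! (t ! x) = x" using matchingD[OF t xl] by simp
    have "even (card {y. inside (t ! x) (t ! (t ! x)) y \<and> inside i (t ! i) (t ! y)})"
      by (rule C2_disjoint[OF t C2]) (use x tx True i in auto)
    then show "evenly (t ! x) i (t ! i) (history t x)"
      unfolding evenly_hist[OF x(2)] by (simp add: inside_def tx conj_assoc)
  qed
  moreover have "(t ! i, free_points t (Suc i) (odd i)) \<in> set (picks [] (free_points t i (odd i)))"
    using picks_member[OF F(3), of "[]"] F(2) by (simp add: free_points_def)
  moreover have "[i..<length t] = i # [Suc i..<length t]" using i by (simp add: upt_conv_Cons)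
  moreover have "i + l \<le> t ! i \<and> t ! i \<le> i + u" using lengths[OF True ti(1)] .
  ultimately show ?thesis unfolding F(1) by (auto intro!: bexI[of _ "(t ! i, free_points t (Suc i) (odd i))"])
next
  case False
  then have less: "t ! i < i" using matchingD[OF t i] by auto
  have ti: "t ! i < length t" "t ! (t ! i) = i" using matchingD[OF t i] by auto
  note F = free_points_closing[OF i less]
  have "closing_ok i (t ! i) (history t i) (history t i)"
    unfolding closing_ok_hist
  proof (intro allI impI)
    fix x assume x: "x < i" "x < t ! i \<and> i < t ! x"
    have "even (card {y. inside (t ! i) (t ! (t ! i)) y \<and> inside x (t ! x) (t ! y)})"
      by (rule C2_nested[OF t C1 C2]) (use x ti less i in auto)
    then show "evenly (t ! i) x (t ! x) (history t i)"
      unfolding evenly_hist[OF less] by (simp add: inside_def ti conj_assoc)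
  qed
  moreover have "[i..<length t] = i # [Suc i..<length t]" using i by (simp add: upt_conv_Cons)
  moreover have "\<not> (free_points t (Suc i) (even i) \<noteq> [] \<and> hd (free_points t (Suc i) (even i)) = i)"
  proof
    assume "free_points t (Suc i) (even i) \<noteq> [] \<and> hd (free_points t (Suc i) (even i)) = i"
    then have "i \<in> set (free_points t (Suc i) (even i))" by (metis hd_in_set)
    then show False by (simp add: free_points_def)
  qed
  ultimately show ?thesis unfolding F using opener_hist[OF t i less] by auto
qed

lemma complete_complete:
  assumes "i \<le> length t"
  shows "history t (length t) \<in> set (complete l u [i..<length t] (free_points t i (even i)) (free_points t i (odd i)) (history t i))"
  using assms
proof (induction rule: inc_induct)
  case (step i)
  then show ?case using complete_step[of i] by blast
qed simp

end

definition search :: "nat \<Rightarrow> nat \<Rightarrow> (nat \<times> nat) list list" where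
  "search n l = complete l (2 * n - l) [1..<2 * n] (filter (\<lambda>x. odd x \<and> x \<noteq> l) [1..<2 * n]) (filter even [1..<2 * n]) [(0, l)]"

lemma search_complete:
  assumes "gauss_word t l (2 * n - l)" "length t = 2 * n" "n > 0" "t ! 0 = l"
  shows "history t (2 * n) \<in> set (search n l)"
proof -
  interpret gauss_word t l "2 * n - l" by fact
  have l: "t ! l = 0" "odd l" "l < 2 * n" using matchingD[OF t, of 0] parity[of 0] assms by auto
  have "1 \<le> t ! x \<longleftrightarrow> x \<noteq> l" if "x < 2 * n" for x
    using matchingD(3)[OF t, of x] l that assms by (metis One_nat_def Suc_leI neq0_conv not_one_le_zero)
  then have "free_points t 1 False = filter (\<lambda>x. odd x \<and> x \<noteq> l) [1..<2 * n]" "free_points t 1 True = filter even [1..<2 * n]"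
    using assms(2) l(2) by (auto simp: free_points_def intro!: filter_cong)
  moreover have "history t 1 = [(0, l)]" using assms(4) by (simp add: history_def)
  ultimately show ?thesis using complete_complete[of 1] assms(2,3) by (simp add: search_def)
qed

section \<open>Verdicts on the candidates\<close>

definition partner0 :: "nat list" where
  "partner0 = [5, 8, 9, 14, 15, 0, 13, 12, 1, 2, 17, 16, 7, 6, 3, 4, 11, 10]"

definition crosses :: "nat \<times> nat \<Rightarrow> nat \<times> nat \<Rightarrow> bool" where
  "crosses p q = ((fst p < fst q \<and> fst q < snd p) \<noteq> (fst p < snd q \<and> snd q < snd p))"

text \<open>The two sets of chords counted in (B3) are disjoint, so the parity of their union suffices. Among $p$, $q$, $r$ only $p$ itself
could be counted by mistake.\<close>

fun triple_even :: "nat \<times> nat \<Rightarrow> nat \<times> nat \<Rightarrow> nat \<times> nat \<Rightarrow> (nat \<times> nat) list \<Rightarrow> bool" where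
  "triple_even p q r [] = True"
| "triple_even p q r (w # h) = ((fst w < snd w \<and>
      (crosses p w \<and> \<not> crosses q w \<and> \<not> crosses r w \<or> w \<noteq> p \<and> crosses q w \<and> crosses r w \<and> \<not> crosses p w))
      \<noteq> triple_even p q r h)"

definition turned :: "nat \<Rightarrow> nat list" where
  "turned s = drop s [0, 1, 2, 3, 4, 5, 6, 7, 8, 9, 10, 11, 12, 13, 14, 15, 16, 17] @
     take s [0, 1, 2, 3, 4, 5, 6, 7, 8, 9, 10, 11, 12, 13, 14, 15, 16, 17]"

text \<open>Reasons why a candidate does not contradict the theorem.\<close>

datatype verdict = Drawn "dir list list" | Split nat nat | Odd_triple "nat \<times> nat" "nat \<times> nat" "nat \<times> nat" | Turned nat

fun justified :: "(nat \<times> nat) list \<Rightarrow> verdict \<Rightarrow> bool" where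
  "justified h (Drawn w) = draws w (map snd (rev h))"
| "justified h (Split a b) = ((\<forall>(x, y) \<in> set h. (a \<le> x \<and> x \<le> b) = (a \<le> y \<and> y \<le> b)) \<and>
     (\<exists>(x, y) \<in> set h. a \<le> x \<and> x \<le> b) \<and> (\<exists>(x, y) \<in> set h. \<not> (a \<le> x \<and> x \<le> b)))"
| "justified h (Odd_triple p q r) = (p \<in> set h \<and> q \<in> set h \<and> r \<in> set h \<and>
     fst p < snd p \<and> fst q < snd q \<and> fst r < snd r \<and>
     crosses p q \<and> crosses q r \<and> crosses p r \<and> \<not> triple_even p q r h)"
| "justified h (Turned s) = (s < 18 \<and> length h = 18 \<and>
     (\<forall>(x, y) \<in> set h. partner0 ! (turned s ! x) = turned s ! y))"

lemma map_snd_hist: "map snd (rev (history t (length t))) = t"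
  by (simp add: history_def map_nth o_def)

lemma rtrancl_invariant:
  assumes "(x, y) \<in> r\<^sup>*" "P x" "\<And>x y. (x, y) \<in> r \<Longrightarrow> P x \<Longrightarrow> P y" shows "P y"
  using assms(1,2) by (induction rule: rtrancl_induct) (use assms(3) in auto)

text \<open>A chord inside the interval crosses no chord outside of it, so the component of a chord never leaves the interval.\<close>

lemma split_not_prime:
  assumes t: "matching t" and j: "justified (history t (length t)) (Split a b)"
  shows "\<not> prime_diagram (chord_diagram t)"
proof
  assume p: "prime_diagram (chord_diagram t)"
  let ?In = "\<lambda>x. a \<le> x \<and> x \<le> b"
  have all: "?In x \<longleftrightarrow> ?In (t ! x)" if "x < length t" for x
    using j that by (auto simp: set_hist)
  obtain i k where ik: "i < length t" "?In i" "k < length t" "\<not> ?In k" using j by (auto simp: set_hist)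
  have "({i, t ! i}, {k, t ! k}) \<in> {(x, y). adj (interlacement_graph (chord_diagram t)) x y}\<^sup>*"
    using p ik unfolding prime_diagram_def connected_graph_def interlacement_graph_def chord_diagram_def by auto
  then have "\<forall>x\<in>{k, t ! k}. ?In x"
  proof (rule rtrancl_invariant[where P = "\<lambda>c. \<forall>x\<in>c. ?In x"])
    show "\<forall>x\<in>{i, t ! i}. ?In x" using all[OF ik(1)] ik(2) by blast
    fix c d assume cd: "(c, d) \<in> {(x, y). adj (interlacement_graph (chord_diagram t)) x y}" "\<forall>x\<in>c. ?In x"
    then have "d \<in> chord_diagram t" "interlaced c d" by (auto simp: interlacement_graph_def)
    then obtain x where x: "x < length t" "d = {x, t ! x}" by (auto simp: chord_diagram_def)
    have "?In x"
    proof (rule ccontr)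
      assume n: "\<not> ?In x"
      obtain p q r s where c: "c = {p, q}" "d = {r, s}" "p < q" "r < s" and
        o: "p < r \<and> r < q \<and> q < s \<or> r < p \<and> p < s \<and> s < q"
        using \<open>interlaced c d\<close> unfolding interlaced_def by blast
      have "?In p" "?In q" using cd(2) c by auto
      moreover have "\<not> ?In r" "\<not> ?In s" using n all[OF x(1)] x(2) c(2) by (auto simp: doubleton_eq_iff)
      ultimately show False using o by auto
    qed
    then show "\<forall>x\<in>d. ?In x" using all[OF x(1)] x by blast
  qed
  then show False using ik by blast
qed

lemma triple_even_hist:
  "triple_even p q r (history t j) \<longleftrightarrow> even (card {x. x < j \<and> x < t ! x \<and>
     (crosses p (x, t ! x) \<and> \<not> crosses q (x, t ! x) \<and> \<not> crosses r (x, t ! x) \<or>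
      (x, t ! x) \<noteq> p \<and> crosses q (x, t ! x) \<and> crosses r (x, t ! x) \<and> \<not> crosses p (x, t ! x))})"
proof (induction j)
  case (Suc j)
  define Q where "Q x \<longleftrightarrow> x < t ! x \<and> (crosses p (x, t ! x) \<and> \<not> crosses q (x, t ! x) \<and> \<not> crosses r (x, t ! x) \<or>
      (x, t ! x) \<noteq> p \<and> crosses q (x, t ! x) \<and> crosses r (x, t ! x) \<and> \<not> crosses p (x, t ! x))" for x
  have "triple_even p q r (history t (Suc j)) \<longleftrightarrow> Q j \<noteq> triple_even p q r (history t j)"
    by (simp add: Q_def)
  moreover have "{x. x < Suc j \<and> Q x} = (if Q j then insert j {x. x < j \<and> Q x} else {x. x < j \<and> Q x})"
    by (auto simp: less_Suc_eq)
  ultimately show ?case using Suc.IH unfolding Q_def[symmetric] by simp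
qed simp

lemma odd_triple_not_B3:
  assumes t: "matching t" and j: "justified (history t (length t)) (Odd_triple p q r)"
  shows "\<not> cond_B3 (interlacement_graph (chord_diagram t))"
proof
  assume B3: "cond_B3 (interlacement_graph (chord_diagram t))"
  have mem: "p \<in> set (history t (length t))" "q \<in> set (history t (length t))" "r \<in> set (history t (length t))"
    and lt: "fst p < snd p" "fst q < snd q" "fst r < snd r"
    and cr: "crosses p q" "crosses q r" "crosses p r" and odd: "\<not> triple_even p q r (history t (length t))"
    using j by auto
  define a b c where "a = {fst p, snd p}" and "b = {fst q, snd q}" and "c = {fst r, snd r}"
  have I: "interlaced {fst w, snd w} {x, t ! x} \<longleftrightarrow> crosses w (x, t ! x)"
    if "w \<in> set (history t (length t))" "fst w < snd w" "x < length t" for w x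
    using interlaced_dia[OF t, of "fst w" x] that by (auto simp: set_hist crosses_def inside_def)
  have chord_diagram: "a \<in> chord_diagram t" "b \<in> chord_diagram t" "c \<in> chord_diagram t" using mem by (auto simp: a_def b_def c_def set_hist chord_diagram_def)
  have "interlaced a b" "interlaced b c" "interlaced a c"
    using I[OF mem(1) lt(1)] I[OF mem(2) lt(2)] mem cr by (auto simp: a_def b_def c_def set_hist)
  let ?R1 = "\<lambda>w. interlaced a w \<and> \<not> interlaced b w \<and> \<not> interlaced c w"
  let ?R2 = "\<lambda>w. w \<noteq> a \<and> interlaced b w \<and> interlaced c w \<and> \<not> interlaced a w"
  have irrefl: "\<not> interlaced w w" for w unfolding interlaced_def by (auto simp: doubleton_eq_iff)
  have "even (card {w \<in> chord_diagram t - {a, b, c}. interlaced w a \<and> \<not> interlaced w b \<and> \<not> interlaced w c} +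
      card {w \<in> chord_diagram t - {a, b, c}. interlaced w b \<and> interlaced w c \<and> \<not> interlaced w a})"
    using B3 chord_diagram \<open>interlaced a b\<close> \<open>interlaced b c\<close> \<open>interlaced a c\<close>
    unfolding cond_B3_def interlacement_graph_def by (simp cong: conj_cong)
  also have "{w \<in> chord_diagram t - {a, b, c}. interlaced w a \<and> \<not> interlaced w b \<and> \<not> interlaced w c} = {w \<in> chord_diagram t. ?R1 w}"
    using irrefl \<open>interlaced b c\<close> interlaced_commute by blast
  also have "{w \<in> chord_diagram t - {a, b, c}. interlaced w b \<and> interlaced w c \<and> \<not> interlaced w a} = {w \<in> chord_diagram t. ?R2 w}"
    using irrefl interlaced_commute by blast
  finally have "even (card {w \<in> chord_diagram t. ?R1 w} + card {w \<in> chord_diagram t. ?R2 w})" .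
  moreover have fin: "finite (chord_diagram t)" unfolding chord_diagram_def by simp
  moreover have "card {w \<in> chord_diagram t. ?R1 w \<or> ?R2 w} = card {w \<in> chord_diagram t. ?R1 w} + card {w \<in> chord_diagram t. ?R2 w}"
    using fin by (subst card_Un_disjoint[symmetric]) (auto intro!: arg_cong[of _ _ card])
  moreover have "card {w \<in> chord_diagram t. ?R1 w \<or> ?R2 w} = card {x. x < length t \<and> x < t ! x \<and> (?R1 {x, t ! x} \<or> ?R2 {x, t ! x})}"
  proof (rule card_chords_by_endpoint[OF _ _ _ _ t])
    fix x assume x: "x < length t" "?R1 {x, t ! x} \<or> ?R2 {x, t ! x}"
    show "(x < length t \<and> x < t ! x \<and> (?R1 {x, t ! x} \<or> ?R2 {x, t ! x})) \<or>
      (t ! x < length t \<and> t ! x < t ! (t ! x) \<and> (?R1 {t ! x, t ! (t ! x)} \<or> ?R2 {t ! x, t ! (t ! x)}))"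
      using x matchingD[OF t x(1)] by (cases "x < t ! x") (auto simp: insert_commute)
  qed (use matchingD[OF t] in auto)
  moreover have "{x, t ! x} = a \<longleftrightarrow> (x, t ! x) = p" if "x < length t" "x < t ! x" for x
    using that lt(1) unfolding a_def by (cases p) (auto simp: doubleton_eq_iff)
  ultimately have "even (card {x. x < length t \<and> x < t ! x \<and>
     (crosses p (x, t ! x) \<and> \<not> crosses q (x, t ! x) \<and> \<not> crosses r (x, t ! x) \<or>
      (x, t ! x) \<noteq> p \<and> crosses q (x, t ! x) \<and> crosses r (x, t ! x) \<and> \<not> crosses p (x, t ! x))})"
    using I[OF mem(1) lt(1)] I[OF mem(2) lt(2)] I[OF mem(3) lt(3)] unfolding a_def[symmetric] b_def[symmetric] c_def[symmetric]
    by (simp cong: conj_cong)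
  then show False using odd unfolding triple_even_hist by simp
qed

lemma list_access_numeral:
  "(x # xs) ! 1 = xs ! 0" "(x # xs) ! numeral k = xs ! pred_numeral k"
  "take 1 (x # xs) = [x]" "take (numeral k) (x # xs) = x # take (pred_numeral k) xs"
  "drop 1 (x # xs) = xs" "drop (numeral k) (x # xs) = drop (pred_numeral k) xs"
  by (simp_all add: numeral_eq_Suc)

lemmas numeral_rules = rel_simps arith_simps arith_special one_plus_numeral numeral_plus_one one_le_numeral
  one_less_numeral_iff not_numeral_less_one numeral_le_one_iff one_neq_zero zero_neq_one numeral_eq_one_iff
  one_eq_numeral_iff not_one_less_zero zero_less_one le_numeral_extra less_numeral_extra numeral_One
  pred_numeral_simps nat.inject Suc_eq_numeral eq_numeral_Suc

lemma upt_18: "[0..<18] = [0, 1, 2, 3, 4, 5, 6, 7, 8, 9, 10, 11, 12, 13, 14, 15, 16, 17]"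
  by code_simp

lemma turned_nth: "s < 18 \<Longrightarrow> x < 18 \<Longrightarrow> turned s ! x = act 9 1 (int s) x"
proof -
  assume "s < 18" "x < 18"
  have "turned s = rotate s [0..<18]" using \<open>s < 18\<close> unfolding turned_def upt_18[symmetric] by (simp add: rotate_drop_take)
  then have "turned s ! x = (s + x) mod 18" using \<open>x < 18\<close> by (simp add: nth_rotate)
  then show ?thesis by (simp add: act_def nat_mod_distrib nat_add_distrib add.commute)
qed

lemma g0_dia: "g0 = chord_diagram partner0"
proof (rule set_eqI)
  fix c :: "nat set"
  have "c \<in> chord_diagram partner0 \<longleftrightarrow> (\<exists>i\<in>set [0..<18]. c = {i, partner0 ! i})" by (auto simp: chord_diagram_def partner0_def)
  also have "\<dots> \<longleftrightarrow> c = {0, 5} \<or> c = {1, 8} \<or> c = {2, 9} \<or> c = {3, 14} \<or> c = {4, 15} \<or> c = {5, 0} \<or> c = {6, 13} \<or>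
      c = {7, 12} \<or> c = {8, 1} \<or> c = {9, 2} \<or> c = {10, 17} \<or> c = {11, 16} \<or> c = {12, 7} \<or> c = {13, 6} \<or>
      c = {14, 3} \<or> c = {15, 4} \<or> c = {16, 11} \<or> c = {17, 10}"
    unfolding upt_18 partner0_def
    by (simp only: list.set bex_simps nth_Cons_0 list_access_numeral numeral_rules simp_thms)
  also have "\<dots> \<longleftrightarrow> c \<in> g0"
    unfolding g0_def insert_iff empty_iff insert_commute[of 5 0] insert_commute[of 8 1] insert_commute[of 9 2]
      insert_commute[of 14 3] insert_commute[of 15 4] insert_commute[of 13 6] insert_commute[of 12 7]
      insert_commute[of 17 10] insert_commute[of 16 11] by argo
  finally show "c \<in> g0 \<longleftrightarrow> c \<in> chord_diagram partner0" ..
qed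

lemma matching_partner0: "matching partner0"
proof -
  have "\<forall>i\<in>set [0..<18]. partner0 ! i < 18 \<and> partner0 ! i \<noteq> i \<and> partner0 ! (partner0 ! i) = i"
    unfolding upt_18 partner0_def by simp
  moreover have "length partner0 = 18" by (simp add: partner0_def)
  ultimately show ?thesis unfolding matching_def by simp
qed

lemma gauss_diagram_g0: "gauss_diagram 9 g0"
  unfolding g0_dia by (rule gauss_diagram_dia[OF matching_partner0]) (simp_all add: partner0_def)

lemma act_image_dia:
  assumes "matching t" "matching t'" "length t = 2 * n" "length t' = 2 * n" "n > 0" "e \<in> {1, -1}"
    and "\<And>x. x < 2 * n \<Longrightarrow> t' ! act n e s x = act n e s (t ! x)"
  shows "(`) (act n e s) ` chord_diagram t = chord_diagram t'"
proof (intro equalityI subsetI)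
  fix c assume "c \<in> (`) (act n e s) ` chord_diagram t"
  then obtain x where "x < 2 * n" "c = {act n e s x, act n e s (t ! x)}" using assms(3) by (auto simp: chord_diagram_def)
  then show "c \<in> chord_diagram t'" using assms(7)[of x] act_less[OF assms(5)] assms(4) by (auto simp: chord_diagram_def)
next
  fix c assume "c \<in> chord_diagram t'"
  then obtain y where y: "y < 2 * n" "c = {y, t' ! y}" using assms(4) by (auto simp: chord_diagram_def)
  have "act n e s ` {0..<2 * n} = {0..<2 * n}"
    using inj_on_act[OF assms(5,6), of s] act_less[OF assms(5)] by (intro endo_inj_surj) auto
  then obtain x where x: "x < 2 * n" "y = act n e s x" using y(1) by (metis (no_types, lifting) atLeastLessThan_iff imageE le0)
  have "c = act n e s ` {x, t ! x}" using y(2) x assms(7)[of x] by simp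
  moreover have "{x, t ! x} \<in> chord_diagram t" using x assms(3) by (auto simp: chord_diagram_def)
  ultimately show "c \<in> (`) (act n e s) ` chord_diagram t" by blast
qed

lemma turned_iso_g0:
  assumes t: "matching t" and j: "justified (history t (length t)) (Turned s)"
  shows "length t = 18" "diagram_iso 9 (chord_diagram t) g0"
proof -
  show l: "length t = 18" using j by (simp add: history_def)
  have "partner0 ! act 9 1 (int s) x = act 9 1 (int s) (t ! x)" if "x < 18" for x
    using j that matchingD(1)[OF t, of x] l by (auto simp: set_hist turned_nth)
  then have "(`) (act 9 1 (int s)) ` chord_diagram t = g0"
    unfolding g0_dia using l by (intro act_image_dia t matching_partner0) (simp_all add: partner0_def)
  then show "diagram_iso 9 (chord_diagram t) g0"
    unfolding diagram_iso_act using gauss_diagram_g0 gauss_diagram_dia[OF t, of 9] l by auto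
qed

lemma verdict_sound:
  assumes t: "matching t" "length t = 2 * n" "n > 0" and "prime_diagram (chord_diagram t)" "B_conditions (chord_diagram t)"
    and j: "justified (history t (length t)) v"
  shows "realizable_diagram n (chord_diagram t) \<or> n = 9 \<and> diagram_iso 9 (chord_diagram t) g0"
proof (cases v)
  case (Drawn w)
  then have "draws w t" using j by (simp add: map_snd_hist)
  then show ?thesis using draws_realizable t by blast
next
  case (Split a b)
  then have "justified (history t (length t)) (Split a b)" using j by (simp only:)
  from split_not_prime[OF t(1) this] show ?thesis using assms(4) by blast
next
  case (Odd_triple p q r)
  then have "justified (history t (length t)) (Odd_triple p q r)" using j by (simp only:)
  from odd_triple_not_B3[OF t(1) this] show ?thesis using assms(5) unfolding B_conditions_def by blast
next
  case (Turned s)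
  then have "justified (history t (length t)) (Turned s)" using j by (simp only:)
  from turned_iso_g0[OF t(1) this] show ?thesis using t(2) by simp
qed

section \<open>Evaluation by rewriting\<close>

fun flip :: "dir \<Rightarrow> dir" where "flip E = W" | "flip N = S" | "flip W = E" | "flip S = N"

definition rot :: "nat \<Rightarrow> 'a list \<Rightarrow> 'a list" where
  "rot k w = drop k w @ take k w"

definition backwards :: "dir list list \<Rightarrow> dir list list" where
  "backwards w = rev (map (\<lambda>e. rev (map flip e)) w)"

text \<open>The simplifier rewrites from the inside out and would evaluate both branches of a conditional. The auxiliary
constants below receive the value of the test as an argument, and their equations only apply once it has been reduced to a truth
value; a branch that is not taken is never evaluated.\<close>

definition evenly1 :: "bool \<Rightarrow> nat \<Rightarrow> nat \<Rightarrow> nat \<Rightarrow> nat \<Rightarrow> (nat \<times> nat) list \<Rightarrow> bool" where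
  "evenly1 p a c d y h = (if p then True else if c < y \<and> y < d then \<not> evenly a c d h else evenly a c d h)"
definition evenly2 :: "bool \<Rightarrow> bool \<Rightarrow> nat \<Rightarrow> nat \<Rightarrow> nat \<Rightarrow> (nat \<times> nat) list \<Rightarrow> bool" where
  "evenly2 p q a c d h = (if p \<and> q then \<not> evenly a c d h else evenly a c d h)"
definition opening1 :: "bool \<Rightarrow> nat \<Rightarrow> nat \<Rightarrow> nat \<Rightarrow> (nat \<times> nat) list \<Rightarrow> bool" where
  "opening1 p y e f h = ((p \<longrightarrow> evenly y e f h) \<and> opening_ok e f h)"
definition opening2 :: "bool \<Rightarrow> nat \<Rightarrow> nat \<Rightarrow> (nat \<times> nat) list \<Rightarrow> bool" where
  "opening2 p e f h = (p \<and> opening_ok e f h)"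
definition closing1 :: "bool \<Rightarrow> bool \<Rightarrow> nat \<Rightarrow> nat \<Rightarrow> nat \<Rightarrow> nat \<Rightarrow> (nat \<times> nat) list \<Rightarrow> (nat \<times> nat) list \<Rightarrow> bool" where
  "closing1 p q x y i a k h = ((p \<and> q \<longrightarrow> evenly a x y k) \<and> closing_ok i a k h)"
definition closing2 :: "bool \<Rightarrow> nat \<Rightarrow> nat \<Rightarrow> (nat \<times> nat) list \<Rightarrow> (nat \<times> nat) list \<Rightarrow> bool" where
  "closing2 p i a k h = (p \<and> closing_ok i a k h)"
definition opener1 :: "bool \<Rightarrow> nat \<Rightarrow> nat \<Rightarrow> (nat \<times> nat) list \<Rightarrow> nat" where
  "opener1 p x i h = (if p then x else opener i h)"
definition complete1 :: "bool \<Rightarrow> nat \<Rightarrow> nat \<Rightarrow> nat \<Rightarrow> nat list \<Rightarrow> nat \<Rightarrow> nat list \<Rightarrow> nat list \<Rightarrow> (nat \<times> nat) list \<Rightarrow> (nat \<times> nat) list list" where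
  "complete1 p l u i is a A B h =
    (if p then concat (map (\<lambda>(b, R). if i + l \<le> b \<and> b \<le> i + u \<and> opening_ok i b h
                                then complete l u is R A ((i, b) # h) else []) (picks [] B))
     else if closing_ok i (opener i h) h h then complete l u is B (a # A) ((i, opener i h) # h) else [])"
definition complete2 :: "bool \<Rightarrow> nat \<Rightarrow> nat \<Rightarrow> nat \<Rightarrow> nat \<Rightarrow> nat list \<Rightarrow> nat list \<Rightarrow> nat list \<Rightarrow> (nat \<times> nat) list \<Rightarrow> (nat \<times> nat) list list" where
  "complete2 p a l u i is A B h = (if p then complete l u is B A ((i, a) # h) else [])"
definition complete3 :: "nat \<Rightarrow> nat \<Rightarrow> nat \<Rightarrow> nat \<Rightarrow> nat list \<Rightarrow> nat list \<Rightarrow> nat list \<Rightarrow> (nat \<times> nat) list \<Rightarrow> (nat \<times> nat) list list" where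
  "complete3 a l u i is A B h = complete2 (closing_ok i a h h) a l u i is A B h"
definition branch :: "nat \<Rightarrow> nat \<Rightarrow> nat \<Rightarrow> nat list \<Rightarrow> nat list \<Rightarrow> (nat \<times> nat list) list \<Rightarrow> (nat \<times> nat) list \<Rightarrow> (nat \<times> nat) list list" where
  "branch l u i is A P h = concat (map (\<lambda>(b, R). if i + l \<le> b \<and> b \<le> i + u \<and> opening_ok i b h
                                then complete l u is R A ((i, b) # h) else []) P)"
definition branch1 :: "bool \<Rightarrow> nat \<Rightarrow> nat \<Rightarrow> nat \<Rightarrow> nat list \<Rightarrow> nat list \<Rightarrow> nat \<Rightarrow> nat list \<Rightarrow> (nat \<times> nat) list \<Rightarrow> (nat \<times> nat) list list" where
  "branch1 p l u i is A b R h = (if p \<and> opening_ok i b h then complete l u is R A ((i, b) # h) else [])"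
definition branch2 :: "bool \<Rightarrow> nat \<Rightarrow> nat \<Rightarrow> nat \<Rightarrow> nat list \<Rightarrow> nat list \<Rightarrow> nat \<Rightarrow> nat list \<Rightarrow> (nat \<times> nat) list \<Rightarrow> (nat \<times> nat) list list" where
  "branch2 p l u i is A b R h = (if p then complete l u is R A ((i, b) # h) else [])"

lemma search_rules:
  "evenly a c d [] = True"
  "evenly a c d ((x, y) # h) = evenly1 (x = a) a c d y h"
  "evenly1 True a c d y h = True"
  "evenly1 False a c d y h = evenly2 (c < y) (y < d) a c d h"
  "evenly2 True True a c d h = (\<not> evenly a c d h)"
  "evenly2 False q a c d h = evenly a c d h"
  "evenly2 True False a c d h = evenly a c d h"
  "opening_ok e f [] = True"
  "opening_ok e f ((x, y) # h) = opening1 (y < x) y e f h"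
  "opening1 True y e f h = opening2 (evenly y e f h) e f h"
  "opening1 False y e f h = opening_ok e f h"
  "opening2 True e f h = opening_ok e f h"
  "opening2 False e f h = False"
  "closing_ok i a k [] = True"
  "closing_ok i a k ((x, y) # h) = closing1 (x < a) (i < y) x y i a k h"
  "closing1 True True x y i a k h = closing2 (evenly a x y k) i a k h"
  "closing1 False q x y i a k h = closing_ok i a k h"
  "closing1 True False x y i a k h = closing_ok i a k h"
  "closing2 True i a k h = closing_ok i a k h"
  "closing2 False i a k h = False"
  "opener i [] = 0"
  "opener i ((x, y) # h) = opener1 (y = i) x i h"
  "opener1 True x i h = x"
  "opener1 False x i h = opener i h"
  "complete l u [] A B h = [h]"
  "complete l u (i # is) [] B h = complete3 (opener i h) l u i is [] B h"
  "complete l u (i # is) (a # A) B h = complete1 (a = i) l u i is a A B h"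
  "complete1 True l u i is a A B h = branch l u i is A (picks [] B) h"
  "complete1 False l u i is a A B h = complete3 (opener i h) l u i is (a # A) B h"
  "complete3 a l u i is A B h = complete2 (closing_ok i a h h) a l u i is A B h"
  "complete2 True a l u i is A B h = complete l u is B A ((i, a) # h)"
  "complete2 False a l u i is A B h = []"
  "branch l u i is A [] h = []"
  "branch l u i is A ((b, R) # P) h = branch1 (i + l \<le> b \<and> b \<le> i + u) l u i is A b R h @ branch l u i is A P h"
  "branch1 True l u i is A b R h = branch2 (opening_ok i b h) l u i is A b R h"
  "branch1 False l u i is A b R h = []"
  "branch2 True l u i is A b R h = complete l u is R A ((i, b) # h)"
  "branch2 False l u i is A b R h = []"
  by (simp_all add: evenly1_def evenly2_def opening1_def opening2_def closing1_def closing2_def opener1_def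
      complete1_def complete2_def complete3_def branch_def branch1_def branch2_def cong: if_cong)

fun apart :: "tag \<Rightarrow> int \<Rightarrow> int \<Rightarrow> (tag \<times> int \<times> int) list \<Rightarrow> bool" where
  "apart a x y [] = True"
| "apart a x y ((b, x', y') # r) = (compatible (a, x, y) (b, x', y') \<and> apart a x y r)"
fun all_apart :: "(tag \<times> int \<times> int) list \<Rightarrow> bool" where
  "all_apart [] = True"
| "all_apart ((a, x, y) # r) = (apart a x y r \<and> all_apart r)"
definition apart1 :: "bool \<Rightarrow> tag \<Rightarrow> int \<Rightarrow> int \<Rightarrow> tag \<Rightarrow> int \<Rightarrow> (tag \<times> int \<times> int) list \<Rightarrow> bool" where
  "apart1 p a x y b y' r = ((p \<longrightarrow> y = y' \<longrightarrow> a = Hor \<and> b = Ver \<or> a = Ver \<and> b = Hor) \<and> apart a x y r)"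
definition apart2 :: "bool \<Rightarrow> tag \<Rightarrow> int \<Rightarrow> int \<Rightarrow> tag \<Rightarrow> (tag \<times> int \<times> int) list \<Rightarrow> bool" where
  "apart2 p a x y b r = ((p \<longrightarrow> a = Hor \<and> b = Ver \<or> a = Ver \<and> b = Hor) \<and> apart a x y r)"
fun positions :: "(tag \<times> int \<times> int) list \<Rightarrow> (int \<times> int) list" where
  "positions [] = []"
| "positions ((Plain, q) # r) = positions r"
| "positions ((Hor, q) # r) = q # positions r"
| "positions ((Ver, q) # r) = q # positions r"
fun same :: "(int \<times> int) list \<Rightarrow> (nat \<times> nat) list \<Rightarrow> bool" where
  "same ps [] = True"
| "same ps ((x, y) # h) = (ps ! x = ps ! y \<and> same ps h)"
definition draws1 :: "(bool \<times> dir) list \<Rightarrow> (nat \<times> nat) list \<Rightarrow> bool" where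
  "draws1 s h = (s \<noteq> [] \<and> no_turn_back (snd (last s)) s \<and> endpoint 20 20 s = (20, 20) \<and>
     sorted_wrt compatible (track (snd (last s)) 20 20 s) \<and>
     length (map snd (filter (\<lambda>i. fst i \<noteq> Plain) (track (snd (last s)) 20 20 s))) = length h \<and>
     same (map snd (filter (\<lambda>i. fst i \<noteq> Plain) (track (snd (last s)) 20 20 s))) h)"
definition draws2 :: "dir \<Rightarrow> (bool \<times> dir) list \<Rightarrow> (nat \<times> nat) list \<Rightarrow> bool" where
  "draws2 p s h = (s \<noteq> [] \<and> no_turn_back p s \<and> endpoint 20 20 s = (20, 20) \<and>
     sorted_wrt compatible (track p 20 20 s) \<and>
     length (map snd (filter (\<lambda>i. fst i \<noteq> Plain) (track p 20 20 s))) = length h \<and>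
     same (map snd (filter (\<lambda>i. fst i \<noteq> Plain) (track p 20 20 s))) h)"
definition draws3 :: "(tag \<times> int \<times> int) list \<Rightarrow> (nat \<times> nat) list \<Rightarrow> bool" where
  "draws3 its h = (all_apart its \<and> length (positions its) = length h \<and> same (positions its) h)"
definition draws4 :: "(int \<times> int) list \<Rightarrow> (nat \<times> nat) list \<Rightarrow> bool" where
  "draws4 ps h = (length ps = length h \<and> same ps h)"

lemma apart_iff: "apart a x y r \<longleftrightarrow> (\<forall>w\<in>set r. compatible (a, x, y) w)"
  by (induction a x y r rule: apart.induct) auto

lemma all_apart_iff: "all_apart its \<longleftrightarrow> sorted_wrt compatible its"
  by (induction its rule: all_apart.induct) (auto simp: apart_iff)

lemma positions_eq: "positions its = map snd (filter (\<lambda>i. fst i \<noteq> Plain) its)"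
  by (induction its rule: positions.induct) auto

lemma same_iff: "same ps h \<longleftrightarrow> (\<forall>(x, y)\<in>set h. ps ! x = ps ! y)"
  by (induction ps h rule: same.induct) auto

lemma draws_rules:
  "draws1 s h = draws2 (snd (last s)) s h"
  "draws2 p s h = (s \<noteq> [] \<and> no_turn_back p s \<and> endpoint 20 20 s = (20, 20) \<and> draws3 (track p 20 20 s) h)"
  "draws3 its h = (all_apart its \<and> draws4 (positions its) h)"
  "draws4 ps h = (length ps = length h \<and> same ps h)"
  "all_apart [] = True"
  "all_apart ((a, x, y) # r) = (apart a x y r \<and> all_apart r)"
  "apart a x y [] = True"
  "apart a x y ((b, x', y') # r) = apart1 (x = x') a x y b y' r"
  "apart1 False a x y b y' r = apart a x y r"
  "apart1 True a x y b y' r = apart2 (y = y') a x y b r"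
  "apart2 False a x y b r = apart a x y r"
  "apart2 True Hor x y Ver r = apart Hor x y r"
  "apart2 True Ver x y Hor r = apart Ver x y r"
  "track p x y [] = []"
  "track p x y ((True, c) # s) = (cross_tag p c, x, y) # track c (x + dx c) (y + dy c) s"
  "track p x y ((False, c) # s) = (Plain, x, y) # track c (x + dx c) (y + dy c) s"
  "last [z] = z" "last (z # z' # zs) = last (z' # zs)"
  by (simp_all add: draws1_def draws2_def draws3_def draws4_def all_apart_iff[symmetric] positions_eq apart1_def apart2_def)

text \<open>Equivalent to \<open>justified\<close> for the history of a complete diagram; the partners are read from the history instead of a list.\<close>

fun verified :: "(nat \<times> nat) list \<Rightarrow> verdict \<Rightarrow> bool" where
  "verified h (Drawn w) = draws1 (steps w) h"
| "verified h (Split a b) = justified h (Split a b)"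
| "verified h (Odd_triple p q r) = justified h (Odd_triple p q r)"
| "verified h (Turned s) = justified h (Turned s)"

lemma verified_justified:
  assumes "verified (history t (length t)) v" shows "justified (history t (length t)) v"
proof (cases v)
  case (Drawn w)
  have "(\<forall>i<length t. ps ! i = ps ! (t ! i)) \<longleftrightarrow> same ps (history t (length t))" for ps
    by (auto simp: same_iff set_hist)
  moreover have "length (history t (length t)) = length t" by (simp add: history_def)
  ultimately show ?thesis using assms Drawn by (simp add: map_snd_hist draws_def draws1_def Let_def)
qed (use assms in auto)

lemma search_eq:
  assumes "[1..<2 * n] = is" "filter (\<lambda>x. odd x \<and> x \<noteq> l) [1..<2 * n] = A" "filter even [1..<2 * n] = B"
    "2 * n - l = u"
  shows "search n l = complete l u is A B [(0, l)]"
  using assms by (simp only: search_def)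

lemma Ball_set_Cons: "Ball (set (x # xs)) P = (P x \<and> Ball (set xs) P)" "Ball (set []) P = True"
  "Bex (set (x # xs)) P = (P x \<or> Bex (set xs) P)" "Bex (set []) P = False" by auto

lemma crosses_pair: "crosses (a, b) (c, d) = ((a < c \<and> c < b) \<noteq> (a < d \<and> d < b))"
  by (simp add: crosses_def)

lemma member_Cons: "x \<in> set (y # ys) \<longleftrightarrow> x = y \<or> x \<in> set ys" "x \<in> set [] \<longleftrightarrow> False"
  by auto

lemmas eval_rules = search_rules picks.simps append_Nil append_Cons prod.inject fst_conv snd_conv
  split_conv simp_thms refl numeral_rules

lemmas verdict_rules = verified.simps draws_rules steps.simps positions.simps same.simps cross_tag.simps turnable.simps
  no_turn_back.simps endpoint.simps dx.simps dy.simps flip.simps rot_def backwards_def list.map rev.simps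
  drop_Nil take_Nil drop_0 take_0 nth_Cons_0 list_access_numeral
  list.size list.distinct justified.simps triple_even.simps crosses_pair Ball_set_Cons member_Cons turned_def partner0_def

section \<open>The catalogue of curves\<close>

text \<open>One lattice walk for every class of prime realizable diagrams with at most 9 chords. The walks were found by
computing a planar embedding from the diagram and an orthogonal drawing with few bends from the embedding; the verdicts
check them from scratch.\<close>

definition "curve_1_1 = [[E,S,W,N], [N,W,S,E]]"
definition "curve_3_1 = [[E,N,N,W,W,S], [S], [S,E,N], [N,W], [W,S,E], [E]]"
definition "curve_4_1 = [[E,N,N,W,W,W,S,S], [S], [S,E,E,N,N], [N,W,S], [S,W], [W,N,E], [E], [E]]"
definition "curve_5_1 = [[E,E,N,N,N,W,W,S], [S], [S], [S,W,N], [N], [N,E], [E,S,W], [W], [W,S,E], [E]]"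
definition "curve_5_2 = [[E,N,N,W], [W,W], [W,S,E], [E,S], [S,E,N], [N,N], [N,W,W,S], [S], [S,E], [E]]"
definition "curve_6_1 = [[E,N], [N,W,S], [S], [S], [S], [S,E,E,N,N,N,N,W], [W], [W,W,S,S,E], [E], [E,S,W],
[W,N], [N,E]]"
definition "curve_6_2 = [[E], [E,S,W], [W,N], [N], [N,W,S], [S], [S,S,E,E,N], [N], [N,W], [W], [W,S,E], [E]]"
definition "curve_6_3 = [[E], [E,S,W], [W,N], [N,W,S], [S,S], [S,E,E,N], [N], [N], [N,E,E,S,S,S,W,W], [W,W],
[W,N,N,E], [E]]"
definition "curve_7_1 = [[E], [E,S,W], [W,N], [N], [N,E,S], [S], [S], [S,W,W,N,N], [N], [N,N,E,E,E,S,S,W],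
[W], [W], [W,S,E], [E]]"
definition "curve_7_2 = [[E], [E,S,W], [W,N], [N,W], [W,S], [S], [S,E,E,E,N], [N], [N,N,W,W,S], [S], [S,W],
[W,N,E], [E], [E]]"
definition "curve_7_3 = [[E,N], [N,W,S], [S], [S,S,W,W], [W,N,E], [E,N], [N,E], [E], [E,N,N,W,W,W,W,S,S,S],
[S], [S], [S,W,W,N,N,N,E,E], [E], [E]]"
definition "curve_7_4 = [[E,N], [N,W,S], [S], [S,W], [W,N], [N,E], [E], [E], [E,N,N,W,W,W,S,S], [S], [S],
[S,W,W,N,N,E], [E], [E]]"
definition "curve_7_5 = [[E,E,N,N,N,W,W,S], [S], [S], [S,S,W,W,W,W,N,N,N,N,E,E,S], [S], [S,E,N], [N], [N,E],
[E,S,W], [W], [W], [W,S,E], [E], [E]]"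
definition "curve_7_6 = [[E,N], [N,W,S], [S], [S], [S], [S,E,E,N], [N], [N,N,W], [W], [W,W,S,S,S,E,E], [E,E],
[E,N,W], [W,W], [W,N,E]]"
definition "curve_7_7 = [[E,E,N], [N], [N,W,W,S,S,S], [S,W], [W,S,E], [E,E,E,E], [E,N,N,N,W], [W], [W,N,E],
[E,S], [S,S,S], [S,W,W,W,W,N], [N], [N,E]]"
definition "curve_7_8 = [[E], [E,N], [N,E,S], [S,S], [S,E,E,N,N,N,N,N,W,W,W,W,W,S,S,S], [S], [S,E,N], [N],
[N,E], [E], [E,S,S,W], [W,W], [W], [W,N,E]]"
definition "curve_7_9 = [[E], [E], [E,N,W], [W], [W,S], [S], [S,E,N], [N], [N], [N,E,S], [S], [S,W], [W],
[W,N,E]]"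
definition "curve_7_10 = [[E,N,N,W], [W,W,W,W], [W,S,S,S,E], [E], [E,N], [N,E,S], [S,E,N], [N,N],
[N,W,W,W,W,S], [S,S,S], [S,E,N], [N,E], [E], [E]]"
definition "curve_8_1 = [[E,E,S,S,S,W], [W,N], [N,N], [N,W,W,W,S,S], [S], [S,S,E,E,E,E,N], [N,W], [W], [W],
[W], [W,N,E], [E], [E,S], [S,W,N], [N], [N,E,E]]"
definition "curve_8_2 = [[E], [E,N,W], [W,S], [S], [S,E,N], [N], [N], [N], [N,W,W,S], [S,S], [S,E], [E],
[E,E,N,N,N,W,W], [W,W], [W,S,S,E], [E]]"
definition "curve_8_3 = [[E,N], [N,W,S], [S], [S], [S], [S,E,E,N,N,N,N,W], [W], [W], [W], [W,S,S,E], [E,E],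
[E,S,W], [W,W,N], [N,N], [N,E,S], [S,E]]"
definition "curve_8_4 = [[E,E,S,S,S,W,W,N], [N], [N], [N,N,W,W,W,W,S,S,S,S,E,E], [E], [E], [E,N,W], [W], [W],
[W,N,N,E,E,S], [S], [S], [S,W,N], [N], [N,E], [E]]"
definition "curve_8_5 = [[E], [E,N,W], [W,S], [S], [S], [S], [S,E,E,E,N,N,N,N,N,N,W,W,S], [S], [S,W], [W],
[W,S,E], [E], [E,S,W], [W,N], [N], [N,E]]"
definition "curve_8_6 = [[E,S], [S,W,N], [N], [N,W,W,W,W,S,S,E], [E], [E], [E], [E], [E,S,S,W,W,W], [W],
[W,N,N], [N,E,S], [S,S], [S,E,N], [N,N], [N,E]]"
definition "curve_8_7 = [[E,S,S], [S,W,N], [N,N], [N,N,W,W,W,S,S], [S], [S,E,E], [E], [E], [E,S,S,W,W,W,N,N],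
[N,N], [N,W,S], [S,W], [W,N,E], [E], [E], [E]]"
definition "curve_8_8 = [[E], [E,N,W], [W,S], [S], [S], [S], [S,E,E,E,N,N,N,N,N,N,W,W,S], [S], [S], [S],
[S,W], [W,N,E], [E], [E,N,W], [W], [W,N,E]]"
definition "curve_8_9 = [[E], [E,S,W], [W,N], [N], [N,N,W,W,W,W,S,S,E], [E], [E,E], [E,S], [S], [S,W,W], [W],
[W,N,N,N], [N,E,S], [S,S,S], [S,E,N], [N,N,E]]"
definition "curve_8_10 = [[E,E,N,N,N,W,W,S], [S], [S], [S], [S], [S,W,W,N], [N,N], [N,N,E,E], [E,S,W], [W,S],
[S,E], [E,S,W], [W,W], [W,N,N,E], [E], [E]]"
definition "curve_8_11 = [[E], [E], [E,S,S,W,W,W,N,N], [N], [N], [N,E,S], [S], [S], [S,E,N], [N,W], [W], [W],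
[W,N,N,N,E,E,E,E,S,S,W], [W], [W,S], [S,E]]"
definition "curve_8_12 = [[E,N], [N,W,S], [S], [S], [S], [S,E,E,N], [N], [N,N,W], [W], [W,W,S,S,E], [E],
[E,E], [E,S,W], [W,W], [W,N], [N,E]]"
definition "curve_8_13 = [[E], [E], [E,N,N,W,W,W,S,S], [S], [S], [S,E,N], [N], [N], [N,E,S], [S], [S,W], [W],
[W,N,E], [E], [E], [E,S,S,S,W,W,W,W,W,N,N,N,N,E,E]]"
definition "curve_8_14 = [[E,N], [N,W,S], [S], [S,E,E,E,N,N,N,N,N,W,W,W,W,W,S,S,S], [S], [S,W,N], [N,E], [E],
[E], [E], [E,N,N,W,W,W,S,S], [S], [S,S,W,W,W,N,N,E], [E], [E], [E]]"
definition "curve_8_15 = [[E], [E,S,W], [W,N], [N,E], [E,N,W], [W,W,W], [W,S,S,S,S,E], [E], [E,E,N], [N],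
[N], [N], [N,W,W,W,S], [S,S,S,S], [S,E,N], [N,N,E]]"
definition "curve_8_16 = [[E], [E,S,W], [W,N], [N], [N,W,S], [S], [S,W,N], [N], [N,W,W,S,S,S,S,E,E,E,E,E,N],
[N], [N,W], [W], [W], [W,S,E], [E], [E]]"
definition "curve_8_17 = [[E], [E,S,W], [W,N], [N,N], [N,N,W,W,W,S,S], [S,E,N], [N,E,S], [S,S], [S,S,E,E,N],
[N], [N,N,W], [W], [W], [W], [W,S,S,E,E,E], [E]]"
definition "curve_8_18 = [[E], [E,S,W], [W,N], [N,N,W], [W], [W,N,E], [E], [E,E], [E,E,S,S,S,S,S,W,W,N], [N],
[N,N,N], [N,W,W,S], [S], [S,W,N], [N], [N,W,W,S,S,S,S,E,E,E,E]]"
definition "curve_8_19 = [[E], [E,S,W], [W,N], [N,W,S], [S,W,N], [N,N], [N,W,S], [S,S], [S,S,E,E,E,E,N], [N],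
[N,N,W,W,W], [W], [W,S,S,E], [E], [E], [E]]"
definition "curve_8_20 = [[E,E], [E,S,W], [W,W,N], [N], [N], [N,W,W,S], [S,S,S,S], [S,E,E,E,E,N], [N], [N],
[N,E,E,S,S,S,W,W], [W,W,W,W], [W,N,N,N,N,E], [E,E], [E,S,W], [W,S,E]]"
definition "curve_8_21 = [[E,E], [E,S,S,W], [W], [W,N], [N], [N,E,E,S], [S,S], [S,W], [W,W], [W,N,N,E], [E],
[E,S], [S], [S,W,W,N], [N,N], [N,E]]"
definition "curve_8_22 = [[E], [E,E,S,S,S,W,W], [W,N], [N], [N], [N,E,S], [S], [S], [S], [S,W,W,N,N], [N,E],
[E], [E,S,W], [W], [W], [W,N,N,E,E]]"
definition "curve_8_23 = [[E,S,W], [W], [W,N], [N], [N,E,E,S,S], [S], [S,W], [W,W], [W,N,N,N,E,E], [E,S],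
[S], [S], [S,W,W,N], [N,N,E], [E], [E]]"
definition "curve_8_24 = [[E,S], [S], [S,W,N], [N], [N], [N], [N,W,S], [S], [S,E], [E], [E,S,W], [W],
[W,S,S,E,E,E,E,N,N,N,N,N,W,W,W], [W], [W,S,E], [E]]"
definition "curve_8_25 = [[E], [E], [E,S,W], [W], [W,N], [N,W,S], [S,S], [S,E,E,N], [N], [N], [N,E,S], [S],
[S,W], [W,W], [W,N,N,E], [E]]"
definition "curve_8_26 = [[E,S], [S,W], [W], [W], [W,N,N,N,E,E,E,S], [S], [S], [S], [S,W,W,N,N], [N,E], [E],
[E], [E,S,S,W,W], [W,N], [N], [N,E]]"
definition "curve_8_27 = [[E,E,S,S,S,S,S,W,W,W,W,W,N,N,N,E], [E,S], [S,E,N], [N,N], [N], [N,W], [W],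
[W,S,S,E], [E,E], [E,S,S,W], [W], [W,N], [N], [N,N], [N,E,S], [S,E]]"
definition "curve_9_1 = [[E], [E,N,W], [W,S], [S], [S,E,N], [N], [N], [N], [N,E,E,S], [S,S,S,W,W], [W],
[W,N], [N,N], [N,N,E,E,E,E,E,S,S,W], [W,W], [W,W], [W,S,S,E], [E]]"
definition "curve_9_2 = [[E,N], [N,W,S], [S], [S,E,E], [E,N,N,W], [W], [W], [W], [W,S], [S], [S,E,E,E,E,N],
[N,N], [N,N,W,W,W,S,S], [S], [S,W], [W,N,E], [E], [E]]"
definition "curve_9_3 = [[E], [E,S,W], [W,N], [N,W], [W], [W,N,N,E,E,E,E,S,S,S], [S], [S,W,W,W], [W,N,E],
[E,N], [N], [N,W,S], [S], [S], [S], [S,W,W,N,N,N,E,E], [E], [E]]"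
definition "curve_9_4 = [[E,E], [E,S,W], [W,W,N], [N], [N], [N,E,E,S,S,S], [S], [S,W,W,W], [W,N,N], [N,E],
[E], [E,N,W], [W,S], [S], [S,S], [S,W,W,N,N,N,E], [E], [E]]"
definition "curve_9_5 = [[E,E,N,N,W], [W,S], [S], [S,E,E,E,N,N,N,N,N,N,W,W,S], [S], [S], [S,W], [W], [W,N,N],
[N,E], [E,E], [E,S,W], [W,W], [W], [W,N,N,E,E,S], [S], [S,S], [S,E]]"
definition "curve_9_6 = [[E], [E,S,W], [W,N], [N], [N,E,S], [S], [S], [S], [S,W,W], [W,N,E], [E,E],
[E,E,N,N,N,W,W], [W], [W,S], [S,S], [S], [S,W,W,N,N,N,N,E,E], [E]]"
definition "curve_9_7 = [[E], [E,S,W], [W,N], [N], [N,E,S], [S], [S], [S,W,W,W,W,W,N,N,N,N,E,E,S], [S],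
[S,E,N], [N], [N,N,E,E,E,S,S,W], [W], [W], [W], [W,S,E], [E], [E]]"
definition "curve_9_8 = [[E], [E,S,W], [W,N], [N], [N,E,S], [S], [S], [S,W,W], [W], [W,S,E], [E],
[E,E,E,E,N,N,N,N,W,W], [W], [W,W,S,S,S], [S], [S,E,N], [N], [N,N,E]]"
definition "curve_9_9 = [[E], [E,S,W], [W,N], [N], [N,E,S], [S], [S], [S,W,W], [W], [W,N,N,N,N,N,E], [E],
[E,E,E,S,S,W], [W], [W,N,N], [N,W,S], [S,S,S,S,S], [S,E,N], [N,N,E]]"
definition "curve_9_10 = [[E,N,N], [N,W,S], [S,S], [S], [S], [S,E,E,N,N,N,N,N,W], [W], [W,W,S], [S], [S,W,N],
[N,E], [E,S], [S,E], [E,S,W], [W,W,W,W,N,N,E], [E], [E], [E]]"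
definition "curve_9_11 = [[E,E,N,N,W], [W,S], [S], [S,E,E,E,N,N,N,N,N,N,W,W,S], [S], [S], [S,W], [W], [W,S],
[S,E,N], [N], [N,N], [N,E,E], [E,S,W], [W,W], [W,W,S,S,S,E], [E], [E]]"
definition "curve_9_12 = [[E,E,S,S,S,W,W], [W], [W,W,W,N,N,N,N,N,E,E,E,E,S,S], [S], [S], [S], [S,W,N], [N],
[N], [N], [N,W,W,S,S,E], [E], [E], [E,S,W], [W], [W,N], [N,E], [E]]"
definition "curve_9_13 = [[E,N], [N,W,S], [S], [S], [S], [S,E,E,N,N,N,N,W], [W], [W,S], [S], [S],
[S,W,W,N,N,E], [E], [E], [E,S,W], [W], [W,N], [N,E], [E]]"
definition "curve_9_14 = [[E], [E,S,W], [W,N], [N,N], [N,E,S], [S,S], [S], [S], [S,W,W,N], [N,N], [N,W,S],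
[S,S,E], [E,E], [E,E,N,N,N,N,W,W], [W], [W,W,W,S,S,E], [E], [E]]"
definition "curve_9_15 = [[E], [E,S,W], [W,N], [N,E], [E,E,S,S,S], [S,W,W,N], [N], [N], [N], [N], [N,W,W,S],
[S,S], [S,S,E,E], [E,E], [E,N,N,N,N,W,W,W], [W,W], [W,S,S,E], [E]]"
definition "curve_9_16 = [[E], [E,S,W], [W,N], [N], [N], [N], [N,N,W,W,W,W,S,S,S,S,S,S,S,E,E,E,E,E,N], [N],
[N,W], [W,W], [W,N,N,E], [E], [E], [E,S,W], [W,N], [N,W,S], [S,S], [S,E,E]]"
definition "curve_9_17 = [[E,S,S], [S,W,N], [N,N], [N,W,W,W,W,S,S,S,E], [E], [E], [E], [E], [E,S,S,W,W,W],
[W], [W,N,N], [N,E], [E,S], [S,S], [S,W,N], [N,N], [N], [N,E,E]]"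
definition "curve_9_18 = [[E], [E,N,W], [W,S], [S], [S], [S], [S,W,W,W,N,N,N,N,N,N,E,E,E,E,S], [S], [S],
[S,W], [W], [W,N,E], [E], [E], [E,S,S,W,W], [W,N], [N], [N,E]]"
definition "curve_9_19 = [[E,N], [N,W,S], [S], [S], [S,W,N], [N], [N,E], [E], [E,S,S], [S,S], [S,W,W,W,W,N],
[N,N,E], [E], [E,E], [E,S,S,W], [W,W,W,W], [W,N,N,N,E,E], [E]]"
definition "curve_9_20 = [[E,N], [N,W,S], [S], [S], [S,W,N], [N], [N,E], [E], [E,N,N,W,W,W,W,W,S,S,S],
[S,S,S], [S,E,N], [N,N,E], [E], [E,S,S,W,W,W], [W], [W,N,N,N,E], [E,E], [E]]"
definition "curve_9_21 = [[E,E], [E,N,W], [W,W,S], [S], [S,E], [E], [E,E,N,N,N,N,W,W,S], [S], [S,S], [S,W],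
[W,W], [W,N,N,E], [E], [E,S], [S], [S,W,W,N], [N,N], [N,E]]"
definition "curve_9_22 = [[E,N], [N,W,S], [S], [S,S,S,W,W,W,W,W,N,N,N,N,E], [E], [E,E], [E], [E],
[E,N,N,W,W,W,S,S], [S], [S,W], [W], [W,N,N], [N,E,S], [S,S], [S,E,N], [N,E], [E]]"
definition "curve_9_23 = [[E], [E,N,W], [W,S], [S], [S], [S,E], [E,E,N,N,N,N,N,W,W,S], [S], [S], [S], [S],
[S,W,W,W,N,N,N,E], [E], [E], [E,S,W], [W], [W,N], [N,E]]"
definition "curve_9_24 = [[E,S], [S,W,N], [N], [N,N,W,W,W,W,S,S,S,E], [E], [E], [E], [E], [E,S,S,W,W,W,W,N],
[N], [N], [N,E,S], [S], [S,W], [W,N], [N,E], [E], [E]]"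
definition "curve_9_25 = [[E,S,S], [S,W,N], [N,N], [N,W,W,S], [S], [S,E], [E], [E], [E,S,S,W,W,W], [W,W],
[W,N,N,N,E], [E], [E,S], [S,S], [S,W,W,N], [N,N,N], [N,E], [E,E]]"
definition "curve_9_26 = [[E,E], [E,S,W], [W,W,N], [N], [N], [N], [N,N,E,E,E,E,S,S,S,S,S,S,S,W,W,N], [N],
[N], [N,N], [N,W,S], [S,W], [W,N,E], [E], [E], [E,S,S,W], [W,W], [W,S,E]]"
definition "curve_9_27 = [[E], [E,N,W], [W,S], [S], [S], [S,W,W,N,N,E], [E], [E,N], [N], [N], [N,W,W,S],
[S,S], [S], [S,E], [E,E,E,N,N,N,N,W,W], [W,W], [W,S,S,E], [E]]"
definition "curve_9_28 = [[E,N], [N,W,S], [S], [S,E,E,N,N], [N,N], [N,E,S], [S,S,W], [W], [W], [W],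
[W,N,N,N,N,E], [E], [E,E,E,E,S,S,W], [W], [W,W,N,N], [N,W,S], [S,S,S,S], [S,E]]"
definition "curve_9_29 = [[E,E,S,S,S,W,W,N], [N], [N], [N,W], [W], [W,S], [S], [S,E,E,E], [E,N,W], [W,N],
[N], [N,W,S], [S], [S,W], [W,N,E], [E], [E], [E]]"
definition "curve_9_30 = [[E,N], [N,W,S], [S], [S], [S,E,E], [E], [E,N,N,N,W,W], [W], [W], [W,S], [S,E],
[E,E], [E,S], [S,W,N], [N], [N,N], [N,N,W,W,W,W,S,S,S,E], [E]]"
definition "curve_9_31 = [[E,E], [E], [E,N,N,W,W,W,W,S,S], [S], [S], [S], [S,E,E,N,N,N], [N], [N,E,S], [S,W],
[W,W], [W], [W,S,E], [E], [E,S,W], [W,N], [N], [N,E]]"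
definition "curve_9_32 = [[E,N], [N,W,S], [S], [S,E,E], [E,E,E,N,N,W], [W], [W], [W], [W], [W,S],
[S,S,E,E,E,N], [N,N], [N,E], [E,S], [S,W,N], [N], [N,W,W,W,W,W,S,S,S,E], [E]]"
definition "curve_9_33 = [[E,S], [S,W,N], [N], [N,W], [W], [W,N,N,E,E], [E,E,E,S], [S,S,S,W], [W], [W,N],
[N], [N], [N], [N,E,E,E,E,S,S,W], [W,W,W], [W,S], [S,E], [E]]"
definition "curve_9_34 = [[E,E,S,S,S,W,W,N], [N], [N], [N,W,W], [W], [W,S,S,S,E,E], [E], [E], [E,N,W], [W],
[W], [W,N,N], [N,E,S], [S,S], [S], [S,E,N], [N], [N,E]]"
definition "curve_9_35 = [[E,E,S,S,S,W,W,N], [N], [N], [N,N,W,W,W,S], [S], [S], [S,E,E], [E], [E,N,W], [W],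
[W,W], [W,N], [N,E], [E,S,W], [W], [W,S,S,S,E,E,E,E,N], [N], [N,E]]"
definition "curve_9_36 = [[E], [E,S], [S,W,W,N,N], [N], [N], [N,E,S], [S], [S], [S,E], [E], [E,N,N,W], [W,W],
[W], [W,N,E], [E], [E,E,S], [S,S], [S,S,W,W,W,W,N,N,N,E]]"
definition "curve_9_37 = [[E], [E,S,W], [W,N], [N], [N], [N,E,S], [S], [S], [S], [S,W,W,N,N], [N], [N,E],
[E], [E,S,W], [W], [W], [W,S,E], [E]]"
definition "curve_9_38 = [[E,E,N,N,N,W,W,S], [S], [S], [S,S,S,W,W], [W,N], [N], [N], [N,N,E,E,E], [E,S,W],
[W,S], [S,S,W], [W], [W,N,E], [E,S], [S], [S,W,W,W,N,N,N,N,E,E], [E,E], [E]]"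
definition "curve_9_39 = [[E,E,E,S,S,W], [W], [W,N,N], [N,N,W,W,W,S,S], [S], [S,S,E,E], [E,E], [E,N],
[N,W,S], [S], [S,W,W,N], [N,N,N], [N,W,S], [S,W], [W,N,E], [E], [E], [E]]"
definition "curve_9_40 = [[E,S], [S,W,N], [N], [N], [N,E], [E,N,W], [W,W], [W,N,N,E,E,E,E,E,S,S,S,S,S,S,W,W],
[W], [W,N], [N], [N,N], [N,E,E,S], [S], [S,W], [W], [W,S,E], [E]]"
definition "curve_9_41 = [[E,E,S,S,W], [W,N], [N], [N,W,S], [S], [S,S], [S], [S,E,E,N,N,N], [N,W], [W], [W],
[W,S,S,E], [E], [E,S,W], [W,N], [N,N], [N,E], [E]]"
definition "curve_9_42 = [[E,E], [E], [E,N,N,W,W,W,W,S,S], [S], [S,S,S,E,E,N], [N], [N], [N], [N,E,S], [S],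
[S], [S,W], [W,N,E], [E], [E,N,W], [W], [W,W], [W,N,E]]"
definition "curve_9_43 = [[E,S], [S,W,N], [N], [N,W,W,W,S,S], [S], [S,W,N], [N,E], [E,E], [E], [E],
[E,S,S,S,W,W,W], [W], [W,W,W,N,N,E], [E], [E,S,S], [S,E,N], [N,N,N], [N,E]]"
definition "curve_9_44 = [[E], [E,S,W], [W,N], [N], [N,N,N,W,W,S], [S], [S,E,E], [E], [E,E,S,S,S,W,W,N], [N],
[N], [N,N,N,N,W,W,W,W,W,S,S,S], [S,E,N], [N,E], [E,S,W], [W], [W], [W,S,S,E,E,E,E,E]]"
definition "curve_9_45 = [[E], [E,N,W], [W,S], [S,E], [E,E], [E,S], [S,W,N], [N], [N,N,N,W,W,S], [S], [S],
[S,S,S], [S,E,N], [N,N,E], [E], [E,S,S,W,W,W], [W], [W,W,N,N,N,N,E]]"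
definition "curve_9_46 = [[E], [E,S,W], [W,N], [N,E], [E,N,W], [W,W], [W,S,S], [S], [S,E,E,E,N], [N], [N],
[N], [N,W,W,S], [S,S], [S,W], [W,N,E], [E], [E]]"
definition "curve_9_47 = [[E,N], [N,W,S], [S], [S,E,E,N,N], [N,N], [N,W,W,W], [W], [W,S,S,S,E,E], [E], [E],
[E], [E,N,N,W], [W,W,W], [W,N], [N,E,S], [S], [S,S], [S,E]]"
definition "curve_9_48 = [[E,N,N], [N,W,S], [S,S], [S,S], [S,W,W,N], [N], [N], [N], [N,E,E], [E],
[E,S,S,S,S,W,W], [W,W], [W,W,N,N,N,E,E], [E,S], [S,W], [W,N,E], [E], [E]]"
definition "curve_9_49 = [[E], [E,S,W], [W,N], [N], [N,W,W], [W], [W,S,S,S,S,E,E], [E], [E,E,N], [N], [N,W],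
[W,W], [W,N], [N,E,S], [S], [S,S,S], [S,E,N], [N,N,E]]"
definition "curve_9_50 = [[E], [E,S,W], [W,N], [N], [N,N,N,W,W,S], [S], [S], [S], [S,S,E,E,E,N], [N], [N,W],
[W,W], [W,N], [N,E], [E,S,W], [W], [W,S,S,E,E], [E,E]]"
definition "curve_9_51 = [[E], [E,S,W], [W,N], [N], [N,W,W,W,W,W,S,S,S,S,E,E,N], [N], [N,E,S], [S],
[S,E,E,E,N], [N], [N,W], [W,S], [S,W], [W], [W,N,E], [E], [E], [E]]"
definition "curve_9_52 = [[E], [E,S,W], [W,N], [N], [N], [N], [N,E,E,E,S], [S], [S,S,S,S,W,W,N], [N], [N,W],
[W], [W,N,N,E,E], [E,E,E], [E,S,W], [W,W,W], [W,S], [S,E]]"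
definition "curve_9_53 = [[E], [E,S,W], [W,N], [N], [N,W,W], [W], [W,S,S,S,S,E], [E,E], [E,E,N], [N], [N,W],
[W,S], [S,S], [S,W,W,N], [N,N,N,N], [N,E,S], [S,S,E], [E]]"
definition "curve_9_54 = [[E,S], [S,W,N], [N], [N,W], [W,W], [W,S,S,E], [E], [E], [E], [E],
[E,S,S,W,W,W,W,W,N,N], [N,N], [N,E,E,S], [S], [S], [S,W,N], [N,E], [E]]"
definition "curve_9_55 = [[E,N], [N,W,S], [S], [S,E,E], [E], [E,N,N,N,N,W,W], [W,W,W], [W,S,S,E], [E], [E],
[E], [E,S,S], [S,W,N], [N,N], [N,N], [N,W,W,W,S], [S,S], [S,E]]"
definition "curve_9_56 = [[E], [E,N,W], [W,S], [S], [S,W,N], [N], [N,N], [N,E,E,S], [S], [S], [S],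
[S,S,W,W,W,N,N,E], [E], [E], [E,E,N,N,N,W,W], [W,W], [W,S,S,E], [E]]"
definition "curve_9_57 = [[E,N], [N,W,S], [S], [S], [S], [S], [S,W,W,N,N], [N,N], [N,E,E], [E],
[E,S,S,S,S,W,W], [W,N], [N,E], [E,S,W], [W], [W], [W,N,N,E], [E,E]]"
definition "curve_9_58 = [[E,N], [N,W,S], [S], [S,S,W,W], [W], [W,N,E], [E], [E,N], [N,E], [E],
[E,N,N,W,W,W,W,S,S,S], [S], [S], [S,W,N], [N], [N,E], [E], [E]]"
definition "curve_9_59 = [[E,N], [N,W,S], [S], [S], [S], [S,W,W,N], [N,N], [N,E], [E], [E],
[E,N,N,W,W,W,S,S], [S], [S,E], [E,S,W], [W,W], [W,N,N,E], [E], [E]]"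
definition "curve_9_60 = [[E,N], [N,W,S], [S], [S,W], [W,W], [W,S,E], [E,S,W], [W,W,N,N,N,N,E,E,E,E], [E],
[E], [E,N,N,W,W,W,S,S], [S], [S], [S,S,S,W,W,N], [N], [N], [N,E,E], [E]]"
definition "curve_9_61 = [[E,N], [N,W,S], [S], [S,E,E], [E], [E,S,W], [W], [W,W,W,N,N], [N,E], [E], [E],
[E,S,S], [S], [S,W,N], [N], [N,N], [N,N,W,W,W,W,S,S,S,E], [E]]"
definition "curve_9_62 = [[E,N], [N,W,S], [S], [S], [S,W], [W], [W,N,N,N,E], [E], [E], [E], [E],
[E,N,N,N,W,W,W,W,W,S,S,S], [S,S,S], [S,E,N], [N,E], [E,E,N,N], [N,N,W,W,W,S,S], [S,E]]"
definition "curve_9_63 = [[E], [E,S,W], [W,N], [N], [N,E], [E,E,E], [E,S,S,S,S,W], [W], [W,W,N], [N], [N],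
[N], [N,E,E,E,S], [S,S,S,S], [S,W,N], [N,N,N,W,W], [W], [W,S,E]]"
definition "curve_9_64 = [[E], [E,S,W], [W,N], [N,W,S], [S,S], [S], [S,E,E,N], [N], [N], [N],
[N,N,W,W,W,S,S], [S,S,E], [E,E], [E,S,W], [W,W], [W,W,N,N,N,E], [E], [E]]"
definition "curve_9_65 = [[E,E], [E,S,W], [W,W,N], [N], [N,N,N,N,E,E,E,S], [S,W], [W,S,E], [E,E],
[E,S,S,S,S,W,W,W,N], [N], [N], [N], [N], [N,E], [E,S,S], [S,W,W], [W,W], [W,S,E]]"
definition "curve_9_66 = [[E,E], [E,S,W], [W,W,N], [N,N,N], [N,E], [E], [E,E,S,S], [S], [S,S,S,W,W,N], [N],
[N,E,E], [E,N,W], [W,W,W,N], [N], [N,E,S], [S,W], [W], [W,S,S,S,E]]"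
definition "curve_9_67 = [[E,E,N,N,N,W,W,S], [S], [S], [S,S,W,W], [W], [W], [W,S,S,E,E,E,N,N], [N], [N],
[N,N,E,E], [E,S,W], [W,S], [S,W], [W,S], [S,W,N], [N,N,E,E], [E], [E]]"
definition "curve_9_68 = [[E,E,N,N,N,W,W,S], [S], [S], [S,W], [W], [W], [W,S,S,E,E,E,N,N], [N], [N], [N,E],
[E,S,W], [W], [W,S], [S], [S,W,N], [N,E], [E], [E]]"
definition "curve_9_69 = [[E,N], [N,W,S], [S], [S], [S], [S,W], [W,N], [N,E], [E], [E,E,N,N,W], [W],
[W,W,W,S,S,S,E], [E], [E], [E,S,S,W,W,N], [N], [N], [N,E]]"
definition "curve_9_70 = [[E,N], [N,W,S], [S], [S], [S,W], [W], [W,N,E], [E], [E], [E,E,N,N,W], [W], [W,S],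
[S], [S], [S,W,N], [N], [N,E], [E]]"
definition "curve_9_71 = [[E,E,N,N,W], [W,S], [S], [S,E,E,E,N,N,N,N,W,W], [W,W], [W], [W,N,E], [E], [E,E,S],
[S], [S,W], [W], [W,N,N], [N], [N,E,S], [S], [S,S], [S,E]]"
definition "curve_9_72 = [[E,N], [N,W,S], [S], [S,S], [S,S,W,W,W,W,W,N,N,N,N,N,E,E,E,S], [S,W], [W,S,E],
[E,E], [E], [E,E,N,N,N,W], [W], [W,S], [S,S], [S,W,W,N], [N], [N,E], [E], [E]]"
definition "curve_9_73 = [[E,E], [E], [E,N,N,W,W,W,W,S,S], [S], [S], [S], [S], [S,E,E,N], [N,N,N], [N],
[N,E,S], [S,W], [W,W], [W,S,E], [E,S,W], [W,S,E], [E,E], [E,S,S,W,W,W,W,W,N,N,N,N,N,N,E,E]]"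
definition "curve_9_74 = [[E], [E], [E,N,N,W,W,W,S,S], [S], [S], [S], [S,E,N], [N], [N], [N], [N,E,S], [S,W],
[W], [W,S,E], [E], [E,S,W], [W], [W,W,N,N,N,E,E]]"
definition "curve_9_75 = [[E,E,N,N,N,W,W,S], [S], [S], [S,S], [S,S,W,W,W,N,N], [N,E,S], [S,E,N], [N,N], [N],
[N,E], [E,S,W], [W], [W,N,N,N,E,E,E,E,E,S,S,S,S,S,S,W,W,W], [W], [W], [W], [W,N,N,E,E,E], [E]]"
definition "curve_9_76 = [[E,E,N,N,W], [W,S], [S], [S], [S,W,N], [N], [N], [N,N], [N,E,E,S], [S], [S,W], [W],
[W,N,N,E], [E,E], [E,E,S,S,S,S,W,W,W], [W], [W,N,E], [E]]"
definition "curve_9_77 = [[E,E,N,N,N,W,W,S], [S], [S], [S,S,S,S,W,W,N], [N], [N,W,S], [S], [S,W,W,N],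
[N,N,N,N], [N,E,E,E,E,E], [E,S,W], [W,W,W,W,W], [W,S,S,S,S,E], [E,E], [E], [E,N,W], [W], [W,N,N,E,E,E,E]]"
definition "curve_9_78 = [[E,N], [N,W,S], [S], [S], [S,W,W,N,N,N], [N,W], [W,N,E], [E,E,E,E,E], [E,S,S,W],
[W], [W], [W,W], [W,N], [N], [N,E,E,E,E,E,S], [S,S], [S,S,W,W], [W,N,E]]"
definition "curve_9_79 = [[E,E,N,N,W], [W,S], [S], [S,W,N], [N], [N,W,S], [S], [S,W,N], [N], [N,N,E,E,E,E,S],
[S,W], [W], [W], [W], [W,S,E], [E], [E], [E]]"
definition "curve_9_80 = [[E,N], [N,W,S], [S], [S], [S,S], [S,S,E,E,E,E,N,N], [N,W,S], [S,W,N], [N,N],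
[N,N,W], [W], [W,W,S,S,S,S,E,E], [E,E], [E], [E], [E,N,N,W,W,W], [W,W], [W,N,E]]"
definition "curve_9_81 = [[E,E,N,N,N,W,W,S], [S], [S], [S,W], [W], [W,S,E], [E],
[E,E,E,E,N,N,N,N,N,N,W,W,W,W,W,W,S,S,E], [E], [E], [E,S,W], [W,N], [N,W,S], [S,S,S], [S], [S,E,N], [N],
[N,E]]"
definition "curve_9_82 = [[E,N], [N,W,S], [S], [S,W], [W,S], [S,W,N], [N,N,N], [N,W,S], [S,S,S],
[S,S,E,E,E,E,E,E,N,N,N,N,N,W], [W], [W,W,W], [W], [W,S,S,S,E], [E], [E], [E,N], [N,E]]"
definition "curve_9_83 = [[E,E,N], [N], [N,W,W,S,S,S], [S,W,N], [N,N,N,N], [N,E,E,E,E,E,E,S], [S,S], [S,W,N],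
[N,W,S], [S,W], [W,N,E], [E], [E], [E], [E,N,N,W], [W,W,W,W,W,W], [W,S,S,S,S,E], [E]]"
definition "curve_9_84 = [[E,S,W], [W], [W], [W,W,N,N,N,N,E,E,E,E,S,S], [S], [S], [S,W,N], [N], [N], [N,W,S],
[S], [S], [S,S,E,E,E,E,N,N,N,N,W,W], [W], [W], [W,S,E], [E], [E]]"
definition "curve_9_85 = [[E,S,W], [W,W], [W], [W,N], [N,N,E,E,E,E,S,S], [S], [S,S,S,W,W,N], [N], [N], [N],
[N,W,S], [S], [S,E], [E,S,W], [W,W,W,N,N,N,E], [E], [E], [E,E]]"
definition "curve_9_86 = [[E,N,N,N,W,W,W,W,W,W,S,S,S,S,E], [E], [E], [E], [E,N], [N,N,W,W,W,W,S,S,S], [S,E],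
[E], [E,N], [N], [N,W,S], [S], [S], [S,W,N], [N], [N,E], [E], [E]]"
definition "curve_9_87 = [[E], [E], [E,S,W], [W], [W,N], [N], [N,E,S], [S], [S], [S], [S,E,N], [N], [N],
[N,W], [W], [W,W,S,S,S,S,S,E,E,E,E,E,N,N,W], [W], [W,W,N,N,E]]"
definition "curve_9_88 = [[E,N,N,N,N,W,W,W,S], [S,S], [S], [S], [S,E,E,N,N], [N,W], [W], [W], [W],
[W,N,N,E,E,E], [E,S,S], [S], [S,W], [W,W,N,N], [N,E,S], [S,E], [E], [E]]"
definition "curve_9_89 = [[E,N,N,W,W], [W,W,W], [W,S,S,S,S,E,E], [E,E], [E,N,N], [N,W], [W,S], [S,W],
[W,N,N,N], [N,E,E,E,S], [S], [S], [S,S], [S,W,W,N], [N], [N,E], [E], [E]]"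
definition "curve_9_90 = [[E], [E,N], [N,E,S], [S,S], [S,E,E,N,N,N,N,N,W,W,W,W,W,S,S,S], [S], [S], [S,E,N],
[N], [N], [N,E], [E], [E,S,S,W], [W,W], [W], [W,S,E], [E], [E,S,S,W,W,W,W,N,N,N,N,E,E]]"
definition "curve_9_91 = [[E], [E,N], [N], [N,W,W,S], [S,S], [S], [S], [S,E,N], [N], [N], [N,E], [E,N,W],
[W,W], [W,W,S,S,S,S,E,E], [E], [E,N,W], [W], [W,N,E]]"
definition "curve_9_92 = [[E], [E,N], [N], [N,W,W,S], [S,S], [S,W,N], [N,W,S], [S,W,N], [N,N],
[N,W,W,S,S,S,S,S,E,E,E,E,E,E,N,N], [N,E], [E,N,W], [W,W], [W,W,W], [W,S,S,E], [E], [E], [E]]"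
definition "curve_9_93 = [[E], [E], [E,N,W], [W], [W,S], [S], [S], [S,E,N], [N], [N], [N], [N,E,S], [S],
[S,W], [W], [W,S,E], [E], [E,S,S,W,W,W,W,N,N,N,N,E,E]]"
definition "curve_9_94 = [[E], [E,E], [E,N,W], [W,W], [W,S], [S], [S], [S,E,N], [N], [N], [N], [N,E,E,S],
[S], [S,S,S,S,W,W,W,W,N,N,E], [E], [E,N,W], [W], [W,N,E]]"
definition "curve_9_95 = [[E,N], [N], [N,W,S], [S], [S], [S,W], [W,S,E], [E,E,E], [E,N,N,N,W], [W], [W],
[W,N,E], [E], [E,S], [S,S,S], [S,W,W,W,N], [N], [N,E]]"
definition "curve_9_96 = [[E,N,N,N,W,W,W,W,S,S], [S], [S], [S,E,E], [E,N,N], [N,N,W,W,S], [S], [S,W], [W,N],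
[N,E], [E], [E,S], [S,S], [S,W,W,W,W,N,N,N,E], [E], [E], [E], [E]]"
definition "curve_9_97 = [[E], [E], [E,S], [S,E,N], [N,E,S], [S,S], [S,E,E,N,N,N,N,N,N,W,W,W,W,W,W,W,S,S],
[S,S,S], [S,E,N], [N,N,N], [N,E,S], [S,E], [E], [E], [E,S,S,W], [W,W,W,W], [W], [W,N,N,N,E]]"
definition "curve_9_98 = [[E], [E,N], [N,E,S], [S,S], [S,E,N], [N,N], [N,N,W,W,W,W,S,S,S], [S], [S,E,N], [N],
[N,E], [E], [E], [E,S,S,W], [W], [W,W], [W], [W,N,E]]"
definition "curve_9_99 = [[E,E,S,S,S,S,S,S,W,W], [W], [W,W,W,N,N], [N,E,S], [S,E,N], [N,N], [N,N,N,E,E,S],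
[S], [S], [S,S,S,S], [S,W,N], [N,N,W], [W], [W], [W,N,N,E,E,E], [E,E], [E,N,W], [W,N,E]]"
definition "curve_9_100 = [[E,N,N], [N,N], [N,W,W,W,S], [S,S], [S,E,N], [N,E,S], [S,S], [S,W,W,W,N], [N,N],
[N,N,E], [E,E,E], [E,S,S,W], [W], [W], [W], [W], [W,S,S,E], [E,E,E]]"
definition "curve_9_101 = [[E,N,N,W], [W,W,W,W], [W,S,S,S,S,S,S,E], [E,E,E], [E,N,W], [W,N], [N,N], [N,E,S],
[S,E,N], [N,N], [N,W,W,W,W,S], [S,S,S,S,S,S], [S,E,E,E,N], [N], [N,W], [W,N,N,E], [E], [E]]"
lemmas curve_defs_1 =
  curve_1_1_def
lemmas curve_defs_3 =
  curve_3_1_def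
lemmas curve_defs_4 =
  curve_4_1_def
lemmas curve_defs_5 =
  curve_5_1_def curve_5_2_def
lemmas curve_defs_6 =
  curve_6_1_def curve_6_2_def curve_6_3_def
lemmas curve_defs_7 =
  curve_7_1_def curve_7_2_def curve_7_3_def curve_7_4_def curve_7_5_def curve_7_6_def curve_7_7_def
  curve_7_8_def curve_7_9_def curve_7_10_def
lemmas curve_defs_8 =
  curve_8_1_def curve_8_2_def curve_8_3_def curve_8_4_def curve_8_5_def curve_8_6_def curve_8_7_def
  curve_8_8_def curve_8_9_def curve_8_10_def curve_8_11_def curve_8_12_def curve_8_13_def curve_8_14_def
  curve_8_15_def curve_8_16_def curve_8_17_def curve_8_18_def curve_8_19_def curve_8_20_def curve_8_21_def
  curve_8_22_def curve_8_23_def curve_8_24_def curve_8_25_def curve_8_26_def curve_8_27_def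
lemmas curve_defs_9 =
  curve_9_1_def curve_9_2_def curve_9_3_def curve_9_4_def curve_9_5_def curve_9_6_def curve_9_7_def
  curve_9_8_def curve_9_9_def curve_9_10_def curve_9_11_def curve_9_12_def curve_9_13_def curve_9_14_def
  curve_9_15_def curve_9_16_def curve_9_17_def curve_9_18_def curve_9_19_def curve_9_20_def curve_9_21_def
  curve_9_22_def curve_9_23_def curve_9_24_def curve_9_25_def curve_9_26_def curve_9_27_def curve_9_28_def
  curve_9_29_def curve_9_30_def curve_9_31_def curve_9_32_def curve_9_33_def curve_9_34_def curve_9_35_def
  curve_9_36_def curve_9_37_def curve_9_38_def curve_9_39_def curve_9_40_def curve_9_41_def curve_9_42_def
  curve_9_43_def curve_9_44_def curve_9_45_def curve_9_46_def curve_9_47_def curve_9_48_def curve_9_49_def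
  curve_9_50_def curve_9_51_def curve_9_52_def curve_9_53_def curve_9_54_def curve_9_55_def curve_9_56_def
  curve_9_57_def curve_9_58_def curve_9_59_def curve_9_60_def curve_9_61_def curve_9_62_def curve_9_63_def
  curve_9_64_def curve_9_65_def curve_9_66_def curve_9_67_def curve_9_68_def curve_9_69_def curve_9_70_def
  curve_9_71_def curve_9_72_def curve_9_73_def curve_9_74_def curve_9_75_def curve_9_76_def curve_9_77_def
  curve_9_78_def curve_9_79_def curve_9_80_def curve_9_81_def curve_9_82_def curve_9_83_def curve_9_84_def
  curve_9_85_def curve_9_86_def curve_9_87_def curve_9_88_def curve_9_89_def curve_9_90_def curve_9_91_def
  curve_9_92_def curve_9_93_def curve_9_94_def curve_9_95_def curve_9_96_def curve_9_97_def curve_9_98_def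
  curve_9_99_def curve_9_100_def curve_9_101_def
text \<open>The verdicts follow the order in which the search finds the diagrams. A walk is adapted to the base point
and the direction of a diagram by \<open>rot\<close> and \<open>backwards\<close>.\<close>

lemma verdicts_1_1: "list_all2 verified (search 1 1)
  [Drawn curve_1_1]"
proof -
  have "search 1 1 = complete 1 1 [1] [] [] [(0, 1)]"
    by (rule search_eq; code_simp)
  then show ?thesis
    by (simp only: eval_rules verdict_rules curve_defs_1 list_all2_Cons list_all2_Nil)
qed

lemma verdicts_3_3: "list_all2 verified (search 3 3)
  [Drawn curve_3_1]"
proof -
  have "search 3 3 = complete 3 3 [1, 2, 3, 4, 5] [1, 5] [2, 4] [(0, 3)]"
    by (rule search_eq; code_simp)
  then show ?thesis
    by (simp only: eval_rules verdict_rules curve_defs_3 list_all2_Cons list_all2_Nil)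
qed

lemma verdicts_4_3: "list_all2 verified (search 4 3)
  [Drawn curve_4_1]"
proof -
  have "search 4 3 = complete 3 5 [1, 2, 3, 4, 5, 6, 7] [1, 5, 7] [2, 4, 6] [(0, 3)]"
    by (rule search_eq; code_simp)
  then show ?thesis
    by (simp only: eval_rules verdict_rules curve_defs_4 list_all2_Cons list_all2_Nil)
qed

lemma verdicts_5_3: "list_all2 verified (search 5 3)
  [Drawn curve_5_1]"
proof -
  have "search 5 3 = complete 3 7 [1, 2, 3, 4, 5, 6, 7, 8, 9] [1, 5, 7, 9] [2, 4, 6, 8] [(0, 3)]"
    by (rule search_eq; code_simp)
  then show ?thesis
    by (simp only: eval_rules verdict_rules curve_defs_5 list_all2_Cons list_all2_Nil)
qed

lemma verdicts_5_5: "list_all2 verified (search 5 5)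
  [Drawn curve_5_2]"
proof -
  have "search 5 5 = complete 5 5 [1, 2, 3, 4, 5, 6, 7, 8, 9] [1, 3, 7, 9] [2, 4, 6, 8] [(0, 5)]"
    by (rule search_eq; code_simp)
  then show ?thesis
    by (simp only: eval_rules verdict_rules curve_defs_5 list_all2_Cons list_all2_Nil)
qed

lemma verdicts_6_3: "list_all2 verified (search 6 3)
  [Split 0 5, Split 5 10, Drawn curve_6_1, Drawn curve_6_2, Drawn curve_6_3, Drawn (rot 8 curve_6_1), Split 4
  9]"
proof -
  have "search 6 3 = complete 3 9 [1, 2, 3, 4, 5, 6, 7, 8, 9, 10, 11] [1, 5, 7, 9, 11] [2, 4, 6, 8, 10] [(0, 3)]"
    by (rule search_eq; code_simp)
  then show ?thesis
    by (simp only: eval_rules verdict_rules curve_defs_6 list_all2_Cons list_all2_Nil)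
qed

lemma verdicts_6_5: "list_all2 verified (search 6 5)
  [Odd_triple (0, 5) (1, 8) (3, 10)]"
proof -
  have "search 6 5 = complete 5 7 [1, 2, 3, 4, 5, 6, 7, 8, 9, 10, 11] [1, 3, 7, 9, 11] [2, 4, 6, 8, 10] [(0, 5)]"
    by (rule search_eq; code_simp)
  then show ?thesis
    by (simp only: eval_rules verdict_rules curve_defs_6 list_all2_Cons list_all2_Nil)
qed

lemma verdicts_7_3: "list_all2 verified (search 7 3)
  [Split 0 5, Split 0 5, Split 0 5, Split 5 12, Split 5 12, Split 6 11, Split 8 13, Split 7 12, Drawn
  curve_7_1, Drawn curve_7_2, Drawn curve_7_3, Drawn curve_7_4, Drawn (rot 2 (backwards curve_7_1)), Drawn
  (rot 10 curve_7_4), Odd_triple (1, 8) (4, 11) (6, 13), Drawn curve_7_5, Drawn curve_7_6, Drawn curve_7_7,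
  Drawn (rot 10 curve_7_2), Drawn (rot 6 curve_7_4), Drawn (rot 9 curve_7_3), Drawn (rot 9 curve_7_1), Drawn
  (rot 11 (backwards curve_7_1)), Split 6 11, Split 4 9, Split 5 10, Split 4 11, Split 4 11, Split 5 10]"
proof -
  have "search 7 3 = complete 3 11 [1, 2, 3, 4, 5, 6, 7, 8, 9, 10, 11, 12, 13] [1, 5, 7, 9, 11, 13] [2, 4, 6, 8, 10, 12] [(0, 3)]"
    by (rule search_eq; code_simp)
  then show ?thesis
    by (simp only: eval_rules verdict_rules curve_defs_7 list_all2_Cons list_all2_Nil)
qed

lemma verdicts_7_5: "list_all2 verified (search 7 5)
  [Drawn curve_7_8, Drawn curve_7_9, Drawn (rot 4 curve_7_9)]"
proof -
  have "search 7 5 = complete 5 9 [1, 2, 3, 4, 5, 6, 7, 8, 9, 10, 11, 12, 13] [1, 3, 7, 9, 11, 13] [2, 4, 6, 8, 10, 12] [(0, 5)]"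
    by (rule search_eq; code_simp)
  then show ?thesis
    by (simp only: eval_rules verdict_rules curve_defs_7 list_all2_Cons list_all2_Nil)
qed

lemma verdicts_7_7: "list_all2 verified (search 7 7)
  [Drawn curve_7_10]"
proof -
  have "search 7 7 = complete 7 7 [1, 2, 3, 4, 5, 6, 7, 8, 9, 10, 11, 12, 13] [1, 3, 5, 9, 11, 13] [2, 4, 6, 8, 10, 12] [(0, 7)]"
    by (rule search_eq; code_simp)
  then show ?thesis
    by (simp only: eval_rules verdict_rules curve_defs_7 list_all2_Cons list_all2_Nil)
qed

lemma verdicts_8_3: "list_all2 verified (search 8 3)
  [Split 0 5, Split 0 5, Split 0 5, Split 0 5, Split 0 5, Split 0 5, Split 0 5, Split 0 5, Split 0 5, Split 5
  14, Split 5 14, Split 5 14, Split 5 14, Split 5 14, Split 5 14, Split 6 13, Split 6 13, Split 7 12, Split 0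
  7, Split 0 7, Split 9 14, Split 7 14, Split 7 14, Split 8 13, Split 10 15, Drawn curve_8_1, Drawn
  curve_8_2, Drawn curve_8_3, Drawn curve_8_4, Split 9 14, Split 8 13, Split 7 12, Drawn curve_8_5, Drawn
  curve_8_6, Drawn curve_8_7, Drawn curve_8_8, Drawn curve_8_9, Odd_triple (1, 8) (4, 11) (6, 13), Drawn
  curve_8_10, Odd_triple (1, 8) (4, 11) (6, 15), Drawn curve_8_11, Drawn curve_8_12, Drawn curve_8_13, Drawn
  (rot 6 (backwards curve_8_11)), Drawn (rot 4 curve_8_9), Drawn (rot 2 (backwards curve_8_5)), Drawn (rot 3
  (backwards curve_8_6)), Drawn (rot 2 (backwards curve_8_9)), Drawn (rot 3 (backwards curve_8_3)), Drawn
  (rot 12 curve_8_11), Drawn curve_8_14, Drawn (rot 1 (backwards curve_8_11)), Drawn curve_8_15, Drawn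
  curve_8_16, Drawn curve_8_17, Drawn (rot 13 (backwards curve_8_16)), Odd_triple (1, 10) (4, 13) (6, 15),
  Drawn curve_8_18, Drawn (rot 11 curve_8_7), Odd_triple (1, 10) (5, 12) (7, 14), Drawn (rot 8 curve_8_18),
  Drawn curve_8_19, Drawn curve_8_20, Odd_triple (1, 10) (5, 12) (8, 15), Drawn (rot 13 (backwards
  curve_8_11)), Drawn (rot 9 (backwards curve_8_9)), Drawn (rot 13 (backwards curve_8_9)), Drawn (rot 13
  (backwards curve_8_10)), Drawn (rot 13 (backwards curve_8_13)), Drawn (rot 13 (backwards curve_8_12)),
  Drawn (rot 7 curve_8_11), Odd_triple (1, 10) (4, 13) (7, 14), Drawn (rot 11 curve_8_5), Drawn (rot 11
  curve_8_9), Drawn (rot 10 curve_8_6), Drawn (rot 10 curve_8_3), Drawn (rot 13 (backwards curve_8_5)), Drawn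
  (rot 6 curve_8_7), Drawn (rot 13 (backwards curve_8_6)), Drawn (rot 10 curve_8_8), Split 4 9, Drawn (rot 12
  curve_8_1), Drawn (rot 13 (backwards curve_8_2)), Drawn (rot 5 (backwards curve_8_4)), Drawn (rot 13
  (backwards curve_8_3)), Split 5 10, Split 6 11, Split 6 13, Split 6 13, Split 7 12, Split 4 11, Split 4 11,
  Split 5 10, Split 5 12, Split 5 12, Split 6 11, Split 4 13, Split 4 13, Split 4 13, Split 4 13, Split 4 13,
  Split 4 13, Split 5 12, Split 5 12, Split 6 11]"
proof -
  have "search 8 3 = complete 3 13 [1, 2, 3, 4, 5, 6, 7, 8, 9, 10, 11, 12, 13, 14, 15] [1, 5, 7, 9, 11, 13, 15] [2, 4, 6, 8, 10, 12, 14] [(0, 3)]"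
    by (rule search_eq; code_simp)
  then show ?thesis
    by (simp only: eval_rules verdict_rules curve_defs_8 list_all2_Cons list_all2_Nil)
qed

lemma verdicts_8_5: "list_all2 verified (search 8 5)
  [Drawn curve_8_21, Drawn curve_8_22, Drawn (rot 7 curve_8_22), Drawn (rot 1 curve_8_21), Drawn curve_8_23,
  Drawn (rot 7 curve_8_23), Odd_triple (1, 8) (3, 12) (6, 13), Odd_triple (0, 5) (1, 8) (3, 12), Odd_triple
  (1, 8) (2, 11) (6, 13), Drawn (rot 1 curve_8_22), Drawn (rot 10 curve_8_23), Drawn (rot 8 curve_8_22),
  Odd_triple (0, 5) (1, 10) (3, 12), Odd_triple (0, 5) (1, 10) (3, 12), Odd_triple (1, 10) (3, 12) (7, 14),
  Drawn (rot 2 curve_8_21), Drawn curve_8_24, Drawn curve_8_25, Drawn (rot 1 curve_8_23), Drawn (rot 10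
  curve_8_22), Drawn (rot 14 curve_8_22), Drawn (rot 14 curve_8_23), Drawn (rot 8 curve_8_23), Drawn
  curve_8_26, Drawn (rot 4 curve_8_24), Drawn (rot 8 curve_8_25), Odd_triple (2, 9) (4, 13) (7, 14), Drawn
  (rot 4 curve_8_25), Drawn curve_8_27, Drawn (rot 4 curve_8_23)]"
proof -
  have "search 8 5 = complete 5 11 [1, 2, 3, 4, 5, 6, 7, 8, 9, 10, 11, 12, 13, 14, 15] [1, 3, 7, 9, 11, 13, 15] [2, 4, 6, 8, 10, 12, 14] [(0, 5)]"
    by (rule search_eq; code_simp)
  then show ?thesis
    by (simp only: eval_rules verdict_rules curve_defs_8 list_all2_Cons list_all2_Nil)
qed

lemma verdicts_8_7: "list_all2 verified (search 8 7)
  [Odd_triple (0, 7) (1, 10) (3, 12)]"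
proof -
  have "search 8 7 = complete 7 9 [1, 2, 3, 4, 5, 6, 7, 8, 9, 10, 11, 12, 13, 14, 15] [1, 3, 5, 9, 11, 13, 15] [2, 4, 6, 8, 10, 12, 14] [(0, 7)]"
    by (rule search_eq; code_simp)
  then show ?thesis
    by (simp only: eval_rules verdict_rules curve_defs_8 list_all2_Cons list_all2_Nil)
qed

lemma verdicts_9_3: "list_all2 verified (search 9 3)
  [Split 0 5, Split 0 5, Split 0 5, Split 0 5, Split 0 5, Split 0 5, Split 0 5, Split 0 5, Split 0 5, Split 0
  5, Split 0 5, Split 0 5, Split 0 5, Split 0 5, Split 0 5, Split 0 5, Split 0 5, Split 0 5, Split 0 5, Split
  0 5, Split 0 5, Split 0 5, Split 0 5, Split 0 5, Split 0 5, Split 0 5, Split 0 5, Split 0 5, Split 0 5,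
  Split 0 5, Split 0 5, Split 0 5, Split 0 5, Split 0 5, Split 0 5, Split 0 5, Split 0 5, Split 0 5, Split 0
  5, Split 0 5, Split 0 5, Split 0 5, Split 0 5, Split 0 5, Split 0 5, Split 0 5, Split 0 5, Split 5 10,
  Split 5 10, Split 10 15, Split 5 16, Split 5 16, Split 5 16, Split 5 16, Split 9 14, Split 5 16, Split 5
  16, Split 5 16, Split 5 16, Split 5 16, Split 5 16, Split 5 16, Split 5 16, Split 5 16, Split 5 16, Split 5
  16, Split 5 16, Split 5 16, Split 5 16, Split 5 16, Split 5 16, Split 5 16, Split 5 16, Split 5 16, Split 5
  16, Split 5 16, Split 5 16, Split 5 16, Split 5 16, Split 6 11, Split 5 16, Split 5 16, Split 5 16, Split 5
  16, Split 7 12, Split 8 13, Split 6 15, Split 6 15, Split 6 15, Split 6 15, Split 6 15, Split 6 15, Split 7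
  14, Split 7 14, Split 8 13, Split 0 7, Split 0 7, Split 0 7, Split 0 7, Split 0 7, Split 0 7, Split 0 7,
  Split 0 7, Split 10 15, Split 7 16, Split 7 16, Split 7 16, Split 7 16, Split 7 16, Split 7 16, Split 8 15,
  Split 8 15, Split 9 14, Split 10 17, Split 10 17, Split 11 16, Split 12 17, Split 11 16, Split 10 15, Drawn
  curve_9_1, Drawn curve_9_2, Drawn curve_9_3, Drawn curve_9_4, Drawn curve_9_5, Drawn curve_9_6, Odd_triple
  (4, 13) (8, 15) (10, 17), Drawn curve_9_7, Drawn curve_9_8, Drawn curve_9_9, Drawn curve_9_10, Drawn
  curve_9_11, Drawn curve_9_12, Drawn curve_9_13, Drawn curve_9_14, Split 8 13, Split 9 14, Split 9 16, Split
  9 16, Split 10 15, Split 8 15, Split 8 15, Split 9 14, Split 7 12, Split 7 14, Split 7 14, Split 8 13,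
  Split 12 17, Split 11 16, Drawn (rot 1 (backwards curve_9_2)), Drawn curve_9_15, Drawn curve_9_16, Drawn
  (rot 8 curve_9_10), Split 10 15, Split 12 17, Drawn (rot 2 (backwards curve_9_3)), Drawn curve_9_17, Drawn
  curve_9_18, Drawn (rot 1 (backwards curve_9_6)), Drawn curve_9_19, Drawn curve_9_20, Drawn curve_9_21,
  Drawn curve_9_22, Drawn (rot 9 curve_9_12), Drawn curve_9_23, Drawn curve_9_24, Drawn (rot 8 curve_9_6),
  Split 9 14, Split 11 16, Drawn (rot 2 (backwards curve_9_1)), Drawn curve_9_25, Drawn curve_9_26, Drawn
  (rot 9 curve_9_14), Split 10 15, Split 9 14, Split 12 17, Split 11 16, Drawn (rot 1 (backwards curve_9_4)),
  Drawn curve_9_27, Drawn curve_9_28, Drawn (rot 8 curve_9_11), Split 10 15, Odd_triple (1, 8) (4, 11) (6,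
  15), Drawn curve_9_29, Odd_triple (1, 8) (4, 11) (6, 15), Drawn curve_9_30, Drawn curve_9_31, Drawn
  curve_9_32, Drawn curve_9_33, Odd_triple (1, 8) (4, 13) (6, 15), Drawn curve_9_34, Odd_triple (1, 8) (4,
  13) (6, 17), Drawn curve_9_35, Drawn curve_9_36, Drawn (rot 8 (backwards curve_9_31)), Drawn curve_9_37,
  Drawn curve_9_38, Drawn curve_9_39, Drawn curve_9_40, Drawn (rot 5 (backwards curve_9_4)), Drawn
  curve_9_41, Drawn curve_9_42, Drawn (rot 8 (backwards curve_9_39)), Drawn (rot 4 (backwards curve_9_26)),
  Split 9 14, Drawn curve_9_43, Drawn curve_9_44, Drawn curve_9_45, Drawn curve_9_46, Drawn curve_9_47, Drawn
  curve_9_48, Drawn (rot 2 (backwards curve_9_29)), Odd_triple (1, 10) (5, 14) (7, 16), Drawn curve_9_49,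
  Drawn curve_9_50, Drawn curve_9_51, Drawn curve_9_52, Drawn (rot 3 (backwards curve_9_30)), Drawn
  curve_9_53, Drawn curve_9_54, Odd_triple (1, 10) (4, 13) (6, 15), Odd_triple (1, 10) (4, 13) (6, 15), Drawn
  curve_9_55, Odd_triple (1, 10) (4, 13) (7, 14), Drawn curve_9_56, Odd_triple (1, 10) (4, 13) (7, 16), Drawn
  curve_9_57, Drawn curve_9_58, Drawn curve_9_59, Odd_triple (1, 10) (4, 13) (6, 17), Odd_triple (1, 10) (4,
  13) (6, 17), Odd_triple (1, 10) (4, 13) (7, 14), Drawn (rot 4 curve_9_43), Drawn curve_9_60, Drawn
  curve_9_61, Drawn (rot 4 (backwards curve_9_34)), Drawn curve_9_62, Drawn (rot 7 (backwards curve_9_60)),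
  Drawn (rot 5 curve_9_45), Drawn (rot 4 curve_9_27), Drawn (rot 4 curve_9_28), Drawn (rot 4 (backwards
  curve_9_7)), Drawn (rot 13 curve_9_39), Odd_triple (1, 10) (5, 12) (7, 14), Drawn curve_9_63, Odd_triple
  (1, 10) (5, 12) (7, 16), Drawn (rot 2 (backwards curve_9_45)), Drawn curve_9_64, Drawn curve_9_65, Drawn
  (rot 3 (backwards curve_9_43)), Drawn curve_9_66, Drawn (rot 3 (backwards curve_9_16)), Drawn (rot 4
  (backwards curve_9_20)), Drawn (rot 3 (backwards curve_9_28)), Drawn (rot 4 (backwards curve_9_9)), Split 4
  9, Odd_triple (1, 10) (5, 12) (8, 15), Drawn (rot 14 curve_9_48), Odd_triple (1, 10) (5, 14) (8, 17), Drawn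
  curve_9_67, Drawn curve_9_68, Drawn (rot 4 curve_9_44), Drawn (rot 3 (backwards curve_9_11)), Drawn (rot 13
  curve_9_66), Drawn (rot 1 (backwards curve_9_48)), Drawn (rot 2 (backwards curve_9_50)), Drawn (rot 4
  curve_9_67), Drawn (rot 2 (backwards curve_9_32)), Odd_triple (1, 10) (5, 14) (7, 16), Drawn (rot 3
  (backwards curve_9_57)), Drawn curve_9_69, Drawn curve_9_70, Drawn curve_9_71, Drawn (rot 3 (backwards
  curve_9_35)), Drawn curve_9_72, Drawn (rot 13 curve_9_50), Drawn (rot 4 curve_9_68), Drawn (rot 13
  curve_9_69), Odd_triple (1, 10) (4, 13) (7, 16), Odd_triple (1, 10) (4, 13) (6, 15), Odd_triple (1, 10) (4,
  13) (6, 15), Odd_triple (1, 10) (4, 13) (6, 17), Odd_triple (1, 10) (4, 13) (6, 17), Drawn (rot 12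
  curve_9_57), Odd_triple (1, 10) (4, 13) (7, 16), Odd_triple (1, 10) (4, 13) (8, 17), Drawn curve_9_73,
  Odd_triple (1, 10) (4, 13) (8, 15), Drawn curve_9_74, Drawn (rot 12 curve_9_35), Drawn curve_9_75, Drawn
  (rot 13 curve_9_32), Odd_triple (1, 10) (4, 15) (8, 17), Odd_triple (1, 10) (5, 12) (7, 16), Odd_triple (1,
  10) (4, 15) (8, 17), Drawn (rot 6 (backwards curve_9_74)), Odd_triple (1, 10) (4, 15) (6, 17), Drawn (rot
  12 curve_9_11), Drawn curve_9_76, Drawn curve_9_77, Drawn (rot 13 curve_9_31), Drawn (rot 13 curve_9_44),
  Drawn (rot 2 (backwards curve_9_31)), Drawn curve_9_78, Drawn curve_9_79, Drawn curve_9_80, Drawn (rot 15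
  (backwards curve_9_79)), Odd_triple (1, 10) (5, 14) (7, 16), Drawn curve_9_81, Drawn (rot 12 curve_9_22),
  Odd_triple (1, 10) (6, 13) (8, 15), Drawn (rot 9 curve_9_77), Drawn curve_9_82, Drawn curve_9_83, Split 4
  9, Drawn (rot 14 curve_9_46), Drawn (rot 14 curve_9_54), Drawn (rot 15 (backwards curve_9_48)), Odd_triple
  (1, 12) (5, 14) (8, 17), Drawn (rot 11 (backwards curve_9_43)), Drawn (rot 11 (backwards curve_9_27)),
  Drawn (rot 11 (backwards curve_9_28)), Drawn (rot 15 (backwards curve_9_45)), Drawn (rot 8 curve_9_44),
  Odd_triple (1, 12) (5, 14) (7, 16), Odd_triple (1, 12) (5, 14) (7, 16), Drawn (rot 15 (backwards
  curve_9_51)), Drawn (rot 8 curve_9_59), Drawn (rot 8 curve_9_60), Drawn (rot 15 (backwards curve_9_52)),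
  Odd_triple (1, 12) (6, 13) (8, 17), Drawn (rot 15 (backwards curve_9_53)), Drawn (rot 15 (backwards
  curve_9_60)), Drawn (rot 13 curve_9_47), Drawn (rot 15 (backwards curve_9_50)), Drawn (rot 15 (backwards
  curve_9_43)), Odd_triple (1, 12) (6, 15) (8, 17), Drawn (rot 15 (backwards curve_9_58)), Drawn (rot 15
  (backwards curve_9_61)), Drawn (rot 15 (backwards curve_9_62)), Drawn (rot 12 curve_9_49), Drawn (rot 15
  (backwards curve_9_57)), Drawn (rot 11 curve_9_55), Drawn (rot 11 curve_9_34), Drawn (rot 12 curve_9_30),
  Drawn (rot 13 curve_9_29), Drawn (rot 10 (backwards curve_9_45)), Odd_triple (1, 12) (6, 13) (8, 17),
  Odd_triple (1, 12) (4, 15) (7, 16), Odd_triple (1, 12) (4, 15) (7, 16), Drawn (rot 11 curve_9_56), Drawn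
  (rot 11 curve_9_7), Odd_triple (1, 12) (6, 13) (9, 16), Drawn (rot 13 curve_9_45), Drawn (rot 8
  curve_9_66), Drawn (rot 2 (backwards curve_9_39)), Drawn (rot 15 (backwards curve_9_63)), Drawn (rot 15
  (backwards curve_9_65)), Drawn (rot 15 (backwards curve_9_64)), Drawn (rot 12 curve_9_43), Odd_triple (1,
  12) (5, 14) (8, 15), Drawn (rot 12 curve_9_16), Drawn (rot 12 curve_9_28), Drawn (rot 11 curve_9_20), Drawn
  (rot 11 curve_9_9), Split 4 9, Drawn (rot 14 curve_9_4), Odd_triple (1, 12) (5, 14) (9, 16), Drawn (rot 10
  curve_9_4), Odd_triple (1, 12) (6, 15) (10, 17), Drawn (rot 15 (backwards curve_9_31)), Drawn (rot 15
  (backwards curve_9_39)), Drawn (rot 15 (backwards curve_9_27)), Drawn (rot 7 (backwards curve_9_11)), Drawn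
  (rot 15 (backwards curve_9_29)), Drawn (rot 15 (backwards curve_9_32)), Drawn (rot 15 (backwards
  curve_9_28)), Odd_triple (1, 12) (6, 15) (8, 17), Drawn (rot 15 (backwards curve_9_36)), Drawn (rot 15
  (backwards curve_9_37)), Drawn (rot 15 (backwards curve_9_40)), Drawn (rot 15 (backwards curve_9_30)),
  Drawn (rot 15 (backwards curve_9_35)), Drawn (rot 15 (backwards curve_9_34)), Drawn (rot 11 curve_9_38),
  Drawn (rot 12 curve_9_33), Split 5 10, Drawn (rot 7 curve_9_31), Odd_triple (1, 12) (4, 15) (8, 17), Split
  6 11, Drawn (rot 12 curve_9_41), Drawn (rot 7 curve_9_39), Drawn (rot 11 curve_9_42), Drawn (rot 11
  curve_9_26), Split 8 13, Split 8 13, Split 4 9, Split 4 9, Drawn (rot 14 curve_9_2), Drawn (rot 14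
  curve_9_6), Drawn (rot 15 (backwards curve_9_15)), Drawn (rot 6 curve_9_21), Drawn (rot 15 (backwards
  curve_9_18)), Drawn (rot 7 (backwards curve_9_10)), Drawn (rot 15 (backwards curve_9_24)), Drawn (rot 7
  (backwards curve_9_6)), Drawn (rot 15 (backwards curve_9_17)), Drawn (rot 15 (backwards curve_9_23)), Drawn
  (rot 15 (backwards curve_9_16)), Drawn (rot 6 curve_9_22), Split 5 10, Drawn (rot 13 curve_9_3), Drawn (rot
  15 (backwards curve_9_19)), Drawn (rot 6 (backwards curve_9_12)), Drawn (rot 15 (backwards curve_9_20)),
  Split 6 11, Split 7 12, Split 5 10, Drawn (rot 13 curve_9_1), Drawn (rot 15 (backwards curve_9_25)), Drawn
  (rot 6 (backwards curve_9_14)), Drawn (rot 15 (backwards curve_9_26)), Split 6 11, Split 7 12, Split 4 9,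
  Split 4 11, Drawn (rot 15 (backwards curve_9_2)), Drawn (rot 15 (backwards curve_9_6)), Drawn (rot 15
  (backwards curve_9_4)), Split 8 13, Split 4 11, Drawn (rot 15 (backwards curve_9_1)), Drawn (rot 15
  (backwards curve_9_10)), Split 5 10, Drawn (rot 15 (backwards curve_9_3)), Odd_triple (4, 11) (6, 13) (8,
  17), Drawn (rot 15 (backwards curve_9_12)), Drawn (rot 15 (backwards curve_9_14)), Drawn (rot 15 (backwards
  curve_9_11)), Drawn (rot 15 (backwards curve_9_7)), Split 5 10, Drawn (rot 13 curve_9_5), Drawn (rot 15
  (backwards curve_9_8)), Drawn (rot 6 (backwards curve_9_13)), Drawn (rot 15 (backwards curve_9_9)), Split 6
  11, Split 7 12, Split 5 12, Split 5 12, Split 6 11, Split 6 13, Split 6 13, Split 7 12, Split 6 15, Split 6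
  15, Split 6 15, Split 6 15, Split 6 15, Split 6 15, Split 7 14, Split 7 14, Split 8 13, Split 4 13, Split 4
  13, Split 4 13, Split 4 13, Split 4 13, Split 4 13, Split 5 12, Split 5 12, Split 6 11, Split 5 14, Split 5
  14, Split 5 14, Split 5 14, Split 5 14, Split 5 14, Split 6 13, Split 6 13, Split 7 12, Split 4 9, Split 9
  14, Split 4 15, Split 4 15, Split 4 15, Split 4 15, Split 8 13, Split 4 15, Split 4 15, Split 4 15, Split 4
  15, Split 4 15, Split 4 15, Split 4 15, Split 4 15, Split 4 15, Split 4 15, Split 4 15, Split 4 15, Split 4
  15, Split 4 15, Split 4 15, Split 4 15, Split 4 15, Split 4 15, Split 4 15, Split 4 15, Split 4 15, Split 4
  15, Split 4 15, Split 4 15, Split 5 10, Split 4 15, Split 4 15, Split 4 15, Split 4 15, Split 6 11, Split 7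
  12, Split 5 14, Split 5 14, Split 5 14, Split 5 14, Split 5 14, Split 5 14, Split 6 13, Split 6 13, Split 7
  12]"
proof -
  have "search 9 3 = complete 3 15 [1, 2, 3, 4, 5, 6, 7, 8, 9, 10, 11, 12, 13, 14, 15, 16, 17] [1, 5, 7, 9, 11, 13, 15, 17] [2, 4, 6, 8, 10, 12, 14, 16] [(0, 3)]"
    by (rule search_eq; code_simp)
  then show ?thesis
    by (simp only: eval_rules verdict_rules curve_defs_9 list_all2_Cons list_all2_Nil)
qed

lemma verdicts_9_5: "list_all2 verified (search 9 5)
  [Odd_triple (3, 12) (8, 15) (10, 17), Drawn curve_9_84, Drawn curve_9_85, Odd_triple (2, 11) (7, 14) (9,
  16), Drawn (rot 1 curve_9_84), Drawn curve_9_86, Odd_triple (0, 5) (1, 8) (3, 12), Odd_triple (3, 12) (6,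
  15) (10, 17), Odd_triple (0, 5) (1, 8) (3, 14), Turned 0, Drawn (rot 1 curve_9_85), Drawn curve_9_87, Drawn
  curve_9_88, Odd_triple (0, 5) (1, 10) (3, 12), Odd_triple (0, 5) (1, 10) (3, 12), Drawn curve_9_89,
  Odd_triple (1, 10) (3, 14) (6, 15), Drawn (rot 11 curve_9_87), Odd_triple (0, 5) (1, 10) (3, 14),
  Odd_triple (1, 10) (6, 15) (8, 17), Drawn curve_9_90, Drawn curve_9_91, Drawn curve_9_92, Odd_triple (0, 5)
  (1, 10) (3, 14), Odd_triple (0, 5) (1, 10) (3, 14), Odd_triple (1, 10) (6, 13) (8, 17), Odd_triple (0, 5)
  (1, 10) (3, 16), Odd_triple (1, 10) (6, 13) (8, 15), Drawn (rot 2 curve_9_84), Odd_triple (1, 10) (2, 13)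
  (6, 15), Odd_triple (1, 10) (2, 13) (7, 14), Odd_triple (1, 10) (6, 15) (8, 17), Drawn curve_9_93, Drawn
  curve_9_94, Drawn curve_9_95, Drawn curve_9_96, Drawn (rot 9 curve_9_88), Drawn (rot 12 curve_9_88), Drawn
  (rot 11 curve_9_86), Drawn (rot 11 curve_9_85), Drawn (rot 8 curve_9_85), Odd_triple (1, 12) (6, 15) (8,
  17), Drawn (rot 4 (backwards curve_9_93)), Drawn (rot 13 (backwards curve_9_94)), Drawn (rot 4 (backwards
  curve_9_95)), Odd_triple (1, 12) (6, 15) (8, 17), Turned 7, Drawn (rot 16 curve_9_88), Drawn (rot 6
  curve_9_88), Drawn (rot 8 curve_9_86), Drawn (rot 1 curve_9_86), Odd_triple (2, 11) (4, 13) (8, 17),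
  Odd_triple (2, 11) (4, 13) (8, 15), Drawn (rot 4 curve_9_87), Drawn (rot 2 curve_9_88), Drawn (rot 15
  curve_9_86), Odd_triple (3, 10) (6, 15) (8, 17), Turned 11, Drawn (rot 4 curve_9_86)]"
proof -
  have "search 9 5 = complete 5 13 [1, 2, 3, 4, 5, 6, 7, 8, 9, 10, 11, 12, 13, 14, 15, 16, 17] [1, 3, 7, 9, 11, 13, 15, 17] [2, 4, 6, 8, 10, 12, 14, 16] [(0, 5)]"
    by (rule search_eq; code_simp)
  then show ?thesis
    by (simp only: eval_rules verdict_rules curve_defs_9 list_all2_Cons list_all2_Nil)
qed

lemma verdicts_9_7: "list_all2 verified (search 9 7)
  [Drawn curve_9_97, Drawn curve_9_98, Drawn curve_9_99, Drawn (rot 5 curve_9_99), Drawn (rot 6 curve_9_98),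
  Drawn curve_9_100]"
proof -
  have "search 9 7 = complete 7 11 [1, 2, 3, 4, 5, 6, 7, 8, 9, 10, 11, 12, 13, 14, 15, 16, 17] [1, 3, 5, 9, 11, 13, 15, 17] [2, 4, 6, 8, 10, 12, 14, 16] [(0, 7)]"
    by (rule search_eq; code_simp)
  then show ?thesis
    by (simp only: eval_rules verdict_rules curve_defs_9 list_all2_Cons list_all2_Nil)
qed

lemma verdicts_9_9: "list_all2 verified (search 9 9)
  [Drawn curve_9_101]"
proof -
  have "search 9 9 = complete 9 9 [1, 2, 3, 4, 5, 6, 7, 8, 9, 10, 11, 12, 13, 14, 15, 16, 17] [1, 3, 5, 7, 11, 13, 15, 17] [2, 4, 6, 8, 10, 12, 14, 16] [(0, 9)]"
    by (rule search_eq; code_simp)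
  then show ?thesis
    by (simp only: eval_rules verdict_rules curve_defs_9 list_all2_Cons list_all2_Nil)
qed

section \<open>Normal form up to rotation\<close>

lemma diagram_iso_trans:
  assumes "diagram_iso n g h" "diagram_iso n h k" shows "diagram_iso n g k"
proof -
  obtain e s e' s' where es: "e \<in> {1, -1}" "h = (`) (act n e s) ` g" "e' \<in> {1, -1}" "k = (`) (act n e' s') ` h"
    and g: "gauss_diagram n g" "gauss_diagram n k"
    using assms unfolding diagram_iso_act by blast
  have n: "n > 0" using g(1) by (simp add: gauss_diagram_def)
  have "act n e' s' ` act n e s ` c = act n (e' * e) (e' * s + s') ` c" for c
    by (simp add: image_image act_act[OF n])
  then have "k = (`) (act n (e' * e) (e' * s + s')) ` g" unfolding es(2,4) by (simp add: image_image)
  moreover have "e' * e \<in> {1, -1}" using es by auto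
  ultimately show ?thesis unfolding diagram_iso_act using g by blast
qed

lemma realizable_diagram_iso: "diagram_iso n g h \<Longrightarrow> realizable_diagram n h \<Longrightarrow> realizable_diagram n g"
  unfolding realizable_diagram_def using diagram_iso_trans by blast

lemma interlaced_iff_separates:
  assumes "i \<noteq> j" "x \<noteq> y" "{i, j} \<inter> {x, y} = {}"
  shows "interlaced {i, j} {x, y} \<longleftrightarrow>
    ((i < x \<and> x < j \<or> j < x \<and> x < i) \<noteq> (i < y \<and> y < j \<or> j < y \<and> y < i))"
proof (cases "i < j")
  case True
  then show ?thesis using interlaced_inside[of i j x y] assms by (auto simp: inside_def)
next
  case False
  then have "j < i" "{j, i} \<inter> {x, y} = {}" using assms by auto
  then have "interlaced {j, i} {x, y} \<longleftrightarrow> inside j i x \<noteq> inside j i y"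
    using assms(2) by (intro interlaced_inside) simp_all
  then show ?thesis using \<open>j < i\<close> unfolding insert_commute[of i j] inside_def by auto
qed

text \<open>A rotation moves the points from some point on to the front. This reverses the order exactly between a moved and an unmoved
point, and separation of two pairs on a circle is not affected.\<close>

lemma rotation_separates:
  fixes m k :: nat
  assumes "i < m" "j < m" "x < m" "y < m" "k < m" "i \<noteq> j" "x \<noteq> y" "i \<noteq> x" "i \<noteq> y" "j \<noteq> x" "j \<noteq> y"
    and r: "\<And>z. z < m \<Longrightarrow> r z = (if z + k < m then z + k else z + k - m)"
  shows "((r i < r x \<and> r x < r j \<or> r j < r x \<and> r x < r i) \<noteq> (r i < r y \<and> r y < r j \<or> r j < r y \<and> r y < r i)) \<longleftrightarrow>
    ((i < x \<and> x < j \<or> j < x \<and> x < i) \<noteq> (i < y \<and> y < j \<or> j < y \<and> y < i))"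
proof -
  have *: "r a < r b \<longleftrightarrow> (if (a + k < m) = (b + k < m) then a < b else b + k < m)" if "a < m" "b < m" for a b
  proof -
    have split: "z + k < m \<and> r z = z + k \<or> \<not> z + k < m \<and> r z + m = z + k" if "z < m" for z
      using r[OF that] by (cases "z + k < m") simp_all
    obtain p q where pq: "p = r a" "q = r b" by blast
    from split[OF that(1)] split[OF that(2)] show ?thesis using that assms(5) unfolding pq[symmetric]
      by (elim disjE conjE) (simp_all, linarith+)
  qed
  have down: "a + k < m" if "a < b" "b + k < m" for a b using that by linarith
  show ?thesis
    unfolding *[OF assms(1,3)] *[OF assms(3,2)] *[OF assms(2,3)] *[OF assms(3,1)]
      *[OF assms(1,4)] *[OF assms(4,2)] *[OF assms(2,4)] *[OF assms(4,1)]
    using assms(6-11) down[of i j] down[of j i] down[of i x] down[of x i] down[of i y] down[of y i]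
      down[of j x] down[of x j] down[of j y] down[of y j] down[of x y] down[of y x]
      linorder_less_linear[of i j] linorder_less_linear[of i x] linorder_less_linear[of i y]
      linorder_less_linear[of j x] linorder_less_linear[of j y] less_asym[of i j] less_asym[of i x]
      less_asym[of i y] less_asym[of j x] less_asym[of j y]
    by argo
qed

lemma rotation_value:
  assumes "n > 0" "k < 2 * n" "x < 2 * n"
  shows "act n 1 (int k) x = (if x + k < 2 * n then x + k else x + k - 2 * n)"
proof -
  have "act n 1 (int k) x = (x + k) mod (2 * n)"
    unfolding act_def by (metis mult_1 nat_int of_nat_add zmod_int)
  then show ?thesis using assms by (auto simp: mod_if)
qed

locale rotated =
  fixes n :: nat and t :: "nat list" and k :: nat
  assumes t: "matching t" "length t = 2 * n" "n > 0" and k: "k < 2 * n"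
begin

abbreviation \<rho> where "\<rho> \<equiv> act n 1 (int k)"

definition t' :: "nat list" where "t' = map (\<lambda>y. \<rho> (t ! (act n 1 (- int k) y))) [0..<2 * n]"

lemma \<rho>_inv: "x < 2 * n \<Longrightarrow> act n 1 (- int k) (\<rho> x) = x" "x < 2 * n \<Longrightarrow> \<rho> (act n 1 (- int k) x) = x"
  using act_inverse[OF t(3), of 1 x "int k"] act_inverse[OF t(3), of 1 x "- int k"] by simp_all

lemma \<rho>_less: "\<rho> x < 2 * n" "act n 1 (- int k) x < 2 * n"
  using act_less[OF t(3)] by auto

lemma length_t': "length t' = 2 * n" by (simp add: t'_def)

lemma t'_nth: "x < 2 * n \<Longrightarrow> t' ! \<rho> x = \<rho> (t ! x)"
  using \<rho>_less by (simp add: t'_def \<rho>_inv)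

lemma matching_t': "matching t'"
  unfolding matching_def length_t'
proof (intro allI impI)
  fix y assume "y < 2 * n"
  then obtain x where x: "x < 2 * n" "y = \<rho> x" using \<rho>_inv(2) \<rho>_less(2) by metis
  have tx: "t ! x < 2 * n" "t ! x \<noteq> x" "t ! (t ! x) = x" using matchingD[OF t(1), of x] x(1) t(2) by auto
  have "\<rho> (t ! x) \<noteq> \<rho> x" using tx x(1) \<rho>_inv(1) by metis
  then show "t' ! y < 2 * n \<and> t' ! y \<noteq> y \<and> t' ! (t' ! y) = y"
    using x tx t'_nth \<rho>_less by simp
qed

lemma image_dia: "(`) \<rho> ` chord_diagram t = chord_diagram t'"
  by (rule act_image_dia[OF t(1) matching_t' t(2) length_t' t(3)]) (use t'_nth in auto)

lemma iso: "diagram_iso n (chord_diagram t) (chord_diagram t')"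
  unfolding diagram_iso_act
  using image_dia gauss_diagram_dia[OF t] gauss_diagram_dia[OF matching_t' length_t' t(3)] by (metis insertI1)

lemma graph_iso_rotation: "graph_iso ((`) \<rho>) (interlacement_graph (chord_diagram t)) (interlacement_graph (chord_diagram t'))"
  unfolding graph_iso_def
proof (intro conjI ballI)
  have inj: "inj_on \<rho> {0..<2 * n}" using inj_on_act[OF t(3), of 1] by simp
  have sub: "c \<subseteq> {0..<2 * n}" if "c \<in> chord_diagram t" for c using dia_partition[OF t(1)] that t(2) by (auto simp: partition_on_def)
  show "bij_betw ((`) \<rho>) (verts (interlacement_graph (chord_diagram t))) (verts (interlacement_graph (chord_diagram t')))"
    unfolding bij_betw_def interlacement_graph_def using image_dia inj_on_image_eq_iff[OF inj sub sub]
    by (auto intro!: inj_onI)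
  fix c d assume "c \<in> verts (interlacement_graph (chord_diagram t))" "d \<in> verts (interlacement_graph (chord_diagram t))"
  then have cd: "c \<in> chord_diagram t" "d \<in> chord_diagram t" by (auto simp: interlacement_graph_def)
  obtain i where i: "i < 2 * n" "c = {i, t ! i}" using cd(1) t(2) by (auto simp: chord_diagram_def)
  obtain x where x: "x < 2 * n" "d = {x, t ! x}" using cd(2) t(2) by (auto simp: chord_diagram_def)
  have ti: "t ! i < 2 * n" "t ! i \<noteq> i" "t ! (t ! i) = i" using matchingD[OF t(1), of i] i t(2) by auto
  have tx: "t ! x < 2 * n" "t ! x \<noteq> x" "t ! (t ! x) = x" using matchingD[OF t(1), of x] x t(2) by auto
  have irrefl: "\<not> interlaced w w" for w unfolding interlaced_def by (auto simp: doubleton_eq_iff)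
  have "interlaced (\<rho> ` c) (\<rho> ` d) \<longleftrightarrow> interlaced c d"
  proof (cases "c = d")
    case True
    then show ?thesis using irrefl by simp
  next
    case False
    then have ne1: "i \<noteq> x" using i(2) x(2) by metis
    have ne2: "i \<noteq> t ! x"
    proof
      assume "i = t ! x"
      then have "c = {t ! x, x}" using i(2) tx(3) by metis
      then show False using False x(2) insert_commute[of x "t ! x" "{}"] by metis
    qed
    have ne3: "t ! i \<noteq> x" and ne4: "t ! i \<noteq> t ! x" using ne1 ne2 ti(3) tx(3) by metis+
    have \<rho>_ne: "\<rho> a \<noteq> \<rho> b" if "a < 2 * n" "b < 2 * n" "a \<noteq> b" for a b
      using inj that by (auto simp: inj_on_eq_iff)
    have left: "interlaced {\<rho> i, \<rho> (t ! i)} {\<rho> x, \<rho> (t ! x)} \<longleftrightarrow>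
        ((\<rho> i < \<rho> x \<and> \<rho> x < \<rho> (t ! i) \<or> \<rho> (t ! i) < \<rho> x \<and> \<rho> x < \<rho> i) \<noteq>
         (\<rho> i < \<rho> (t ! x) \<and> \<rho> (t ! x) < \<rho> (t ! i) \<or> \<rho> (t ! i) < \<rho> (t ! x) \<and> \<rho> (t ! x) < \<rho> i))"
      by (rule interlaced_iff_separates)
        (use \<rho>_ne[OF i(1) ti(1)] \<rho>_ne[OF x(1) tx(1)] \<rho>_ne[OF i(1) x(1) ne1] \<rho>_ne[OF i(1) tx(1) ne2]
          \<rho>_ne[OF ti(1) x(1) ne3] \<rho>_ne[OF ti(1) tx(1) ne4] ti(2) tx(2) in simp_all)
    have right: "interlaced {i, t ! i} {x, t ! x} \<longleftrightarrow>
        ((i < x \<and> x < t ! i \<or> t ! i < x \<and> x < i) \<noteq> (i < t ! x \<and> t ! x < t ! i \<or> t ! i < t ! x \<and> t ! x < i))"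
      by (rule interlaced_iff_separates) (use ti(2) tx(2) ne1 ne2 ne3 ne4 in simp_all)
    have "\<rho> z = (if z + k < 2 * n then z + k else z + k - 2 * n)" if "z < 2 * n" for z
      using rotation_value[OF t(3) k that] .
    then have "interlaced {\<rho> i, \<rho> (t ! i)} {\<rho> x, \<rho> (t ! x)} \<longleftrightarrow> interlaced {i, t ! i} {x, t ! x}"
      unfolding left right
      by (intro rotation_separates[of i "2 * n" "t ! i" x "t ! x" k \<rho>] i(1) x(1) ti(1) tx(1) k
          ti(2)[symmetric] tx(2)[symmetric] ne1 ne2 ne3 ne4)
    then show ?thesis using i(2) x(2) by simp
  qed
  moreover have "\<rho> ` c \<in> chord_diagram t'" "\<rho> ` d \<in> chord_diagram t'" using cd image_dia by auto
  ultimately show "adj (interlacement_graph (chord_diagram t')) (\<rho> ` c) (\<rho> ` d) \<longleftrightarrow> adj (interlacement_graph (chord_diagram t)) c d"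
    using cd by (simp add: interlacement_graph_def)
qed

end

definition gap :: "nat \<Rightarrow> nat list \<Rightarrow> nat \<Rightarrow> int" where
  "gap n t x = (int (t ! x) - int x) mod int (2 * n)"

lemma (in rotated) gap_rotation: "x < 2 * n \<Longrightarrow> gap n t' (\<rho> x) = gap n t x"
proof -
  assume x: "x < 2 * n"
  have "int (\<rho> a) = (int a + int k) mod int (2 * n)" for a using int_act[OF t(3), of 1 "int k" a] by simp
  then have "gap n t' (\<rho> x) = ((int (t ! x) + int k) mod int (2 * n) - (int x + int k) mod int (2 * n)) mod int (2 * n)"
    unfolding gap_def t'_nth[OF x] by simp
  also have "\<dots> = ((int (t ! x) + int k) - (int x + int k)) mod int (2 * n)" by (rule mod_diff_eq)
  finally show ?thesis by (simp add: gap_def)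
qed

lemma gap_swap:
  assumes "matching t" "length t = 2 * n" "x < 2 * n"
  shows "gap n t (t ! x) = int (2 * n) - gap n t x" "x < t ! x \<Longrightarrow> gap n t x = int (t ! x) - int x" "0 < gap n t x"
proof -
  have tx: "t ! x < 2 * n" "t ! x \<noteq> x" "t ! (t ! x) = x" using matchingD[OF assms(1), of x] assms by auto
  have *: "gap n t y = (if y < t ! y then int (t ! y) - int y else int (t ! y) - int y + int (2 * n))"
    if "y < 2 * n" "t ! y < 2 * n" "t ! y \<noteq> y" for y
  proof (cases "y < t ! y")
    case True
    then show ?thesis using that by (simp add: gap_def)
  next
    case False
    have "gap n t y = (int (t ! y) - int y + int (2 * n)) mod int (2 * n)" unfolding gap_def by simp
    also have "\<dots> = int (t ! y) - int y + int (2 * n)" using False that by (intro mod_pos_pos_trivial) auto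
    finally show ?thesis using False by simp
  qed
  show "gap n t (t ! x) = int (2 * n) - gap n t x" using *[of x] *[of "t ! x"] tx assms(3) by auto
  show "x < t ! x \<Longrightarrow> gap n t x = int (t ! x) - int x" "0 < gap n t x" using *[of x] tx assms(3) by auto
qed

text \<open>Rotate so that a shortest gap starts at 0. A gap of 1 would be a chord between neighbouring points, which crosses nothing,
so only the diagram with a single chord can have it.\<close>

lemma normal_form:
  assumes "gauss_diagram n g" "prime_diagram g" "B_conditions g"
  obtains t l where "matching t" "length t = 2 * n" "n > 0" "diagram_iso n g (chord_diagram t)"
    "prime_diagram (chord_diagram t)" "B_conditions (chord_diagram t)" "t ! 0 = l" "gauss_word t l (2 * n - l)" "odd l" "l \<le> n" "l = 1 \<Longrightarrow> n = 1"
proof -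
  have n: "n > 0" using assms(1) by (simp add: gauss_diagram_def)
  obtain t0 where t0: "matching t0" "length t0 = 2 * n" "g = chord_diagram t0" using gauss_diagram_is_dia[OF assms(1)] by blast
  obtain i where i: "i < 2 * n" and least: "\<And>x. x < 2 * n \<Longrightarrow> gap n t0 i \<le> gap n t0 x"
  proof -
    have "0 \<in> {..<2 * n}" using n by simp
    then have "finite (gap n t0 ` {..<2 * n})" "gap n t0 ` {..<2 * n} \<noteq> {}" by blast+
    then have "Min (gap n t0 ` {..<2 * n}) \<in> gap n t0 ` {..<2 * n}" by (rule Min_in)
    then obtain i where "i < 2 * n" "gap n t0 i = Min (gap n t0 ` {..<2 * n})" by auto
    then show thesis using that[of i] by auto
  qed
  define k where "k = (2 * n - i) mod (2 * n)"
  interpret rotated n t0 k by unfold_locales (use t0 n in \<open>auto simp: k_def\<close>)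
  have \<rho>i: "\<rho> i = 0"
  proof -
    have "\<rho> i = (i + k) mod (2 * n)" unfolding act_def by (metis mult_1 nat_int of_nat_add zmod_int)
    also have "\<dots> = (i + (2 * n - i)) mod (2 * n)" unfolding k_def by (rule mod_add_right_eq)
    also have "\<dots> = 0" using i by simp
    finally show ?thesis .
  qed
  have pos: "0 < t' ! 0" "t' ! 0 < 2 * n" using matchingD[OF matching_t', of 0] n length_t' by auto
  have gap0: "gap n t' 0 = int (t' ! 0)" using gap_swap(2)[OF matching_t' length_t', of 0] n pos by simp
  have least': "int (t' ! 0) \<le> gap n t' y" if y: "y < 2 * n" for y
  proof -
    obtain x where "x < 2 * n" "y = \<rho> x" using \<rho>_inv(2)[OF y] \<rho>_less(2) by metis
    then have "gap n t' y = gap n t0 x" using gap_rotation by simp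
    moreover have "gap n t' 0 = gap n t0 i" using gap_rotation[OF i] \<rho>i by simp
    ultimately show ?thesis using least[OF \<open>x < 2 * n\<close>] gap0 by simp
  qed
  have pr: "prime_diagram (chord_diagram t')"
    using connected_graph_iso[OF graph_iso_rotation] assms(2) simple_graph_interlacement_graph t0(3)
    unfolding prime_diagram_def by blast
  have B: "B_conditions (chord_diagram t')"
    using cond_C1_iso[OF graph_iso_rotation] cond_C2_iso[OF graph_iso_rotation] cond_B3_iso[OF graph_iso_rotation] assms(3) t0(3)
    unfolding B_conditions_def by blast
  have gw: "gauss_word t' (t' ! 0) (2 * n - t' ! 0)"
  proof
    fix x assume x: "x < t' ! x" "t' ! x < length t'"
    then have xl: "x < 2 * n" "t' ! x < 2 * n" using length_t' by auto
    have "int (t' ! 0) \<le> int (t' ! x) - int x" using least'[OF xl(1)] gap_swap(2)[OF matching_t' length_t' xl(1) x(1)] by simp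
    moreover have "int (t' ! 0) \<le> int (2 * n) - (int (t' ! x) - int x)"
      using least'[OF xl(2)] gap_swap(1,2)[OF matching_t' length_t' xl(1)] x(1) by simp
    ultimately show "x + t' ! 0 \<le> t' ! x \<and> t' ! x \<le> x + (2 * n - t' ! 0)" using pos x by linarith
  qed (use matching_t' B in \<open>auto simp: B_conditions_def\<close>)
  have "odd (t' ! 0)" using gauss_word.parity[OF gw, of 0] n length_t' by simp
  moreover have "t' ! 0 \<le> n"
    using least'[OF pos(2)] gap_swap(1)[OF matching_t' length_t', of 0] gap0 n by simp
  moreover have "n = 1" if "t' ! 0 = 1"
  proof (rule ccontr)
    assume "n \<noteq> 1"
    then have n2: "2 < 2 * n" using n by simp
    have t1: "t' ! 1 = 0" using matchingD(3)[OF matching_t', of 0] that n length_t' by simp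
    have "(x \<le> 1) = (t' ! x \<le> 1)" if "x < 2 * n" for x
    proof -
      have "t' ! (t' ! x) = x" using matchingD(3)[OF matching_t', of x] that length_t' by simp
      moreover have "z \<le> 1 \<longleftrightarrow> z = 0 \<or> z = 1" for z :: nat by auto
      ultimately show ?thesis using t1 \<open>t' ! 0 = 1\<close> by metis
    qed
    then have "justified (history t' (length t')) (Split 0 1)"
      using n2 length_t' by (auto simp: set_hist intro: exI[of _ 0] exI[of _ 2])
    then show False using split_not_prime[OF matching_t'] pr by blast
  qed
  ultimately show thesis
    using that[of t' "t' ! 0"] matching_t' length_t' n iso t0(3) pr B gw by blast
qed

definition openers_graph :: "nat list \<Rightarrow> nat list \<Rightarrow> nat graph" where
  "openers_graph t xs = \<lparr>verts = set xs, adj = (\<lambda>x y. x \<in> set xs \<and> y \<in> set xs \<and> crosses (x, t ! x) (y, t ! y))\<rparr>"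

lemma graph_iso_openers:
  assumes t: "matching t" and xs: "set xs = {x. x < length t \<and> x < t ! x}"
  shows "graph_iso (\<lambda>x. {x, t ! x}) (openers_graph t xs) (interlacement_graph (chord_diagram t))"
  unfolding graph_iso_def
proof (intro conjI ballI)
  let ?X = "{x. x < length t \<and> x < t ! x}"
  have "c \<in> (\<lambda>x. {x, t ! x}) ` ?X" if c: "c \<in> chord_diagram t" for c
  proof -
    obtain x where x: "x < length t" "c = {x, t ! x}" using c by (auto simp: chord_diagram_def)
    note m = matchingD[OF t x(1)]
    show ?thesis
    proof (cases "x < t ! x")
      case True
      then show ?thesis using x by auto
    next
      case False
      then have "t ! x \<in> ?X" "c = {t ! x, t ! (t ! x)}" using m x by auto
      then show ?thesis by (metis (no_types, lifting) image_eqI)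
    qed
  qed
  moreover have "inj_on (\<lambda>x. {x, t ! x}) ?X" by (rule inj_onI) (auto simp: doubleton_eq_iff)
  ultimately show "bij_betw (\<lambda>x. {x, t ! x}) (verts (openers_graph t xs)) (verts (interlacement_graph (chord_diagram t)))"
    unfolding bij_betw_def openers_graph_def interlacement_graph_def using xs by (auto simp: chord_diagram_def)
  fix x y assume "x \<in> verts (openers_graph t xs)" "y \<in> verts (openers_graph t xs)"
  then have "x < length t" "x < t ! x" "y < length t" "y < t ! y" "x \<in> set xs" "y \<in> set xs"
    using xs by (auto simp: openers_graph_def)
  then show "adj (interlacement_graph (chord_diagram t)) {x, t ! x} {y, t ! y} \<longleftrightarrow> adj (openers_graph t xs) x y"
    using interlaced_dia[OF t] by (auto simp: openers_graph_def interlacement_graph_def crosses_def inside_def chord_diagram_def)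
qed

section \<open>The exceptional diagram\<close>

fun even_among :: "('a \<Rightarrow> bool) \<Rightarrow> 'a list \<Rightarrow> bool" where
  "even_among p [] = True"
| "even_among p (x # xs) = (p x \<noteq> even_among p xs)"

lemma even_among: "distinct xs \<Longrightarrow> even_among p xs \<longleftrightarrow> even (card {x \<in> set xs. p x})"
proof (induction xs)
  case (Cons x xs)
  have "{y \<in> set (x # xs). p y} = (if p x then insert x {y \<in> set xs. p y} else {y \<in> set xs. p y})" by auto
  then show ?case using Cons by auto
qed simp

fun all1 :: "('a \<Rightarrow> bool) \<Rightarrow> 'a list \<Rightarrow> bool" where
  "all1 p [] = True"
| "all1 p (x # xs) = (p x \<and> all1 p xs)"

fun all2 :: "('a \<Rightarrow> 'b \<Rightarrow> bool) \<Rightarrow> 'a list \<Rightarrow> 'b list \<Rightarrow> bool" where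
  "all2 p [] ys = True"
| "all2 p (x # xs) ys = (all1 (p x) ys \<and> all2 p xs ys)"

fun all3 :: "('a \<Rightarrow> 'b \<Rightarrow> 'c \<Rightarrow> bool) \<Rightarrow> 'a list \<Rightarrow> 'b list \<Rightarrow> 'c list \<Rightarrow> bool" where
  "all3 p [] ys zs = True"
| "all3 p (x # xs) ys zs = (all2 (p x) ys zs \<and> all3 p xs ys zs)"

lemma all1_iff: "all1 p xs \<longleftrightarrow> (\<forall>x\<in>set xs. p x)"
  by (induction p xs rule: all1.induct) auto
lemma all2_iff: "all2 p xs ys \<longleftrightarrow> (\<forall>x\<in>set xs. \<forall>y\<in>set ys. p x y)"
  by (induction p xs ys rule: all2.induct) (auto simp: all1_iff)
lemma all3_iff: "all3 p xs ys zs \<longleftrightarrow> (\<forall>x\<in>set xs. \<forall>y\<in>set ys. \<forall>z\<in>set zs. p x y z)"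
  by (induction p xs ys zs rule: all3.induct) (auto simp: all2_iff)

text \<open>The chords of g0 are represented by their smaller end points.\<close>

definition g0_openers :: "nat list" where "g0_openers = [0, 1, 2, 3, 4, 6, 7, 10, 11]"

definition g0_adj :: "nat \<Rightarrow> nat \<Rightarrow> bool" where
  "g0_adj x y = crosses (x, partner0 ! x) (y, partner0 ! y)"

definition g0_red :: "nat \<Rightarrow> nat \<Rightarrow> nat \<Rightarrow> bool" where
  "g0_red v x y = (x \<noteq> v \<and> y \<noteq> v \<and> x \<noteq> y \<and>
     (g0_adj x y \<and> (\<not> g0_adj x v \<or> \<not> g0_adj y v) \<or> \<not> g0_adj x y \<and> g0_adj x v \<and> g0_adj y v))"

definition both :: "('a \<Rightarrow> 'b \<Rightarrow> bool) \<Rightarrow> 'a \<Rightarrow> 'a \<Rightarrow> 'b \<Rightarrow> bool" where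
  "both r u v w = (r u w \<and> r v w)"

definition C2_at :: "(nat \<Rightarrow> nat \<Rightarrow> bool) \<Rightarrow> nat \<Rightarrow> nat \<Rightarrow> bool" where
  "C2_at r u v = (u = v \<or> r u v \<or> even_among (both r u v) g0_openers)"

definition only_first :: "nat \<Rightarrow> nat \<Rightarrow> nat \<Rightarrow> nat \<Rightarrow> bool" where
  "only_first a b c w = (w \<noteq> a \<and> w \<noteq> b \<and> w \<noteq> c \<and> g0_adj w a \<and> \<not> g0_adj w b \<and> \<not> g0_adj w c)"
definition not_first :: "nat \<Rightarrow> nat \<Rightarrow> nat \<Rightarrow> nat \<Rightarrow> bool" where
  "not_first a b c w = (w \<noteq> a \<and> w \<noteq> b \<and> w \<noteq> c \<and> g0_adj w b \<and> g0_adj w c \<and> \<not> g0_adj w a)"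
definition B3_cond :: "bool \<Rightarrow> nat \<Rightarrow> nat \<Rightarrow> nat \<Rightarrow> bool" where
  "B3_cond p a b c = (p \<longrightarrow> even_among (only_first a b c) g0_openers = even_among (not_first a b c) g0_openers)"
definition B3_at :: "nat \<Rightarrow> nat \<Rightarrow> nat \<Rightarrow> bool" where
  "B3_at a b c = B3_cond (g0_adj a b \<and> g0_adj b c \<and> g0_adj a c) a b c"

lemma g0_adj_table:
  "g0_adj 0 1" "g0_adj 0 2" "g0_adj 0 3" "g0_adj 0 4" "g0_adj 1 0" "g0_adj 1 2" "g0_adj 1 3" "g0_adj 1 4"
  "g0_adj 1 6" "g0_adj 1 7" "g0_adj 2 0" "g0_adj 2 1" "g0_adj 2 3" "g0_adj 2 4" "g0_adj 2 6" "g0_adj 2 7"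
  "g0_adj 3 0" "g0_adj 3 1" "g0_adj 3 2" "g0_adj 3 4" "g0_adj 3 10" "g0_adj 3 11" "g0_adj 4 0" "g0_adj 4 1"
  "g0_adj 4 2" "g0_adj 4 3" "g0_adj 4 10" "g0_adj 4 11" "g0_adj 6 1" "g0_adj 6 2" "g0_adj 6 10"
  "g0_adj 6 11" "g0_adj 7 1" "g0_adj 7 2" "g0_adj 7 10" "g0_adj 7 11" "g0_adj 10 3" "g0_adj 10 4"
  "g0_adj 10 6" "g0_adj 10 7" "g0_adj 11 3" "g0_adj 11 4" "g0_adj 11 6" "g0_adj 11 7" "\<not> g0_adj 0 0"
  "\<not> g0_adj 0 6" "\<not> g0_adj 0 7" "\<not> g0_adj 0 10" "\<not> g0_adj 0 11" "\<not> g0_adj 1 1"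
  "\<not> g0_adj 1 10" "\<not> g0_adj 1 11" "\<not> g0_adj 2 2" "\<not> g0_adj 2 10" "\<not> g0_adj 2 11"
  "\<not> g0_adj 3 3" "\<not> g0_adj 3 6" "\<not> g0_adj 3 7" "\<not> g0_adj 4 4" "\<not> g0_adj 4 6"
  "\<not> g0_adj 4 7" "\<not> g0_adj 6 0" "\<not> g0_adj 6 3" "\<not> g0_adj 6 4" "\<not> g0_adj 6 6"
  "\<not> g0_adj 6 7" "\<not> g0_adj 7 0" "\<not> g0_adj 7 3" "\<not> g0_adj 7 4" "\<not> g0_adj 7 6"
  "\<not> g0_adj 7 7" "\<not> g0_adj 10 0" "\<not> g0_adj 10 1" "\<not> g0_adj 10 2" "\<not> g0_adj 10 10"
  "\<not> g0_adj 10 11" "\<not> g0_adj 11 0" "\<not> g0_adj 11 1" "\<not> g0_adj 11 2"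
  "\<not> g0_adj 11 10" "\<not> g0_adj 11 11"
  by (simp_all only: g0_adj_def partner0_def crosses_pair list_access_numeral nth_Cons_0 numeral_rules simp_thms)

lemmas table_rules = g0_adj_table all1.simps all2.simps all3.simps even_among.simps g0_openers_def numeral_rules simp_thms refl

lemma g0_checks:
  "all1 (\<lambda>v. even_among (g0_adj v) g0_openers) g0_openers"
  "all2 (C2_at g0_adj) g0_openers g0_openers"
  "all3 B3_at g0_openers g0_openers g0_openers"
  "all3 (\<lambda>v. C2_at (g0_red v)) g0_openers g0_openers g0_openers"
proof -
  show "all1 (\<lambda>v. even_among (g0_adj v) g0_openers) g0_openers" by (simp only: table_rules)
  show "all2 (C2_at g0_adj) g0_openers g0_openers" by (simp only: table_rules C2_at_def both_def)
  have "B3_cond True a b c = (even_among (only_first a b c) g0_openers = even_among (not_first a b c) g0_openers)"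
    "B3_cond False a b c = True" for a b c
    by (simp_all add: B3_cond_def)
  then show "all3 B3_at g0_openers g0_openers g0_openers"
    by (simp only: table_rules B3_at_def only_first_def not_first_def)
  show "all3 (\<lambda>v. C2_at (g0_red v)) g0_openers g0_openers g0_openers"
    by (simp only: table_rules C2_at_def both_def g0_red_def)
qed

lemma set_g0_openers: "set g0_openers = {x. x < length partner0 \<and> x < partner0 ! x}"
proof -
  have "{x. x < length partner0 \<and> x < partner0 ! x} = set (filter (\<lambda>x. x < partner0 ! x) [0..<18])"
    by (auto simp: partner0_def)
  also have "filter (\<lambda>x. x < partner0 ! x) [0..<18] = g0_openers"
    unfolding upt_18 g0_openers_def partner0_def by simp
  finally show ?thesis ..
qed

lemma g0_iso: "graph_iso (\<lambda>x. {x, partner0 ! x}) (openers_graph partner0 g0_openers) (interlacement_graph g0)"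
  unfolding g0_dia by (rule graph_iso_openers[OF matching_partner0 set_g0_openers])

lemma distinct_g0_openers: "distinct g0_openers"
  by (simp add: g0_openers_def)

lemma openers_graph_adj: "x \<in> set g0_openers \<Longrightarrow> y \<in> set g0_openers \<Longrightarrow> adj (openers_graph partner0 g0_openers) x y = g0_adj x y"
  by (simp add: openers_graph_def g0_adj_def)

lemma openers_graph_verts: "verts (openers_graph partner0 g0_openers) = set g0_openers"
  by (simp add: openers_graph_def)

lemma g0_C1: "cond_C1 (interlacement_graph g0)"
proof (rule cond_C1_iso[OF g0_iso], unfold cond_C1_def openers_graph_verts, rule ballI)
  fix v assume v: "v \<in> set g0_openers"
  have "even (card {u \<in> set g0_openers. g0_adj v u})"
    using g0_checks(1) v by (simp add: all1_iff even_among[OF distinct_g0_openers])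
  then show "even (card {u \<in> set g0_openers. adj (openers_graph partner0 g0_openers) v u})"
    using v by (simp add: openers_graph_adj cong: conj_cong)
qed

lemma g0_C2: "cond_C2 (interlacement_graph g0)"
proof (rule cond_C2_iso[OF g0_iso], unfold cond_C2_def openers_graph_verts, intro ballI impI)
  fix u v assume uv: "u \<in> set g0_openers" "v \<in> set g0_openers" "u \<noteq> v \<and> \<not> adj (openers_graph partner0 g0_openers) u v"
  then have "\<not> g0_adj u v" "u \<noteq> v" by (auto simp: openers_graph_adj)
  then have "even (card {w \<in> set g0_openers. g0_adj u w \<and> g0_adj v w})"
    using g0_checks(2) uv by (auto simp: all2_iff C2_at_def even_among[OF distinct_g0_openers] both_def)
  then show "even (card {w \<in> set g0_openers. adj (openers_graph partner0 g0_openers) u w \<and> adj (openers_graph partner0 g0_openers) v w})"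
    using uv by (simp add: openers_graph_adj cong: conj_cong)
qed

lemma g0_B3: "cond_B3 (interlacement_graph g0)"
proof (rule cond_B3_iso[OF g0_iso], unfold cond_B3_def openers_graph_verts, intro ballI impI)
  let ?G = "openers_graph partner0 g0_openers" and ?V = "set g0_openers"
  fix a b c assume abc: "a \<in> ?V" "b \<in> ?V" "c \<in> ?V" "adj ?G a b \<and> adj ?G b c \<and> adj ?G a c"
  then have "g0_adj a b \<and> g0_adj b c \<and> g0_adj a c" by (simp add: openers_graph_adj)
  then have "even (card {w \<in> ?V. only_first a b c w}) = even (card {w \<in> ?V. not_first a b c w})"
    using g0_checks(3) abc by (simp add: all3_iff B3_at_def B3_cond_def even_among[OF distinct_g0_openers])
  moreover have "{w \<in> ?V - {a, b, c}. adj ?G w a \<and> \<not> adj ?G w b \<and> \<not> adj ?G w c} = {w \<in> ?V. only_first a b c w}"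
    using abc by (auto simp: openers_graph_adj only_first_def)
  moreover have "{w \<in> ?V - {a, b, c}. adj ?G w b \<and> adj ?G w c \<and> \<not> adj ?G w a} = {w \<in> ?V. not_first a b c w}"
    using abc by (auto simp: openers_graph_adj not_first_def)
  ultimately show "even (card {w \<in> ?V - {a, b, c}. adj ?G w a \<and> \<not> adj ?G w b \<and> \<not> adj ?G w c} +
      card {w \<in> ?V - {a, b, c}. adj ?G w b \<and> adj ?G w c \<and> \<not> adj ?G w a})" by simp
qed

lemma g0_reduced_C2:
  assumes "c \<in> verts (interlacement_graph g0)" shows "cond_C2 (reduced_graph (interlacement_graph g0) c)"
proof -
  let ?G = "openers_graph partner0 g0_openers" and ?V = "set g0_openers"
  obtain v where v: "v \<in> ?V" "c = {v, partner0 ! v}"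
    using assms graph_isoD(1)[OF g0_iso] by (auto simp: openers_graph_verts)
  have vG: "v \<in> verts ?G" using v by (simp add: openers_graph_verts)
  have red: "adj (reduced_graph ?G v) x y \<longleftrightarrow> g0_red v x y" if "x \<in> ?V" "y \<in> ?V" for x y
    using that v(1) by (auto simp: reduced_graph_def g0_red_def openers_graph_verts openers_graph_adj)
  have verts: "verts (reduced_graph ?G v) = ?V - {v}" by (simp add: reduced_graph_def openers_graph_verts)
  have "cond_C2 (reduced_graph ?G v)"
    unfolding cond_C2_def verts
  proof (intro ballI impI)
    fix x y assume xy: "x \<in> ?V - {v}" "y \<in> ?V - {v}" "x \<noteq> y \<and> \<not> adj (reduced_graph ?G v) x y"
    then have "even (card {w \<in> ?V. both (g0_red v) x y w})"
      using g0_checks(4) v(1) red by (auto simp: all3_iff C2_at_def even_among[OF distinct_g0_openers])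
    moreover have "{w \<in> ?V - {v}. adj (reduced_graph ?G v) x w \<and> adj (reduced_graph ?G v) y w} = {w \<in> ?V. both (g0_red v) x y w}"
      using xy red by (auto simp: both_def g0_red_def)
    ultimately show "even (card {w \<in> ?V - {v}. adj (reduced_graph ?G v) x w \<and> adj (reduced_graph ?G v) y w})" by simp
  qed
  then show ?thesis using cond_C2_iso[OF reduced_graph_iso[OF g0_iso vG]] v(2) by simp
qed

lemma g0_prime: "prime_diagram g0"
proof -
  let ?R = "{(c, d). adj (interlacement_graph g0) c d}"
  let ?f = "\<lambda>x. {x, partner0 ! x}"
  have edge: "(?f x, ?f y) \<in> ?R" if "g0_adj x y" "x \<in> set g0_openers" "y \<in> set g0_openers" for x y
    using graph_isoD(3)[OF g0_iso, of x y] that by (simp add: openers_graph_verts openers_graph_adj)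
  have edges: "(?f 0, ?f 1) \<in> ?R" "(?f 0, ?f 2) \<in> ?R" "(?f 0, ?f 3) \<in> ?R" "(?f 0, ?f 4) \<in> ?R"
    "(?f 1, ?f 6) \<in> ?R" "(?f 1, ?f 7) \<in> ?R" "(?f 3, ?f 10) \<in> ?R" "(?f 3, ?f 11) \<in> ?R"
    by (rule edge, simp only: g0_adj_table, simp add: g0_openers_def, simp add: g0_openers_def)+
  have root: "(?f 0, ?f x) \<in> ?R\<^sup>*" if "x \<in> set g0_openers" for x
  proof -
    have "x \<in> {0, 1, 2, 3, 4, 6, 7, 10, 11}" using that by (simp add: g0_openers_def)
    then show ?thesis using edges by (blast intro: rtrancl_into_rtrancl r_into_rtrancl)
  qed
  have "sym ?R" unfolding sym_def interlacement_graph_def using interlaced_commute by auto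
  then have "sym (?R\<^sup>*)" by (rule sym_rtrancl)
  have "(c, d) \<in> ?R\<^sup>*" if cd: "c \<in> g0" "d \<in> g0" for c d
  proof -
    have "g0 = ?f ` set g0_openers"
      using graph_isoD(1)[OF g0_iso] by (simp add: interlacement_graph_def openers_graph_verts)
    then have "c \<in> ?f ` set g0_openers" "d \<in> ?f ` set g0_openers" using cd by (simp_all only:)
    then obtain x y where xy: "c = ?f x" "x \<in> set g0_openers" "d = ?f y" "y \<in> set g0_openers" by (elim imageE) simp
    have "(c, ?f 0) \<in> ?R\<^sup>*" using symD[OF \<open>sym (?R\<^sup>*)\<close> root[OF xy(2)]] xy(1) by (simp only:)
    moreover have "(?f 0, d) \<in> ?R\<^sup>*" using root[OF xy(4)] xy(3) by (simp only:)
    ultimately show ?thesis by (rule rtrancl_trans)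
  qed
  moreover have "g0 \<noteq> {}" by (simp add: g0_def)
  ultimately show ?thesis unfolding prime_diagram_def connected_graph_def by (simp add: interlacement_graph_def)
qed

lemmas verdicts = verdicts_1_1 verdicts_3_3 verdicts_4_3 verdicts_5_3 verdicts_5_5 verdicts_6_3 verdicts_6_5 verdicts_7_3 verdicts_7_5 verdicts_7_7 verdicts_8_3 verdicts_8_5 verdicts_8_7 verdicts_9_3 verdicts_9_5 verdicts_9_7 verdicts_9_9

text \<open>There is no diagram in normal form for $n = 2$, since its shortest gap would be 1.\<close>

lemma realizable_or_g0:
  assumes "gauss_diagram n g" "prime_diagram g" "B_conditions g" "n \<le> 9"
  shows "realizable_diagram n g \<or> n = 9 \<and> diagram_iso 9 g g0"
proof -
  obtain t l where t: "matching t" "length t = 2 * n" "n > 0" and iso: "diagram_iso n g (chord_diagram t)"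
    and pr: "prime_diagram (chord_diagram t)" "B_conditions (chord_diagram t)" and l: "t ! 0 = l" "gauss_word t l (2 * n - l)"
      "odd l" "l \<le> n" "l = 1 \<Longrightarrow> n = 1"
    using normal_form[OF assms(1-3)] by metis
  have "n \<in> {1, 2, 3, 4, 5, 6, 7, 8, 9}" "l \<in> {1, 3, 5, 7, 9}" using t(3) assms(4) l(3,4) by (auto, presburger)
  then have "\<exists>vs. list_all2 verified (search n l) vs"
    using l(4,5) verdicts by auto
  then obtain vs where "list_all2 verified (search n l) vs" by blast
  moreover have "history t (length t) \<in> set (search n l)" using search_complete[OF l(2) t(2,3) l(1)] t(2) by simp
  ultimately obtain v where "verified (history t (length t)) v" by (metis in_set_conv_nth list_all2_conv_all_nth)
  then have "justified (history t (length t)) v" by (rule verified_justified)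
  from verdict_sound[OF t pr this] show ?thesis
  proof
    assume "realizable_diagram n (chord_diagram t)"
    then show ?thesis using realizable_diagram_iso[OF iso] by blast
  next
    assume *: "n = 9 \<and> diagram_iso 9 (chord_diagram t) g0"
    then have "diagram_iso 9 g (chord_diagram t)" using iso by simp
    then show ?thesis using * diagram_iso_trans by blast
  qed
qed

theorem mainTheorem1:
  "(gauss_diagram 9 g0 \<and> prime_diagram g0 \<and> B_conditions g0 \<and> GL_conditions g0 \<and>
      \<not> realizable_diagram 9 g0) \<and>
   (\<forall>n g. n \<le> 8 \<and> gauss_diagram n g \<and> prime_diagram g \<and> B_conditions g \<and> GL_conditions g \<longrightarrow>
      realizable_diagram n g) \<and>
   (\<forall>g. gauss_diagram 9 g \<and> prime_diagram g \<and> B_conditions g \<and> GL_conditions g \<and>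
      \<not> realizable_diagram 9 g \<longrightarrow> diagram_iso 9 g g0)"
proof (intro conjI allI impI)
  show "gauss_diagram 9 g0" by (rule gauss_diagram_g0)
  show "prime_diagram g0" by (rule g0_prime)
  show "B_conditions g0" unfolding B_conditions_def using g0_C1 g0_C2 g0_B3 by blast
  show "GL_conditions g0" unfolding GL_conditions_def using g0_C1 g0_C2 g0_reduced_C2 by blast
  show "\<not> realizable_diagram 9 g0" by (rule g0_not_realizable)
next
  fix n g assume "n \<le> 8 \<and> gauss_diagram n g \<and> prime_diagram g \<and> B_conditions g \<and> GL_conditions g"
  then show "realizable_diagram n g" using realizable_or_g0[of n g] by auto
next
  fix g assume "gauss_diagram 9 g \<and> prime_diagram g \<and> B_conditions g \<and> GL_conditions g \<and> \<not> realizable_diagram 9 g"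
  then show "diagram_iso 9 g g0" using realizable_or_g0[of 9 g] by auto
qed

end
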